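(* Let $\mathbf{k}$ be a field, $A$ a unital $\mathbf{k}$-algebra, and let $(P,\mu_P)$ be a shifted projective bimodule resolution of $A$. Then $P$ admits a weakly counital $A_\infty$-coalgebra structure $\delta=(\delta_n)_{n\ge1}$, with weak counit $\mu_P$, such that $\delta_1=d_P$.
   Context: Conventions. $A^e=A\otimes_{\mathbf{k}}A^{op}$; $A$-bimodules are identified with $A^e$-modules, and $A$ is regarded as a complex concentrated in degree $0$. Complexes have differentials of degree $1$. All maps between graded bimodules are $A^e$-linear. The Koszul sign rule is used: $(f\otimes_A g)(x\otimes_A y)=(-1)^{|g||x|}f(x)\otimes_A g(y)$. $1$ denotes identity maps and $C^{\otimes_A 0}=A$. An $A_\infty$-coalgebra is a graded $A$-bimodule $C$ with maps $\delta_n:C\to C^{\otimes_A n}$, $n\ge 1$, of degree $1$ (put $\delta_0=0$) such that $\sum_{r+s+t=N}(1^{\otimes_A r}\otimes_A\delta_s\otimes_A 1^{\otimes_A t})\delta_{N-s+1}=0$ for all $N\ge 0$. It is weakly counital, with weak counit $\mu$, if $\mu:C\to A$ is a bimodule map of degree $-1$ with $(\mu\otimes_A\mu)\delta_2=\mu$ and $\mu^{\otimes_A n}\delta_n=0$ for all $n>2$. If $P'$ is a projective $A$-bimodule resolution of $A$ (in degrees $\le 0$), the associated shifted projective bimodule resolution is the complex $P$ with $P_{i}=P'_{i-1}$ (so $P_1=P'_0$) and differential $d_P$, together with the bimodule chain map $\mu_P:P\to A$ of degree $-1$ given by the augmentation, which is a quasi-isomorphism up to the shift. *)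

theory Defs
  imports "HOL-Algebra.AbelCoset" "HOL-Algebra.Module" "HOL-Algebra.Free_Abelian_Groups"
begin

section \<open>Algebras and bimodules\<close>

locale unital_algebra = K: field K + A: ring A + KA: module K A
  for K :: "('k, 'y) ring_scheme" (structure) and A :: "('k, 'a, 'z) module_scheme" (structure) +
  assumes smult_mult_left:
      "\<lbrakk>c \<in> carrier K; a \<in> carrier A; b \<in> carrier A\<rbrakk> \<Longrightarrow>
       (c \<odot>\<^bsub>A\<^esub> a) \<otimes>\<^bsub>A\<^esub> b = c \<odot>\<^bsub>A\<^esub> (a \<otimes>\<^bsub>A\<^esub> b)"
    and smult_mult_right:
      "\<lbrakk>c \<in> carrier K; a \<in> carrier A; b \<in> carrier A\<rbrakk> \<Longrightarrow>
       a \<otimes>\<^bsub>A\<^esub> (c \<odot>\<^bsub>A\<^esub> b) = c \<odot>\<^bsub>A\<^esub> (a \<otimes>\<^bsub>A\<^esub> b)"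

text \<open>As for modules in the library, the fields \<^const>\<open>monoid.mult\<close> and \<^const>\<open>one\<close> inherited from
  rings carry no meaning; \<^const>\<open>smult\<close> is the left action.\<close>

record ('a, 'm) bimodule = "('a, 'm) module" +
  rsmult :: "['m, 'a] \<Rightarrow> 'm" (infixl \<open>\<star>\<index>\<close> 70)

text \<open>The axiom \<open>central\<close> says that the two induced actions of the ground field coincide, so that
  these bimodules are exactly the modules over the enveloping algebra.\<close>

locale bimodule = unital_algebra K A + M: abelian_group M
  for K :: "('k, 'y) ring_scheme" (structure) and A :: "('k, 'a, 'z) module_scheme" (structure)
    and M :: "('a, 'm) bimodule" (structure) +
  assumes l_closed: "\<lbrakk>a \<in> carrier A; x \<in> carrier M\<rbrakk> \<Longrightarrow> a \<odot>\<^bsub>M\<^esub> x \<in> carrier M"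
    and r_closed: "\<lbrakk>a \<in> carrier A; x \<in> carrier M\<rbrakk> \<Longrightarrow> x \<star>\<^bsub>M\<^esub> a \<in> carrier M"
    and l_add: "\<lbrakk>a \<in> carrier A; x \<in> carrier M; y \<in> carrier M\<rbrakk> \<Longrightarrow>
      a \<odot>\<^bsub>M\<^esub> (x \<oplus>\<^bsub>M\<^esub> y) = a \<odot>\<^bsub>M\<^esub> x \<oplus>\<^bsub>M\<^esub> a \<odot>\<^bsub>M\<^esub> y"
    and r_add: "\<lbrakk>a \<in> carrier A; x \<in> carrier M; y \<in> carrier M\<rbrakk> \<Longrightarrow>
      (x \<oplus>\<^bsub>M\<^esub> y) \<star>\<^bsub>M\<^esub> a = x \<star>\<^bsub>M\<^esub> a \<oplus>\<^bsub>M\<^esub> y \<star>\<^bsub>M\<^esub> a"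
    and add_l: "\<lbrakk>a \<in> carrier A; b \<in> carrier A; x \<in> carrier M\<rbrakk> \<Longrightarrow>
      (a \<oplus>\<^bsub>A\<^esub> b) \<odot>\<^bsub>M\<^esub> x = a \<odot>\<^bsub>M\<^esub> x \<oplus>\<^bsub>M\<^esub> b \<odot>\<^bsub>M\<^esub> x"
    and add_r: "\<lbrakk>a \<in> carrier A; b \<in> carrier A; x \<in> carrier M\<rbrakk> \<Longrightarrow>
      x \<star>\<^bsub>M\<^esub> (a \<oplus>\<^bsub>A\<^esub> b) = x \<star>\<^bsub>M\<^esub> a \<oplus>\<^bsub>M\<^esub> x \<star>\<^bsub>M\<^esub> b"
    and l_assoc: "\<lbrakk>a \<in> carrier A; b \<in> carrier A; x \<in> carrier M\<rbrakk> \<Longrightarrow>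
      (a \<otimes>\<^bsub>A\<^esub> b) \<odot>\<^bsub>M\<^esub> x = a \<odot>\<^bsub>M\<^esub> (b \<odot>\<^bsub>M\<^esub> x)"
    and r_assoc: "\<lbrakk>a \<in> carrier A; b \<in> carrier A; x \<in> carrier M\<rbrakk> \<Longrightarrow>
      x \<star>\<^bsub>M\<^esub> (a \<otimes>\<^bsub>A\<^esub> b) = (x \<star>\<^bsub>M\<^esub> a) \<star>\<^bsub>M\<^esub> b"
    and l_one: "x \<in> carrier M \<Longrightarrow> \<one>\<^bsub>A\<^esub> \<odot>\<^bsub>M\<^esub> x = x"
    and r_one: "x \<in> carrier M \<Longrightarrow> x \<star>\<^bsub>M\<^esub> \<one>\<^bsub>A\<^esub> = x"
    and lr_assoc: "\<lbrakk>a \<in> carrier A; b \<in> carrier A; x \<in> carrier M\<rbrakk> \<Longrightarrow>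
      (a \<odot>\<^bsub>M\<^esub> x) \<star>\<^bsub>M\<^esub> b = a \<odot>\<^bsub>M\<^esub> (x \<star>\<^bsub>M\<^esub> b)"
    and central: "\<lbrakk>c \<in> carrier K; x \<in> carrier M\<rbrakk> \<Longrightarrow>
      (c \<odot>\<^bsub>A\<^esub> \<one>\<^bsub>A\<^esub>) \<odot>\<^bsub>M\<^esub> x = x \<star>\<^bsub>M\<^esub> (c \<odot>\<^bsub>A\<^esub> \<one>\<^bsub>A\<^esub>)"

definition bimodule_hom ::
    "('k, 'a, 'z) module_scheme \<Rightarrow> ('a, 'm) bimodule \<Rightarrow> ('a, 'n) bimodule \<Rightarrow> ('m \<Rightarrow> 'n) set"
  where "bimodule_hom A M N =
    {f. f \<in> carrier M \<rightarrow> carrier N \<and>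
        (\<forall>x\<in>carrier M. \<forall>y\<in>carrier M. f (x \<oplus>\<^bsub>M\<^esub> y) = f x \<oplus>\<^bsub>N\<^esub> f y) \<and>
        (\<forall>a\<in>carrier A. \<forall>x\<in>carrier M. f (a \<odot>\<^bsub>M\<^esub> x) = a \<odot>\<^bsub>N\<^esub> f x) \<and>
        (\<forall>a\<in>carrier A. \<forall>x\<in>carrier M. f (x \<star>\<^bsub>M\<^esub> a) = f x \<star>\<^bsub>N\<^esub> a)}"

definition regular_bimodule :: "('k, 'a, 'z) module_scheme \<Rightarrow> ('a, 'a) bimodule"
  where "regular_bimodule A =
    \<lparr>carrier = carrier A, monoid.mult = monoid.mult A, one = \<one>\<^bsub>A\<^esub>, ring.zero = \<zero>\<^bsub>A\<^esub>, add = add A,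
     smult = monoid.mult A, rsmult = monoid.mult A\<rparr>"

text \<open>Graded bimodules are families \<open>C i\<close> of bimodules indexed by the integers.\<close>

definition graded_hom :: "('k, 'a, 'z) module_scheme \<Rightarrow> int \<Rightarrow>
    (int \<Rightarrow> ('a, 'm) bimodule) \<Rightarrow> (int \<Rightarrow> ('a, 'n) bimodule) \<Rightarrow> (int \<Rightarrow> 'm \<Rightarrow> 'n) \<Rightarrow> bool"
  where "graded_hom A e C D f \<longleftrightarrow> (\<forall>i. f i \<in> bimodule_hom A (C i) (D (i + e)))"

definition in_degree_zero :: "('k, 'a, 'z) module_scheme \<Rightarrow> int \<Rightarrow> ('a, 'a) bimodule"
  where "in_degree_zero A i =
    (if i = 0 then regular_bimodule A else (regular_bimodule A)\<lparr>carrier := {\<zero>\<^bsub>A\<^esub>}\<rparr>)"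


section \<open>Projective bimodule resolutions\<close>

text \<open>A quantifier cannot range over bimodules on all types. The lifting property is therefore
  demanded against surjections \<open>M \<rightarrow> N\<close> with \<open>N\<close> on the type of \<open>P\<close> and \<open>M\<close> on a type that can
  hold the free bimodule generated by the set \<open>P\<close>. Lemma \<open>projective_bimodule_lift\<close> at the end derives
  the lifting property on arbitrary types from this.\<close>

definition projective_bimodule ::
    "('k, 'y) ring_scheme \<Rightarrow> ('k, 'a, 'z) module_scheme \<Rightarrow> ('a, 'p) bimodule \<Rightarrow> bool"
  where "projective_bimodule K A P \<longleftrightarrow> bimodule K A P \<and>
    (\<forall>(M :: ('a, ('a \<times> 'p \<times> 'a \<Rightarrow>\<^sub>0 int) set) bimodule) (N :: ('a, 'p) bimodule) g f.
       bimodule K A M \<and> bimodule K A N \<and>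
       g \<in> bimodule_hom A M N \<and> g ` carrier M = carrier N \<and> f \<in> bimodule_hom A P N \<longrightarrow>
       (\<exists>h \<in> bimodule_hom A P M. \<forall>x\<in>carrier P. g (h x) = f x))"

definition projective_resolution ::
    "('k, 'y) ring_scheme \<Rightarrow> ('k, 'a, 'z) module_scheme \<Rightarrow>
     (int \<Rightarrow> ('a, 'p) bimodule) \<Rightarrow> (int \<Rightarrow> 'p \<Rightarrow> 'p) \<Rightarrow> ('p \<Rightarrow> 'a) \<Rightarrow> bool"
  where "projective_resolution K A P d \<epsilon> \<longleftrightarrow>
    (\<forall>i. projective_bimodule K A (P i)) \<and>
    (\<forall>i>0. carrier (P i) = {\<zero>\<^bsub>P i\<^esub>}) \<and>
    graded_hom A 1 P P d \<and>
    \<epsilon> \<in> bimodule_hom A (P 0) (regular_bimodule A) \<and>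
    \<epsilon> ` carrier (P 0) = carrier A \<and>
    a_kernel (P 0) A \<epsilon> = d (-1) ` carrier (P (-1)) \<and>
    (\<forall>i<0. a_kernel (P i) (P (i + 1)) (d i) = d (i - 1) ` carrier (P (i - 1)))"

text \<open>No sign is put on the shifted differential: if \<open>(P', d', \<epsilon>)\<close> is a resolution, then so is
  \<open>(P', -d', \<epsilon>)\<close>, so both sign conventions are covered.\<close>

definition shifted_projective_resolution ::
    "('k, 'y) ring_scheme \<Rightarrow> ('k, 'a, 'z) module_scheme \<Rightarrow>
     (int \<Rightarrow> ('a, 'p) bimodule) \<Rightarrow> (int \<Rightarrow> 'p \<Rightarrow> 'p) \<Rightarrow> (int \<Rightarrow> 'p \<Rightarrow> 'a) \<Rightarrow> bool"
  where "shifted_projective_resolution K A P d \<mu> \<longleftrightarrow>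
    (\<exists>P' d' \<epsilon>. projective_resolution K A P' d' \<epsilon> \<and>
       (\<forall>i. P i = P' (i - 1)) \<and>
       (\<forall>i. \<forall>x\<in>carrier (P i). d i x = d' (i - 1) x) \<and>
       (\<forall>i. \<forall>x\<in>carrier (P i). \<mu> i x = (if i = 1 then \<epsilon> x else \<zero>\<^bsub>A\<^esub>)))"


section \<open>Tensor powers\<close>

text \<open>The abelian group with generators \<open>W\<close> and relators \<open>R\<close>.\<close>

definition presented :: "'w set \<Rightarrow> ('w \<Rightarrow>\<^sub>0 int) set \<Rightarrow> ('w \<Rightarrow>\<^sub>0 int) set ring"
  where "presented W R =
    \<lparr>carrier = rcosets\<^bsub>free_Abelian_group W\<^esub> (generate (free_Abelian_group W) R),
     monoid.mult = undefined, one = undefined,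
     ring.zero = generate (free_Abelian_group W) R,
     add = set_mult (free_Abelian_group W)\<rparr>"

definition presented_gen :: "'w set \<Rightarrow> ('w \<Rightarrow>\<^sub>0 int) set \<Rightarrow> 'w \<Rightarrow> ('w \<Rightarrow>\<^sub>0 int) set"
  where "presented_gen W R w = generate (free_Abelian_group W) R #>\<^bsub>free_Abelian_group W\<^esub> frag_of w"

text \<open>If \<open>\<phi>\<close> respects the relators, this is the additive map sending each generator \<open>w\<close> to \<open>\<phi> w\<close>.\<close>

definition presented_lift :: "('m, 'e) ring_scheme \<Rightarrow> ('w \<Rightarrow> 'm) \<Rightarrow> ('w \<Rightarrow>\<^sub>0 int) set \<Rightarrow> 'm"
  where "presented_lift M \<phi> Y =
    (THE y. \<forall>c\<in>Y. y = (\<Oplus>\<^bsub>M\<^esub>w\<in>Poly_Mapping.keys c. [Poly_Mapping.lookup c w] \<cdot>\<^bsub>M\<^esub> \<phi> w))"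

text \<open>A word \<open>[(i\<^sub>1, x\<^sub>1), \<dots>, (i\<^sub>n, x\<^sub>n)]\<close> stands for the elementary tensor of the homogeneous elements
  \<open>x\<^sub>j\<close> of degrees \<open>i\<^sub>j\<close>. The relators are additivity in each factor and balancedness over \<open>A\<close>;
  linearity over the ground field follows from them.\<close>

type_synonym 'p word = "(int \<times> 'p) list"

abbreviation word_deg :: "'p word \<Rightarrow> int"
  where "word_deg w \<equiv> sum_list (map fst w)"

definition tensor_words :: "(int \<Rightarrow> ('a, 'p) bimodule) \<Rightarrow> nat \<Rightarrow> int \<Rightarrow> 'p word set"
  where "tensor_words C n m =
    {w. length w = n \<and> word_deg w = m \<and> (\<forall>(i, x)\<in>set w. x \<in> carrier (C i))}"

definition tensor_relators ::
    "('k, 'a, 'z) module_scheme \<Rightarrow> (int \<Rightarrow> ('a, 'p) bimodule) \<Rightarrow> nat \<Rightarrow> int \<Rightarrow> ('p word \<Rightarrow>\<^sub>0 int) set"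
  where "tensor_relators A C n m =
    {frag_of (u @ (i, x \<oplus>\<^bsub>C i\<^esub> y) # v) - frag_of (u @ (i, x) # v) - frag_of (u @ (i, y) # v)
      | u i x y v. u @ (i, x) # v \<in> tensor_words C n m \<and> y \<in> carrier (C i)} \<union>
    {frag_of (u @ (i, x \<star>\<^bsub>C i\<^esub> a) # (j, y) # v) - frag_of (u @ (i, x) # (j, a \<odot>\<^bsub>C j\<^esub> y) # v)
      | u i x a j y v. u @ (i, x) # (j, y) # v \<in> tensor_words C n m \<and> a \<in> carrier A}"

abbreviation tensor ::
    "('k, 'a, 'z) module_scheme \<Rightarrow> (int \<Rightarrow> ('a, 'p) bimodule) \<Rightarrow> nat \<Rightarrow> int \<Rightarrow>
     'p word \<Rightarrow> ('p word \<Rightarrow>\<^sub>0 int) set"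
  where "tensor A C n m \<equiv> presented_gen (tensor_words C n m) (tensor_relators A C n m)"

fun lact_word :: "(int \<Rightarrow> ('a, 'p) bimodule) \<Rightarrow> 'a \<Rightarrow> 'p word \<Rightarrow> 'p word"
  where
    "lact_word C a [] = []"
  | "lact_word C a ((i, x) # w) = (i, a \<odot>\<^bsub>C i\<^esub> x) # w"

fun ract_word :: "(int \<Rightarrow> ('a, 'p) bimodule) \<Rightarrow> 'p word \<Rightarrow> 'a \<Rightarrow> 'p word"
  where
    "ract_word C [] a = []"
  | "ract_word C [(i, x)] a = [(i, x \<star>\<^bsub>C i\<^esub> a)]"
  | "ract_word C (p # q # w) a = p # ract_word C (q # w) a"

text \<open>The degree \<open>m\<close> part of the \<open>n\<close>-fold tensor power of \<open>C\<close> over \<open>A\<close>, for \<open>n \<ge> 1\<close>. For \<open>n = 0\<close> this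
  is not the algebra \<open>A\<close>; that case is never used below. For \<open>n = 1\<close> it is identified with \<open>C m\<close> through
  the one-letter words \<open>[(m, x)]\<close>.\<close>

definition tensor_power ::
    "('k, 'a, 'z) module_scheme \<Rightarrow> (int \<Rightarrow> ('a, 'p) bimodule) \<Rightarrow> nat \<Rightarrow> int \<Rightarrow>
     ('a, ('p word \<Rightarrow>\<^sub>0 int) set) bimodule"
  where "tensor_power A C n m =
    (let T = presented (tensor_words C n m) (tensor_relators A C n m) in
     \<lparr>carrier = carrier T, monoid.mult = undefined, one = undefined, ring.zero = \<zero>\<^bsub>T\<^esub>, add = add T,
      smult = (\<lambda>a. presented_lift T (\<lambda>w. tensor A C n m (lact_word C a w))),
      rsmult = (\<lambda>Y a. presented_lift T (\<lambda>w. tensor A C n m (ract_word C w a)) Y)\<rparr>)"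


section \<open>\<open>A\<^sub>\<infinity>\<close>-coalgebras\<close>

definition koszul :: "('m, 'e) ring_scheme \<Rightarrow> int \<Rightarrow> 'm \<Rightarrow> 'm"
  where "koszul M e x = (if even e then x else \<ominus>\<^bsub>M\<^esub> x)"

text \<open>\<open>splice u Y v\<close> is \<open>u \<otimes> Y \<otimes> v\<close>, for a tensor \<open>Y\<close> and words \<open>u\<close>, \<open>v\<close>.\<close>

definition splice_tensor ::
    "('k, 'a, 'z) module_scheme \<Rightarrow> (int \<Rightarrow> ('a, 'p) bimodule) \<Rightarrow> nat \<Rightarrow> int \<Rightarrow>
     'p word \<Rightarrow> ('p word \<Rightarrow>\<^sub>0 int) set \<Rightarrow> 'p word \<Rightarrow> ('p word \<Rightarrow>\<^sub>0 int) set"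
  where "splice_tensor A C n m u Y v =
    presented_lift (tensor_power A C n m) (\<lambda>z. tensor A C n m (u @ z @ v)) Y"

text \<open>The map \<open>1\<^sup>r \<otimes> f \<otimes> 1\<^sup>t\<close> on the degree \<open>m\<close> part of the tensor power with \<open>r + 1 + t\<close> factors,
  for a map \<open>f\<close> of degree 1 from \<open>C\<close> to its \<open>s\<close>-fold tensor power. The Koszul rule
  contributes \<open>-1\<close> to the total degree of the first \<open>r\<close> factors.\<close>

definition id_tensor_id ::
    "('k, 'a, 'z) module_scheme \<Rightarrow> (int \<Rightarrow> ('a, 'p) bimodule) \<Rightarrow> nat \<Rightarrow> nat \<Rightarrow> nat \<Rightarrow>
     (int \<Rightarrow> 'p \<Rightarrow> ('p word \<Rightarrow>\<^sub>0 int) set) \<Rightarrow> int \<Rightarrow>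
     ('p word \<Rightarrow>\<^sub>0 int) set \<Rightarrow> ('p word \<Rightarrow>\<^sub>0 int) set"
  where "id_tensor_id A C r s t f m =
    presented_lift (tensor_power A C (r + s + t) (m + 1))
      (\<lambda>w. koszul (tensor_power A C (r + s + t) (m + 1)) (word_deg (take r w))
        (splice_tensor A C (r + s + t) (m + 1)
          (take r w) (case w ! r of (i, x) \<Rightarrow> f i x) (drop (Suc r) w)))"

text \<open>The terms with \<open>s = 0\<close> vanish because \<open>\<delta>\<^sub>0 = 0\<close>; this leaves nothing of the relation for
  \<open>N = 0\<close>.\<close>

definition A_infinity_coalgebra ::
    "('k, 'y) ring_scheme \<Rightarrow> ('k, 'a, 'z) module_scheme \<Rightarrow> (int \<Rightarrow> ('a, 'p) bimodule) \<Rightarrow>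
     (nat \<Rightarrow> int \<Rightarrow> 'p \<Rightarrow> ('p word \<Rightarrow>\<^sub>0 int) set) \<Rightarrow> bool"
  where "A_infinity_coalgebra K A C \<delta> \<longleftrightarrow>
    (\<forall>i. bimodule K A (C i)) \<and>
    (\<forall>n\<ge>1. graded_hom A 1 C (tensor_power A C n) (\<delta> n)) \<and>
    (\<forall>N\<ge>1. \<forall>i. \<forall>x\<in>carrier (C i).
      (\<Oplus>\<^bsub>tensor_power A C N (i + 2)\<^esub> p \<in> {(r, s, t). r + s + t = N \<and> s \<ge> 1}.
        case p of (r, s, t) \<Rightarrow>
          id_tensor_id A C r s t (\<delta> s) (i + 1) (\<delta> (N - s + 1) i x))
      = \<zero>\<^bsub>tensor_power A C N (i + 2)\<^esub>)"

text \<open>For \<open>\<mu>\<close> of degree \<open>-1\<close>, the map \<open>\<mu>\<^sup>n\<close> on words, with values in \<open>A\<close> through \<open>A \<otimes> \<dots> \<otimes> A = A\<close>. In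
  \<open>\<mu> \<otimes> \<mu>\<^sup>l\<close> the factor \<open>\<mu>\<^sup>l\<close> of degree \<open>-l\<close> passes the first tensor factor.\<close>

fun counit_word :: "('k, 'a, 'z) module_scheme \<Rightarrow> (int \<Rightarrow> 'p \<Rightarrow> 'a) \<Rightarrow> 'p word \<Rightarrow> 'a"
  where
    "counit_word A \<mu> [] = \<one>\<^bsub>A\<^esub>"
  | "counit_word A \<mu> ((i, x) # w) =
      koszul A (int (length w) * i) (\<mu> i x \<otimes>\<^bsub>A\<^esub> counit_word A \<mu> w)"

definition weakly_counital_A_infinity_coalgebra ::
    "('k, 'y) ring_scheme \<Rightarrow> ('k, 'a, 'z) module_scheme \<Rightarrow> (int \<Rightarrow> ('a, 'p) bimodule) \<Rightarrow>
     (nat \<Rightarrow> int \<Rightarrow> 'p \<Rightarrow> ('p word \<Rightarrow>\<^sub>0 int) set) \<Rightarrow> (int \<Rightarrow> 'p \<Rightarrow> 'a) \<Rightarrow> bool"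
  where "weakly_counital_A_infinity_coalgebra K A C \<delta> \<mu> \<longleftrightarrow>
    A_infinity_coalgebra K A C \<delta> \<and>
    graded_hom A (-1) C (in_degree_zero A) \<mu> \<and>
    (\<forall>i. \<forall>x\<in>carrier (C i). presented_lift A (counit_word A \<mu>) (\<delta> 2 i x) = \<mu> i x) \<and>
    (\<forall>n>2. \<forall>i. \<forall>x\<in>carrier (C i).
      presented_lift A (counit_word A \<mu>) (\<delta> n i x) = \<zero>\<^bsub>A\<^esub>)"


section \<open>Well-definedness\<close>

subsection \<open>Presented abelian groups\<close>


lemma presented_add_monoid:
  "add_monoid (presented W R) = free_Abelian_group W Mod generate (free_Abelian_group W) R"
  by (simp add: presented_def FactGroup_def)

context
  fixes W :: "'w set" and R
  assumes R: "R \<subseteq> carrier (free_Abelian_group W)"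
begin

interpretation F: comm_group "free_Abelian_group W" by (rule abelian_free_Abelian_group)

lemma presented_normal: "generate (free_Abelian_group W) R \<lhd> free_Abelian_group W"
  using F.subgroup_imp_normal F.generate_is_subgroup R by blast

interpretation N: normal "generate (free_Abelian_group W) R" "free_Abelian_group W"
  by (rule presented_normal)

lemma presented_abelian_group: "abelian_group (presented W R)"
proof -
  have "comm_group (free_Abelian_group W Mod generate (free_Abelian_group W) R)"
    using F.abelian_FactGroup F.generate_is_subgroup R by blast
  then have "comm_group (add_monoid (presented W R))" by (simp only: presented_add_monoid)
  then show ?thesis
    by (intro abelian_group.intro abelian_monoid.intro abelian_group_axioms.intro)
      (auto intro: comm_group.axioms)
qed

abbreviation (input) "presented_coset c \<equiv> generate (free_Abelian_group W) R #>\<^bsub>free_Abelian_group W\<^esub> c"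

lemma presented_coset_closed: "Poly_Mapping.keys c \<subseteq> W \<Longrightarrow> presented_coset c \<in> carrier (presented W R)"
  by (auto simp: presented_def RCOSETS_def)

lemma presented_coset_hom: "presented_coset \<in> hom (free_Abelian_group W) (add_monoid (presented W R))"
  unfolding presented_add_monoid using N.r_coset_hom_Mod .

lemma presented_cases:
  assumes "Y \<in> carrier (presented W R)"
  obtains c where "Poly_Mapping.keys c \<subseteq> W" "Y = presented_coset c"
  using assms by (auto simp: presented_def RCOSETS_def)

lemma presented_gen_closed: "w \<in> W \<Longrightarrow> presented_gen W R w \<in> carrier (presented W R)"
  unfolding presented_gen_def by (rule presented_coset_closed) simp

abbreviation (input) presented_eval where "presented_eval M \<phi> c \<equiv> (\<Oplus>\<^bsub>M\<^esub>w\<in>Poly_Mapping.keys c. [Poly_Mapping.lookup c w] \<cdot>\<^bsub>M\<^esub> \<phi> w)"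

lemma hom_eq_presented_eval:
  assumes M: "abelian_group M" and h: "h \<in> hom (free_Abelian_group W) (add_monoid M)"
    and c: "Poly_Mapping.keys c \<subseteq> W"
  shows "h c = presented_eval M (\<lambda>w. h (frag_of w)) c"
proof -
  interpret M: abelian_group M by fact
  interpret h: group_hom "free_Abelian_group W" "add_monoid M" h
    by (intro group_hom.intro group_hom_axioms.intro h) (auto simp: M.add.is_group)
  have *: "Poly_Mapping.keys (\<Sum>i\<in>I. frag_cmul (poly_mapping.lookup c i) (frag_of i)) \<subseteq> W \<and> 
     h (\<Sum>i\<in>I. frag_cmul (poly_mapping.lookup c i) (frag_of i))
     = (\<Oplus>\<^bsub>M\<^esub>w\<in>I. [Poly_Mapping.lookup c w] \<cdot>\<^bsub>M\<^esub> h (frag_of w))" if "finite I" "I \<subseteq> W" for I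
    using that
  proof (induction I)
    case empty then show ?case using h.hom_one by simp
  next
    case (insert i I)
    let ?a = "frag_cmul (poly_mapping.lookup c i) (frag_of i)"
    let ?b = "\<Sum>i\<in>I. frag_cmul (poly_mapping.lookup c i) (frag_of i)"
    have ka: "Poly_Mapping.keys ?a \<subseteq> W" using insert.prems keys_cmul[of "poly_mapping.lookup c i" "frag_of i"] by auto
    have IH: "Poly_Mapping.keys ?b \<subseteq> W" "h ?b = (\<Oplus>\<^bsub>M\<^esub>w\<in>I. [Poly_Mapping.lookup c w] \<cdot>\<^bsub>M\<^esub> h (frag_of w))"
      using insert by auto
    have presented_coset: "h (frag_of w) \<in> carrier M" if "w \<in> W" for w
      using h.hom_closed[of "frag_of w"] that by simp
    have "h (?a + ?b) = h ?a \<oplus>\<^bsub>M\<^esub> h ?b" using h.hom_mult[of ?a ?b] ka IH(1) by simp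
    moreover have "h ?a = [poly_mapping.lookup c i] \<cdot>\<^bsub>M\<^esub> h (frag_of i)"
      using h.hom_int_pow[of "frag_of i" "poly_mapping.lookup c i"] insert.prems by (simp add: add_pow_def)
    moreover have "Poly_Mapping.keys (?a + ?b) \<subseteq> W" using ka IH(1) keys_add[of ?a ?b] by blast
    moreover have "(\<Oplus>\<^bsub>M\<^esub>w\<in>insert i I. [Poly_Mapping.lookup c w] \<cdot>\<^bsub>M\<^esub> h (frag_of w)) =
        [Poly_Mapping.lookup c i] \<cdot>\<^bsub>M\<^esub> h (frag_of i) \<oplus>\<^bsub>M\<^esub>
        (\<Oplus>\<^bsub>M\<^esub>w\<in>I. [Poly_Mapping.lookup c w] \<cdot>\<^bsub>M\<^esub> h (frag_of w))"
      using insert.prems insert.hyps presented_coset by (intro M.finsum_insert) (auto intro!: M.add.int_pow_closed)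
    ultimately show ?case using insert.hyps IH by simp
  qed
  have "c = (\<Sum>i\<in>Poly_Mapping.keys c. frag_cmul (poly_mapping.lookup c i) (frag_of i))"
    using frag_expansion[of c] by (simp add: frag_extend_def)
  with *[of "Poly_Mapping.keys c"] c show ?thesis by simp
qed

lemma presented_eval_hom:
  assumes M: "abelian_group M" and \<phi>: "\<phi> ` W \<subseteq> carrier M"
  obtains h where "h \<in> hom (free_Abelian_group W) (add_monoid M)" 
    "\<And>w. w \<in> W \<Longrightarrow> h (frag_of w) = \<phi> w" "\<And>c. Poly_Mapping.keys c \<subseteq> W \<Longrightarrow> h c = presented_eval M \<phi> c"
proof -
  interpret M: abelian_group M by fact
  obtain h where h: "h \<in> hom (free_Abelian_group W) (add_monoid M)" 
    "\<And>w. w \<in> W \<Longrightarrow> h (frag_of w) = \<phi> w"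
    using M.add.free_Abelian_group_universal[of \<phi> W] \<phi> by auto
  have "h c = presented_eval M \<phi> c" if c: "Poly_Mapping.keys c \<subseteq> W" for c
    unfolding hom_eq_presented_eval[OF M h(1) c] using c h \<phi>
    by (intro M.finsum_cong) (auto simp: simp_implies_def subset_iff Pi_def intro!: M.add.int_pow_closed)
  with h that show thesis by blast
qed

lemma presented_lift_coset:
  assumes M: "abelian_group M" and h: "h \<in> hom (free_Abelian_group W) (add_monoid M)"
    and \<phi>: "\<And>w. w \<in> W \<Longrightarrow> h (frag_of w) = \<phi> w"
    and R0: "\<And>r. r \<in> R \<Longrightarrow> h r = \<zero>\<^bsub>M\<^esub>"
    and c: "Poly_Mapping.keys c \<subseteq> W"
  shows "presented_lift M \<phi> (presented_coset c) = h c"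
proof -
  interpret M: abelian_group M by fact
  interpret h: group_hom "free_Abelian_group W" "add_monoid M" h
    by (intro group_hom.intro group_hom_axioms.intro h) (auto simp: M.add.is_group)
  have Nk: "generate (free_Abelian_group W) R \<subseteq> kernel (free_Abelian_group W) (add_monoid M) h"
    using R R0 by (intro F.generate_subgroup_incl h.subgroup_kernel) (auto simp: kernel_def simp del: carrier_free_Abelian_group_iff)
  have evc: "presented_eval M \<phi> c' = h c'" if "Poly_Mapping.keys c' \<subseteq> W" for c'
  proof -
    have \<phi>c: "\<phi> w \<in> carrier M" if "w \<in> W" for w
      using h.hom_closed[of "frag_of w"] \<phi>[OF that] that by simp
    have "h c' = presented_eval M (\<lambda>w. h (frag_of w)) c'" by (rule hom_eq_presented_eval[OF M h that])
    also have "\<dots> = presented_eval M \<phi> c'"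
      using \<phi> that \<phi>c
      by (intro M.finsum_cong) (auto simp: simp_implies_def subset_iff Pi_def intro!: M.add.int_pow_closed)
    finally show ?thesis by simp
  qed
  have *: "h c' = h c" "Poly_Mapping.keys c' \<subseteq> W" if c': "c' \<in> presented_coset c" for c'
  proof -
    obtain n where n: "n \<in> generate (free_Abelian_group W) R" "c' = n + c"
      using c' by (auto simp: r_coset_def)
    then have "Poly_Mapping.keys n \<subseteq> W" "h n = \<zero>\<^bsub>M\<^esub>" using Nk by (auto simp: kernel_def dest!: subsetD)
    then show "h c' = h c" "Poly_Mapping.keys c' \<subseteq> W" using h.hom_mult[of n c] c n keys_add[of n c] h.hom_closed[of c]
      by auto
  qed
  have "c \<in> presented_coset c" using F.rcos_self[of c] F.generate_is_subgroup[OF R] c by simp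
  then show ?thesis unfolding presented_lift_def
    using * evc by (intro the_equality) (metis | auto)+
qed

lemma presented_lift:
  assumes M: "abelian_group M" and \<phi>: "\<phi> ` W \<subseteq> carrier M"
    and R0: "\<And>r. r \<in> R \<Longrightarrow> presented_eval M \<phi> r = \<zero>\<^bsub>M\<^esub>"
  shows "presented_lift M \<phi> \<in> hom (add_monoid (presented W R)) (add_monoid M)"
    and "w \<in> W \<Longrightarrow> presented_lift M \<phi> (presented_gen W R w) = \<phi> w"
proof -
  interpret M: abelian_group M by fact
  obtain h where h: "h \<in> hom (free_Abelian_group W) (add_monoid M)" 
    "\<And>w. w \<in> W \<Longrightarrow> h (frag_of w) = \<phi> w" "\<And>c. Poly_Mapping.keys c \<subseteq> W \<Longrightarrow> h c = presented_eval M \<phi> c"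
    by (rule presented_eval_hom[OF M \<phi>]) blast
  have h0: "h r = \<zero>\<^bsub>M\<^esub>" if "r \<in> R" for r using R0[OF that] h(3)[of r] that R by auto
  note L = presented_lift_coset[OF M h(1,2) h0]
  show "w \<in> W \<Longrightarrow> presented_lift M \<phi> (presented_gen W R w) = \<phi> w"
    unfolding presented_gen_def using L[of "frag_of w"] h(2) by simp
  show "presented_lift M \<phi> \<in> hom (add_monoid (presented W R)) (add_monoid M)"
  proof (rule homI; simp)
    fix Y Z assume "Y \<in> carrier (presented W R)" "Z \<in> carrier (presented W R)"
    then obtain y z where y: "Poly_Mapping.keys y \<subseteq> W" "Y = presented_coset y" and z: "Poly_Mapping.keys z \<subseteq> W" "Z = presented_coset z"
      by (metis presented_cases)
    have yz: "Poly_Mapping.keys (y + z) \<subseteq> W" using y z keys_add[of y z] by blast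
    have "Y \<oplus>\<^bsub>presented W R\<^esub> Z = presented_coset (y + z)"
      using presented_coset_hom y z unfolding hom_def by auto
    then show "presented_lift M \<phi> (Y \<oplus>\<^bsub>presented W R\<^esub> Z) =
       presented_lift M \<phi> Y \<oplus>\<^bsub>M\<^esub> presented_lift M \<phi> Z"
      using L y z yz h(1) by (auto simp: hom_def)
  next
    fix Y assume "Y \<in> carrier (presented W R)"
    then obtain y where y: "Poly_Mapping.keys y \<subseteq> W" "Y = presented_coset y" by (metis presented_cases)
    then show "presented_lift M \<phi> Y \<in> carrier M" using L h(1) by (auto simp: hom_def)
  qed
qed

lemma presented_hom_eq:
  assumes M: "abelian_group M"
    and f: "f \<in> hom (add_monoid (presented W R)) (add_monoid M)"
    and g: "g \<in> hom (add_monoid (presented W R)) (add_monoid M)"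
    and fg: "\<And>w. w \<in> W \<Longrightarrow> f (presented_gen W R w) = g (presented_gen W R w)"
    and Y: "Y \<in> carrier (presented W R)"
  shows "f Y = g Y"
proof -
  obtain y where y: "Poly_Mapping.keys y \<subseteq> W" "Y = presented_coset y" using Y by (rule presented_cases)
  have 1: "(\<lambda>c. f (presented_coset c)) \<in> hom (free_Abelian_group W) (add_monoid M)"
    using hom_compose[OF presented_coset_hom f] by (simp add: comp_def)
  have 2: "(\<lambda>c. g (presented_coset c)) \<in> hom (free_Abelian_group W) (add_monoid M)"
    using hom_compose[OF presented_coset_hom g] by (simp add: comp_def)
  interpret M: abelian_group M by fact
  have "f (presented_coset y) = presented_eval M (\<lambda>w. f (presented_gen W R w)) y" using hom_eq_presented_eval[OF M 1 y(1)] unfolding presented_gen_def .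
  also have "\<dots> = presented_eval M (\<lambda>w. g (presented_gen W R w)) y"
    using fg y(1) g presented_gen_closed
    by (intro M.finsum_cong) (auto simp: hom_def simp_implies_def subset_iff Pi_def intro!: M.add.int_pow_closed)
  also have "\<dots> = g (presented_coset y)" using hom_eq_presented_eval[OF M 2 y(1)] unfolding presented_gen_def by simp
  finally show ?thesis using y by simp
qed

lemma presented_coset_relator:
  assumes h: "r \<in> R" shows "presented_coset r = \<zero>\<^bsub>presented W R\<^esub>"
  using N.rcos_const[of r] generate.incl[OF h] F.coset_join2 R h F.generate_is_subgroup[OF R]
  by (auto simp: presented_def)


lemma hom_free_diff:
  assumes M: "abelian_group M" and h: "h \<in> hom (free_Abelian_group W) (add_monoid M)"
    and "Poly_Mapping.keys x \<subseteq> W" "Poly_Mapping.keys y \<subseteq> W"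
  shows "h (x - y) = h x \<ominus>\<^bsub>M\<^esub> h y"
proof -
  interpret M: abelian_group M by fact
  interpret h: group_hom "free_Abelian_group W" "add_monoid M" h
    by (intro group_hom.intro group_hom_axioms.intro h) (auto simp: M.add.is_group)
  have "Poly_Mapping.keys (x - y) \<subseteq> W" using assms(3,4) keys_diff[of x y] by blast
  then have "h (x - y) \<oplus>\<^bsub>M\<^esub> h y = h x" "h (x - y) \<in> carrier M" "h y \<in> carrier M" "h x \<in> carrier M"
    using h.hom_mult[of "x - y" y] h.hom_closed assms(3,4) by auto
  then show ?thesis by (metis M.add.inv_solve_right M.minus_eq)
qed

lemma presented_lift_hom:
  assumes M: "abelian_group M" and \<phi>: "\<And>w. w \<in> W \<Longrightarrow> \<phi> w \<in> carrier M"
    and R0: "\<And>r h. \<lbrakk>r \<in> R; h \<in> hom (free_Abelian_group W) (add_monoid M);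
       \<And>w. w \<in> W \<Longrightarrow> h (frag_of w) = \<phi> w\<rbrakk> \<Longrightarrow> h r = \<zero>\<^bsub>M\<^esub>"
  shows "presented_lift M \<phi> \<in> hom (add_monoid (presented W R)) (add_monoid M)"
    and "w \<in> W \<Longrightarrow> presented_lift M \<phi> (presented_gen W R w) = \<phi> w"
proof -
  have \<phi>': "\<phi> ` W \<subseteq> carrier M" using \<phi> by auto
  obtain h where h: "h \<in> hom (free_Abelian_group W) (add_monoid M)" 
    "\<And>w. w \<in> W \<Longrightarrow> h (frag_of w) = \<phi> w" "\<And>c. Poly_Mapping.keys c \<subseteq> W \<Longrightarrow> h c = presented_eval M \<phi> c"
    by (rule presented_eval_hom[OF M \<phi>']) blast
  have "presented_eval M \<phi> r = \<zero>\<^bsub>M\<^esub>" if "r \<in> R" for r using R0[OF that h(1,2)] h(3)[of r] that R by auto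
  note L = presented_lift[OF M \<phi>' this]
  from L show "presented_lift M \<phi> \<in> hom (add_monoid (presented W R)) (add_monoid M)"
    and "w \<in> W \<Longrightarrow> presented_lift M \<phi> (presented_gen W R w) = \<phi> w" by auto
qed

lemma presented_gen_eq:
  assumes "frag_of u - frag_of v \<in> R" "u \<in> W" "v \<in> W"
  shows "presented_gen W R u = presented_gen W R v"
proof -
  interpret T: abelian_group "presented W R" by (rule presented_abelian_group)
  have "presented_coset (frag_of u - frag_of v) = presented_gen W R u \<ominus>\<^bsub>presented W R\<^esub> presented_gen W R v"
    unfolding presented_gen_def using hom_free_diff[OF presented_abelian_group presented_coset_hom] assms(2,3) by simp
  then show ?thesis using presented_coset_relator[OF assms(1)] presented_gen_closed assms by (metis T.minus_eq T.add.inv_solve_right T.add.l_one T.zero_closed)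
qed

lemma presented_gen_add:
  assumes "frag_of u - frag_of v - frag_of w \<in> R" "u \<in> W" "v \<in> W" "w \<in> W"
  shows "presented_gen W R u = presented_gen W R v \<oplus>\<^bsub>presented W R\<^esub> presented_gen W R w"
proof -
  interpret T: abelian_group "presented W R" by (rule presented_abelian_group)
  have k: "Poly_Mapping.keys (frag_of u - frag_of v) \<subseteq> W"
    using assms keys_diff[of "frag_of u" "frag_of v"] by auto
  have "presented_coset (frag_of u - frag_of v - frag_of w) =
     presented_gen W R u \<ominus>\<^bsub>presented W R\<^esub> presented_gen W R v \<ominus>\<^bsub>presented W R\<^esub> presented_gen W R w"
    unfolding presented_gen_def using hom_free_diff[OF presented_abelian_group presented_coset_hom] assms(2-4) k by simp
  then have "\<zero>\<^bsub>presented W R\<^esub> = presented_gen W R u \<ominus>\<^bsub>presented W R\<^esub> presented_gen W R v \<ominus>\<^bsub>presented W R\<^esub> presented_gen W R w"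
    using presented_coset_relator[OF assms(1)] by simp
  moreover have "x \<ominus>\<^bsub>presented W R\<^esub> y \<ominus>\<^bsub>presented W R\<^esub> z \<oplus>\<^bsub>presented W R\<^esub> z \<oplus>\<^bsub>presented W R\<^esub> y = x"
    if "x \<in> carrier (presented W R)" "y \<in> carrier (presented W R)" "z \<in> carrier (presented W R)" for x y z
    using that by (simp add: T.minus_eq T.a_assoc T.l_neg)
  ultimately have "presented_gen W R u = \<zero>\<^bsub>presented W R\<^esub> \<oplus>\<^bsub>presented W R\<^esub> presented_gen W R w
      \<oplus>\<^bsub>presented W R\<^esub> presented_gen W R v"
    using presented_gen_closed assms(2-4) by metis
  then show ?thesis using presented_gen_closed assms(2-4) by (simp add: T.a_comm)
qed

lemma presented_bimodule:
  fixes K :: "('k, 'y) ring_scheme" and A :: "('k, 'a, 'z) module_scheme"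
    and lw :: "'a \<Rightarrow> 'w \<Rightarrow> 'w" and rw :: "'w \<Rightarrow> 'a \<Rightarrow> 'w"
  defines "T \<equiv> presented W R" and "g \<equiv> presented_gen W R"
  defines "B \<equiv> \<lparr>carrier = carrier T, monoid.mult = undefined, one = undefined, ring.zero = \<zero>\<^bsub>T\<^esub>, add = add T,
      smult = (\<lambda>a. presented_lift T (\<lambda>w. g (lw a w))),
      rsmult = (\<lambda>Y a. presented_lift T (\<lambda>w. g (rw w a)) Y)\<rparr>"
  assumes A: "unital_algebra K A"
   and lwc: "\<And>a w. \<lbrakk>a \<in> carrier A; w \<in> W\<rbrakk> \<Longrightarrow> lw a w \<in> W"
   and rwc: "\<And>a w. \<lbrakk>a \<in> carrier A; w \<in> W\<rbrakk> \<Longrightarrow> rw w a \<in> W"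
   and lR: "\<And>a r h. \<lbrakk>a \<in> carrier A; r \<in> R; h \<in> hom (free_Abelian_group W) (add_monoid T);
       \<And>w. w \<in> W \<Longrightarrow> h (frag_of w) = g (lw a w)\<rbrakk> \<Longrightarrow> h r = \<zero>\<^bsub>T\<^esub>"
   and rR: "\<And>a r h. \<lbrakk>a \<in> carrier A; r \<in> R; h \<in> hom (free_Abelian_group W) (add_monoid T);
       \<And>w. w \<in> W \<Longrightarrow> h (frag_of w) = g (rw w a)\<rbrakk> \<Longrightarrow> h r = \<zero>\<^bsub>T\<^esub>"
   and l1: "\<And>w. w \<in> W \<Longrightarrow> g (lw \<one>\<^bsub>A\<^esub> w) = g w"
   and r1: "\<And>w. w \<in> W \<Longrightarrow> g (rw w \<one>\<^bsub>A\<^esub>) = g w"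
   and la: "\<And>a b w. \<lbrakk>a \<in> carrier A; b \<in> carrier A; w \<in> W\<rbrakk> \<Longrightarrow> g (lw (a \<otimes>\<^bsub>A\<^esub> b) w) = g (lw a (lw b w))"
   and ra: "\<And>a b w. \<lbrakk>a \<in> carrier A; b \<in> carrier A; w \<in> W\<rbrakk> \<Longrightarrow> g (rw w (a \<otimes>\<^bsub>A\<^esub> b)) = g (rw (rw w a) b)"
   and lra: "\<And>a b w. \<lbrakk>a \<in> carrier A; b \<in> carrier A; w \<in> W\<rbrakk> \<Longrightarrow> g (rw (lw a w) b) = g (lw a (rw w b))"
   and lp: "\<And>a b w. \<lbrakk>a \<in> carrier A; b \<in> carrier A; w \<in> W\<rbrakk> \<Longrightarrow> g (lw (a \<oplus>\<^bsub>A\<^esub> b) w) = g (lw a w) \<oplus>\<^bsub>T\<^esub> g (lw b w)"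
   and rp: "\<And>a b w. \<lbrakk>a \<in> carrier A; b \<in> carrier A; w \<in> W\<rbrakk> \<Longrightarrow> g (rw w (a \<oplus>\<^bsub>A\<^esub> b)) = g (rw w a) \<oplus>\<^bsub>T\<^esub> g (rw w b)"
   and cen: "\<And>c w. \<lbrakk>c \<in> carrier K; w \<in> W\<rbrakk> \<Longrightarrow> g (lw (c \<odot>\<^bsub>A\<^esub> \<one>\<^bsub>A\<^esub>) w) = g (rw w (c \<odot>\<^bsub>A\<^esub> \<one>\<^bsub>A\<^esub>))"
  shows "bimodule K A B"
    and "\<And>a w. \<lbrakk>a \<in> carrier A; w \<in> W\<rbrakk> \<Longrightarrow> a \<odot>\<^bsub>B\<^esub> g w = g (lw a w)"
    and "\<And>a w. \<lbrakk>a \<in> carrier A; w \<in> W\<rbrakk> \<Longrightarrow> g w \<star>\<^bsub>B\<^esub> a = g (rw w a)"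
proof -
  interpret A: unital_algebra K A by fact
  have T: "abelian_group T" unfolding T_def by (rule presented_abelian_group)
  interpret T: abelian_group T by fact
  have gc: "g w \<in> carrier T" if "w \<in> W" for w using that presented_gen_closed by (simp add: g_def T_def)
  define L where "L a = presented_lift T (\<lambda>w. g (lw a w))" for a
  define Q where "Q a = presented_lift T (\<lambda>w. g (rw w a))" for a
  have Lh: "L a \<in> hom (add_monoid T) (add_monoid T)" if "a \<in> carrier A" for a
    unfolding L_def using that lwc gc lR presented_lift_hom(1)[OF T, of "\<lambda>w. g (lw a w)"] by (simp add: T_def)
  have Qh: "Q a \<in> hom (add_monoid T) (add_monoid T)" if "a \<in> carrier A" for a
    unfolding Q_def using that rwc gc rR presented_lift_hom(1)[OF T, of "\<lambda>w. g (rw w a)"] by (simp add: T_def)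
  have Lg: "L a (g w) = g (lw a w)" if "a \<in> carrier A" "w \<in> W" for a w
    unfolding L_def using that lwc gc lR presented_lift_hom(2)[OF T, of "\<lambda>w. g (lw a w)" w] by (simp add: T_def g_def)
  have Qg: "Q a (g w) = g (rw w a)" if "a \<in> carrier A" "w \<in> W" for a w
    unfolding Q_def using that rwc gc rR presented_lift_hom(2)[OF T, of "\<lambda>w. g (rw w a)" w] by (simp add: T_def g_def)
  have B: "carrier B = carrier T" "\<zero>\<^bsub>B\<^esub> = \<zero>\<^bsub>T\<^esub>" "add B = add T" "smult B = L" "rsmult B = (\<lambda>Y a. Q a Y)"
    unfolding B_def L_def Q_def by auto
  have Lc: "L a x \<in> carrier T" "Q a x \<in> carrier T" if "a \<in> carrier A" "x \<in> carrier T" for a x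
    using Lh[OF that(1)] Qh[OF that(1)] that(2) by (auto simp: hom_def)
  have Lp: "L a (x \<oplus>\<^bsub>T\<^esub> y) = L a x \<oplus>\<^bsub>T\<^esub> L a y" "Q a (x \<oplus>\<^bsub>T\<^esub> y) = Q a x \<oplus>\<^bsub>T\<^esub> Q a y"
    if "a \<in> carrier A" "x \<in> carrier T" "y \<in> carrier T" for a x y
    using Lh[OF that(1)] Qh[OF that(1)] that(2,3) by (auto simp: hom_def)
  have eqI: "f x = f' x" if "f \<in> hom (add_monoid T) (add_monoid T)" "f' \<in> hom (add_monoid T) (add_monoid T)"
    "\<And>w. w \<in> W \<Longrightarrow> f (g w) = f' (g w)" "x \<in> carrier T" for f f' x
    using presented_hom_eq[OF T, of f f' x] that unfolding T_def g_def by blast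
  have comp: "(\<lambda>x. f (f' x)) \<in> hom (add_monoid T) (add_monoid T)"
    if "f \<in> hom (add_monoid T) (add_monoid T)" "f' \<in> hom (add_monoid T) (add_monoid T)" for f f'
    using hom_compose[OF that(2,1)] by (simp add: comp_def)
  have plus: "(\<lambda>x. f x \<oplus>\<^bsub>T\<^esub> f' x) \<in> hom (add_monoid T) (add_monoid T)"
    if "f \<in> hom (add_monoid T) (add_monoid T)" "f' \<in> hom (add_monoid T) (add_monoid T)" for f f'
    using that by (auto simp: hom_def Pi_def T.a_ac)
  have id: "(\<lambda>x. x) \<in> hom (add_monoid T) (add_monoid T)" by (auto simp: hom_def)
  show "bimodule K A B"
  proof (intro bimodule.intro bimodule_axioms.intro A)
    show "abelian_group B"
    proof (rule abelian_groupI; unfold B)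
      show "\<exists>y\<in>carrier T. y \<oplus>\<^bsub>T\<^esub> x = \<zero>\<^bsub>T\<^esub>" if "x \<in> carrier T" for x
        using T.l_neg[OF that] T.a_inv_closed[OF that] by blast
    qed (simp_all add: T.a_ac)
  next
    fix a b x assume *: "a \<in> carrier A" "b \<in> carrier A" "x \<in> carrier B"
    then have x: "x \<in> carrier T" and ab: "a \<oplus>\<^bsub>A\<^esub> b \<in> carrier A" "a \<otimes>\<^bsub>A\<^esub> b \<in> carrier A"
      by (simp_all add: B)
    show "(a \<oplus>\<^bsub>A\<^esub> b) \<odot>\<^bsub>B\<^esub> x = a \<odot>\<^bsub>B\<^esub> x \<oplus>\<^bsub>B\<^esub> b \<odot>\<^bsub>B\<^esub> x" unfolding B
      by (rule eqI[OF Lh[OF ab(1)] plus[OF Lh[OF *(1)] Lh[OF *(2)]] _ x]) (simp add: Lg lp * ab)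
    show "x \<star>\<^bsub>B\<^esub> (a \<oplus>\<^bsub>A\<^esub> b) = x \<star>\<^bsub>B\<^esub> a \<oplus>\<^bsub>B\<^esub> x \<star>\<^bsub>B\<^esub> b" unfolding B
      by (rule eqI[OF Qh[OF ab(1)] plus[OF Qh[OF *(1)] Qh[OF *(2)]] _ x]) (simp add: Qg rp * ab)
    show "(a \<otimes>\<^bsub>A\<^esub> b) \<odot>\<^bsub>B\<^esub> x = a \<odot>\<^bsub>B\<^esub> (b \<odot>\<^bsub>B\<^esub> x)" unfolding B
      by (rule eqI[OF Lh[OF ab(2)] comp[OF Lh[OF *(1)] Lh[OF *(2)]] _ x]) (simp add: Lg la lwc * ab)
    show "x \<star>\<^bsub>B\<^esub> (a \<otimes>\<^bsub>A\<^esub> b) = (x \<star>\<^bsub>B\<^esub> a) \<star>\<^bsub>B\<^esub> b" unfolding B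
      by (rule eqI[OF Qh[OF ab(2)] comp[OF Qh[OF *(2)] Qh[OF *(1)]] _ x]) (simp add: Qg ra rwc * ab)
    show "(a \<odot>\<^bsub>B\<^esub> x) \<star>\<^bsub>B\<^esub> b = a \<odot>\<^bsub>B\<^esub> (x \<star>\<^bsub>B\<^esub> b)" unfolding B
      by (rule eqI[OF comp[OF Qh[OF *(2)] Lh[OF *(1)]] comp[OF Lh[OF *(1)] Qh[OF *(2)]] _ x])
        (simp add: Lg Qg lra lwc rwc * ab)
  next
    fix c x assume *: "c \<in> carrier K" "x \<in> carrier B"
    then have x: "x \<in> carrier T" and c: "c \<odot>\<^bsub>A\<^esub> \<one>\<^bsub>A\<^esub> \<in> carrier A" by (simp_all add: B)
    show "(c \<odot>\<^bsub>A\<^esub> \<one>\<^bsub>A\<^esub>) \<odot>\<^bsub>B\<^esub> x = x \<star>\<^bsub>B\<^esub> (c \<odot>\<^bsub>A\<^esub> \<one>\<^bsub>A\<^esub>)" unfolding B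
      by (rule eqI[OF Lh[OF c] Qh[OF c] _ x]) (simp add: Lg Qg cen c *)
  next
    fix x assume "x \<in> carrier B"
    then have x: "x \<in> carrier T" by (simp add: B)
    show "\<one>\<^bsub>A\<^esub> \<odot>\<^bsub>B\<^esub> x = x" unfolding B
      by (rule eqI[OF Lh[OF A.A.one_closed] id _ x]) (simp add: Lg l1)
    show "x \<star>\<^bsub>B\<^esub> \<one>\<^bsub>A\<^esub> = x" unfolding B
      by (rule eqI[OF Qh[OF A.A.one_closed] id _ x]) (simp add: Qg r1)
  qed (auto simp: B Lc Lp)
  show "\<And>a w. \<lbrakk>a \<in> carrier A; w \<in> W\<rbrakk> \<Longrightarrow> a \<odot>\<^bsub>B\<^esub> g w = g (lw a w)"
    and "\<And>a w. \<lbrakk>a \<in> carrier A; w \<in> W\<rbrakk> \<Longrightarrow> g w \<star>\<^bsub>B\<^esub> a = g (rw w a)"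
    by (auto simp: B Lg Qg)
qed

end


subsection \<open>Tensor powers are bimodules\<close>

lemma tensor_words_iff: "w \<in> tensor_words C n m \<longleftrightarrow>
   length w = n \<and> word_deg w = m \<and> list_all (\<lambda>(i, x). x \<in> carrier (C i)) w"
  by (auto simp: tensor_words_def list_all_iff)

lemma additivity_relator: "u @ (i, x) # v \<in> tensor_words C n m \<Longrightarrow> y \<in> carrier (C i) \<Longrightarrow>
  frag_of (u @ (i, x \<oplus>\<^bsub>C i\<^esub> y) # v) - frag_of (u @ (i, x) # v) - frag_of (u @ (i, y) # v) \<in> tensor_relators A C n m"
  unfolding tensor_relators_def by blast

lemma balance_relator: "u @ (i, x) # (j, y) # v \<in> tensor_words C n m \<Longrightarrow> a \<in> carrier A \<Longrightarrow>
  frag_of (u @ (i, x \<star>\<^bsub>C i\<^esub> a) # (j, y) # v) - frag_of (u @ (i, x) # (j, a \<odot>\<^bsub>C j\<^esub> y) # v) \<in> tensor_relators A C n m"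
  unfolding tensor_relators_def by blast


context
  fixes K :: "('k, 'y) ring_scheme" and A :: "('k, 'a, 'z) module_scheme"
    and C :: "int \<Rightarrow> ('a, 'p) bimodule"
  assumes C: "\<And>i. bimodule K A (C i)"
begin

lemma tensor_relators_carrier: 
  "tensor_relators A C n m \<subseteq> carrier (free_Abelian_group (tensor_words C n m))"
proof -
  interpret C: bimodule K A "C i" for i by (rule C)
  have *: "Poly_Mapping.keys (frag_of a - frag_of b) \<subseteq> W" if "a \<in> W" "b \<in> W" for W and a b :: "'p word"
    using that keys_diff[of "frag_of a" "frag_of b"] by auto
  have **: "Poly_Mapping.keys (frag_of a - frag_of b - frag_of c) \<subseteq> W" if "a \<in> W" "b \<in> W" "c \<in> W" for W and a b c :: "'p word"
    using *[OF that(1,2)] that(3) keys_diff[of "frag_of a - frag_of b" "frag_of c"] by auto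
  show ?thesis unfolding tensor_relators_def
    by (auto simp: tensor_words_iff C.l_closed C.r_closed simp del: carrier_free_Abelian_group_iff
       intro!: *[THEN carrier_free_Abelian_group_iff[THEN iffD2]] **[THEN carrier_free_Abelian_group_iff[THEN iffD2]])
qed

lemma ract_word_append: "v \<noteq> [] \<Longrightarrow> ract_word C (u @ v) a = u @ ract_word C v a"
proof (induction u)
  case (Cons p u)
  then show ?case by (cases "u @ v") auto
qed auto

lemma lact_word_append: "u \<noteq> [] \<Longrightarrow> lact_word C a (u @ v) = lact_word C a u @ v"
  by (cases u) auto

lemma lact_words: "a \<in> carrier A \<Longrightarrow> w \<in> tensor_words C n m \<Longrightarrow> lact_word C a w \<in> tensor_words C n m"
  using bimodule.l_closed[OF C] by (cases "(C,a,w)" rule: lact_word.cases) (auto simp: tensor_words_iff)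

lemma ract_words: 
  assumes a: "a \<in> carrier A" and w: "w \<in> tensor_words C n m"
  shows "ract_word C w a \<in> tensor_words C n m"
proof (cases w rule: rev_cases)
  case (snoc u p)
  then show ?thesis using w a bimodule.r_closed[OF C] by (cases p) (auto simp: tensor_words_iff ract_word_append)
qed (use w in auto)

lemma tensor_add: 
  assumes "u @ (i, x) # v \<in> tensor_words C n m" "y \<in> carrier (C i)"
  shows "tensor A C n m (u @ (i, x \<oplus>\<^bsub>C i\<^esub> y) # v) = 
   tensor A C n m (u @ (i, x) # v) \<oplus>\<^bsub>presented (tensor_words C n m) (tensor_relators A C n m)\<^esub> tensor A C n m (u @ (i, y) # v)"
proof -
  interpret C: bimodule K A "C i" for i by (rule C)
  show ?thesis
    by (rule presented_gen_add[OF tensor_relators_carrier additivity_relator[OF assms]]) (use assms in \<open>auto simp: tensor_words_iff\<close>)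
qed

lemma tensor_balanced: 
  assumes "u @ (i, x) # (j, y) # v \<in> tensor_words C n m" "a \<in> carrier A"
  shows "tensor A C n m (u @ (i, x \<star>\<^bsub>C i\<^esub> a) # (j, y) # v) = tensor A C n m (u @ (i, x) # (j, a \<odot>\<^bsub>C j\<^esub> y) # v)"
proof -
  interpret C: bimodule K A "C i" for i by (rule C)
  show ?thesis
    by (rule presented_gen_eq[OF tensor_relators_carrier balance_relator[OF assms]]) 
      (use assms in \<open>auto simp: tensor_words_iff C.l_closed C.r_closed\<close>)
qed

lemma tensor_hom_zero:
  assumes r: "r \<in> tensor_relators A C n m" and M: "abelian_group M"
   and h: "h \<in> hom (free_Abelian_group (tensor_words C n m)) (add_monoid M)"
   and 1: "\<And>u i x y v. u @ (i, x) # v \<in> tensor_words C n m \<Longrightarrow> y \<in> carrier (C i) \<Longrightarrow>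
     h (frag_of (u @ (i, x \<oplus>\<^bsub>C i\<^esub> y) # v)) = h (frag_of (u @ (i, x) # v)) \<oplus>\<^bsub>M\<^esub> h (frag_of (u @ (i, y) # v))"
   and 2: "\<And>u i x j y v a. u @ (i, x) # (j, y) # v \<in> tensor_words C n m \<Longrightarrow> a \<in> carrier A \<Longrightarrow>
     h (frag_of (u @ (i, x \<star>\<^bsub>C i\<^esub> a) # (j, y) # v)) = h (frag_of (u @ (i, x) # (j, a \<odot>\<^bsub>C j\<^esub> y) # v))"
  shows "h r = \<zero>\<^bsub>M\<^esub>"
proof -
  interpret C: bimodule K A "C i" for i by (rule C)
  interpret M: abelian_group M by fact
  let ?W = "tensor_words C n m"
  have hc: "h (frag_of w) \<in> carrier M" if "w \<in> ?W" for w using h that by (auto simp: hom_def)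
  note D = hom_free_diff[OF tensor_relators_carrier M h]
  from r consider 
    (a) u i x y v where "r = frag_of (u @ (i, x \<oplus>\<^bsub>C i\<^esub> y) # v) - frag_of (u @ (i, x) # v) - frag_of (u @ (i, y) # v)"
      "u @ (i, x) # v \<in> ?W" "y \<in> carrier (C i)"
  | (b) u i x a j y v where "r = frag_of (u @ (i, x \<star>\<^bsub>C i\<^esub> a) # (j, y) # v) - frag_of (u @ (i, x) # (j, a \<odot>\<^bsub>C j\<^esub> y) # v)"
      "u @ (i, x) # (j, y) # v \<in> ?W" "a \<in> carrier A"
    unfolding tensor_relators_def by blast
  then show ?thesis
  proof cases
    case a
    let ?p = "u @ (i, x \<oplus>\<^bsub>C i\<^esub> y) # v" and ?q = "u @ (i, y) # v" and ?s = "u @ (i, x) # v"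
    have w: "?p \<in> ?W" "?q \<in> ?W" "?s \<in> ?W" using a by (auto simp: tensor_words_iff)
    have k: "Poly_Mapping.keys (frag_of ?p - frag_of ?s) \<subseteq> ?W" using w keys_diff[of "frag_of ?p" "frag_of ?s"] by auto
    have z: "s \<oplus>\<^bsub>M\<^esub> q \<ominus>\<^bsub>M\<^esub> s \<ominus>\<^bsub>M\<^esub> q = \<zero>\<^bsub>M\<^esub>" if "s \<in> carrier M" "q \<in> carrier M" for s q
      using that by (simp add: M.minus_eq M.a_assoc[of "s \<oplus>\<^bsub>M\<^esub> q"] M.minus_add[symmetric] M.r_neg)
    have "h r = h (frag_of ?p) \<ominus>\<^bsub>M\<^esub> h (frag_of ?s) \<ominus>\<^bsub>M\<^esub> h (frag_of ?q)"
      using a(1) D[of "frag_of ?p - frag_of ?s" "frag_of ?q"] D[of "frag_of ?p" "frag_of ?s"] k w by simp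
    then show ?thesis using 1[OF a(2,3)] z hc[OF w(2)] hc[OF w(3)] by simp
  next
    case b
    have w: "u @ (i, x \<star>\<^bsub>C i\<^esub> a) # (j, y) # v \<in> ?W" "u @ (i, x) # (j, a \<odot>\<^bsub>C j\<^esub> y) # v \<in> ?W"
      using b by (auto simp: tensor_words_iff C.l_closed C.r_closed)
    show ?thesis using b(1) D w 2[OF b(2,3)] hc[OF w(2)] by (simp add: M.minus_eq M.r_neg)
  qed
qed

lemma tensor_power_bimodule:
  assumes n: "n \<ge> 1"
  shows "bimodule K A (tensor_power A C n m)"
    and "\<And>a w. \<lbrakk>a \<in> carrier A; w \<in> tensor_words C n m\<rbrakk> \<Longrightarrow> a \<odot>\<^bsub>tensor_power A C n m\<^esub> tensor A C n m w = tensor A C n m (lact_word C a w)"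
    and "\<And>a w. \<lbrakk>a \<in> carrier A; w \<in> tensor_words C n m\<rbrakk> \<Longrightarrow> tensor A C n m w \<star>\<^bsub>tensor_power A C n m\<^esub> a = tensor A C n m (ract_word C w a)"
proof -
  interpret C: bimodule K A "C i" for i by (rule C)
  let ?W = "tensor_words C n m" and ?R = "tensor_relators A C n m"
  let ?T = "presented ?W ?R" and ?g = "tensor A C n m"
  have T: "abelian_group ?T" by (rule presented_abelian_group[OF tensor_relators_carrier])
  have lR: "h r = \<zero>\<^bsub>?T\<^esub>" if a: "a \<in> carrier A" and r: "r \<in> ?R" and h: "h \<in> hom (free_Abelian_group ?W) (add_monoid ?T)"
     and hw: "\<And>w. w \<in> ?W \<Longrightarrow> h (frag_of w) = ?g (lact_word C a w)" for a r h
  proof (rule tensor_hom_zero[OF r T h])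
    fix u i x y v assume w: "u @ (i, x) # v \<in> ?W" and y: "y \<in> carrier (C i)"
    have w': "u @ (i, y) # v \<in> ?W" "u @ (i, x \<oplus>\<^bsub>C i\<^esub> y) # v \<in> ?W" "x \<in> carrier (C i)" using w y by (auto simp: tensor_words_iff)
    show "h (frag_of (u @ (i, x \<oplus>\<^bsub>C i\<^esub> y) # v)) = h (frag_of (u @ (i, x) # v)) \<oplus>\<^bsub>?T\<^esub> h (frag_of (u @ (i, y) # v))"
    proof (cases "u = []")
      case True
      then show ?thesis using w w' y a tensor_add[of "[]" i "a \<odot>\<^bsub>C i\<^esub> x" v n m "a \<odot>\<^bsub>C i\<^esub> y"] lact_words[OF a w]
        by (simp add: hw C.l_add C.l_closed)
    next
      case False
      then show ?thesis using w w' y a tensor_add[of "lact_word C a u" i x v n m y] lact_words[OF a w]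
        by (simp add: hw lact_word_append)
    qed
  next
    fix u i x j y v b assume w: "u @ (i, x) # (j, y) # v \<in> ?W" and b: "b \<in> carrier A"
    have w': "u @ (i, x \<star>\<^bsub>C i\<^esub> b) # (j, y) # v \<in> ?W" "u @ (i, x) # (j, b \<odot>\<^bsub>C j\<^esub> y) # v \<in> ?W" "x \<in> carrier (C i)" 
      using w b by (auto simp: tensor_words_iff C.l_closed C.r_closed)
    show "h (frag_of (u @ (i, x \<star>\<^bsub>C i\<^esub> b) # (j, y) # v)) = h (frag_of (u @ (i, x) # (j, b \<odot>\<^bsub>C j\<^esub> y) # v))"
    proof (cases "u = []")
      case True
      then show ?thesis using w w' b a tensor_balanced[of "[]" i "a \<odot>\<^bsub>C i\<^esub> x" j y v n m b] lact_words[OF a w]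
        by (simp add: hw C.lr_assoc[symmetric])
    next
      case False
      then show ?thesis using w w' b a tensor_balanced[of "lact_word C a u" i x j y v n m b] lact_words[OF a w]
        by (simp add: hw lact_word_append)
    qed
  qed
  have rR: "h r = \<zero>\<^bsub>?T\<^esub>" if a: "a \<in> carrier A" and r: "r \<in> ?R" and h: "h \<in> hom (free_Abelian_group ?W) (add_monoid ?T)"
     and hw: "\<And>w. w \<in> ?W \<Longrightarrow> h (frag_of w) = ?g (ract_word C w a)" for a r h
  proof (rule tensor_hom_zero[OF r T h])
    fix u i x y v assume w: "u @ (i, x) # v \<in> ?W" and y: "y \<in> carrier (C i)"
    have w': "u @ (i, y) # v \<in> ?W" "u @ (i, x \<oplus>\<^bsub>C i\<^esub> y) # v \<in> ?W" "x \<in> carrier (C i)" using w y by (auto simp: tensor_words_iff)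
    show "h (frag_of (u @ (i, x \<oplus>\<^bsub>C i\<^esub> y) # v)) = h (frag_of (u @ (i, x) # v)) \<oplus>\<^bsub>?T\<^esub> h (frag_of (u @ (i, y) # v))"
    proof (cases v)
      case Nil
      then show ?thesis using w w' y a tensor_add[of u i "x \<star>\<^bsub>C i\<^esub> a" v n m "y \<star>\<^bsub>C i\<^esub> a"] ract_words[OF a w]
        by (simp add: hw C.r_add C.r_closed ract_word_append)
    next
      case (Cons p q)
      then show ?thesis using w w' y a tensor_add[of u i x "ract_word C v a" n m y] ract_words[OF a w]
        by (simp add: hw ract_word_append)
    qed
  next
    fix u i x j y v b assume w: "u @ (i, x) # (j, y) # v \<in> ?W" and b: "b \<in> carrier A"
    have w': "u @ (i, x \<star>\<^bsub>C i\<^esub> b) # (j, y) # v \<in> ?W" "u @ (i, x) # (j, b \<odot>\<^bsub>C j\<^esub> y) # v \<in> ?W" "y \<in> carrier (C j)" 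
      using w b by (auto simp: tensor_words_iff C.l_closed C.r_closed)
    show "h (frag_of (u @ (i, x \<star>\<^bsub>C i\<^esub> b) # (j, y) # v)) = h (frag_of (u @ (i, x) # (j, b \<odot>\<^bsub>C j\<^esub> y) # v))"
    proof (cases v)
      case Nil
      then show ?thesis using w w' b a tensor_balanced[of u i x j "y \<star>\<^bsub>C j\<^esub> a" "[]" n m b] ract_words[OF a w]
        by (simp add: hw C.lr_assoc ract_word_append)
    next
      case (Cons p q)
      then show ?thesis using w w' b a tensor_balanced[of u i x j y "ract_word C v a" n m b] ract_words[OF a w]
        by (simp add: hw ract_word_append)
    qed
  qed
  have split: "\<exists>i x v. w = (i, x) # v \<and> x \<in> carrier (C i)" "\<exists>i x v. w = v @ [(i, x)] \<and> x \<in> carrier (C i)" if "w \<in> ?W" for w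
    using that n by (cases w; force simp: tensor_words_iff)
       (cases w rule: rev_cases; use that n in \<open>force simp: tensor_words_iff\<close>)
  have central: "?g (lact_word C e w) = ?g (ract_word C w e)" if "w \<in> ?W" and e: "e = c \<odot>\<^bsub>A\<^esub> \<one>\<^bsub>A\<^esub>" and c: "c \<in> carrier K" for w c e
  proof -
    have eA: "e \<in> carrier A" using e c by simp
    have "?g (u @ lact_word C e v) = ?g (u @ ract_word C v e)" if "u @ v \<in> ?W" for u v
      using that
    proof (induction v arbitrary: u)
      case (Cons p v)
      obtain i x where p: "p = (i, x)" by (cases p)
      have x: "x \<in> carrier (C i)" using Cons.prems p by (auto simp: tensor_words_iff)
      show ?case
      proof (cases v)
        case Nil then show ?thesis using C.central[OF c x] e p by simp
      next
        case (Cons q z)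
        obtain j y where q: "q = (j, y)" by (cases q)
        have "?g (u @ (i, e \<odot>\<^bsub>C i\<^esub> x) # (j, y) # z) = ?g (u @ (i, x \<star>\<^bsub>C i\<^esub> e) # (j, y) # z)"
          using C.central[OF c x] e by simp
        also have "\<dots> = ?g (u @ (i, x) # (j, e \<odot>\<^bsub>C j\<^esub> y) # z)"
          using Cons.prems eA p q Cons by (intro tensor_balanced) auto
        also have "\<dots> = ?g (u @ (i, x) # ract_word C (q # z) e)"
          using Cons.IH[of "u @ [p]"] Cons.prems Cons p q by simp
        finally show ?thesis using p q Cons by simp
      qed
    qed simp
    from this[of "[]" w] that(1) show ?thesis by simp
  qed
  note PB = presented_bimodule[OF tensor_relators_carrier, where K = K and A = A and lw = "lact_word C" and rw = "ract_word C"]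
  have I: "unital_algebra K A" by (rule C.unital_algebra_axioms)
  have l1: "?g (lact_word C \<one>\<^bsub>A\<^esub> w) = ?g w" "?g (ract_word C w \<one>\<^bsub>A\<^esub>) = ?g w" if "w \<in> ?W" for w
    using split(1)[OF that] apply (fastforce simp: C.l_one)
    using split(2)[OF that] by (fastforce simp: C.r_one ract_word_append)
  have la: "?g (lact_word C (a \<otimes>\<^bsub>A\<^esub> b) w) = ?g (lact_word C a (lact_word C b w))"
    "?g (ract_word C w (a \<otimes>\<^bsub>A\<^esub> b)) = ?g (ract_word C (ract_word C w a) b)"
    "?g (lact_word C (a \<oplus>\<^bsub>A\<^esub> b) w) = ?g (lact_word C a w) \<oplus>\<^bsub>?T\<^esub> ?g (lact_word C b w)"
    "?g (ract_word C w (a \<oplus>\<^bsub>A\<^esub> b)) = ?g (ract_word C w a) \<oplus>\<^bsub>?T\<^esub> ?g (ract_word C w b)"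
    if a: "a \<in> carrier A" "b \<in> carrier A" and w: "w \<in> ?W" for a b w
  proof -
    from split(1)[OF w] obtain i x v where x: "w = (i, x) # v" "x \<in> carrier (C i)" by blast
    show "?g (lact_word C (a \<otimes>\<^bsub>A\<^esub> b) w) = ?g (lact_word C a (lact_word C b w))"
      using x a by (simp add: C.l_assoc)
    show "?g (lact_word C (a \<oplus>\<^bsub>A\<^esub> b) w) = ?g (lact_word C a w) \<oplus>\<^bsub>?T\<^esub> ?g (lact_word C b w)"
      using x a tensor_add[of "[]" i "a \<odot>\<^bsub>C i\<^esub> x" v n m "b \<odot>\<^bsub>C i\<^esub> x"] lact_words[OF a(1) w] by (simp add: C.add_l C.l_closed)
    from split(2)[OF w] obtain i x v where x: "w = v @ [(i, x)]" "x \<in> carrier (C i)" by blast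
    show "?g (ract_word C w (a \<otimes>\<^bsub>A\<^esub> b)) = ?g (ract_word C (ract_word C w a) b)"
      using x a by (simp add: C.r_assoc ract_word_append)
    show "?g (ract_word C w (a \<oplus>\<^bsub>A\<^esub> b)) = ?g (ract_word C w a) \<oplus>\<^bsub>?T\<^esub> ?g (ract_word C w b)"
      using x a tensor_add[of v i "x \<star>\<^bsub>C i\<^esub> a" "[]" n m "x \<star>\<^bsub>C i\<^esub> b"] ract_words[OF a(1) w] by (simp add: C.add_r C.r_closed ract_word_append)
  qed
  have lra: "?g (ract_word C (lact_word C a w) b) = ?g (lact_word C a (ract_word C w b))"
    if a: "a \<in> carrier A" "b \<in> carrier A" and w: "w \<in> ?W" for a b w
  proof -
    from split(1)[OF w] obtain i x v where x: "w = (i, x) # v" "x \<in> carrier (C i)" by blast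
    then show ?thesis using a by (cases v) (auto simp: C.lr_assoc)
  qed
  have central': "?g (lact_word C (c \<odot>\<^bsub>A\<^esub> \<one>\<^bsub>A\<^esub>) w) = ?g (ract_word C w (c \<odot>\<^bsub>A\<^esub> \<one>\<^bsub>A\<^esub>))" if "c \<in> carrier K" "w \<in> ?W" for c w
    using central[OF that(2) refl that(1)] .
  note prems = I lact_words ract_words lR rR l1(1) l1(2) la(1) la(2) lra la(3) la(4) central'
  show "bimodule K A (tensor_power A C n m)"
    unfolding tensor_power_def Let_def
    by (rule PB(1)) (fact prems)+
  show "a \<odot>\<^bsub>tensor_power A C n m\<^esub> ?g w = ?g (lact_word C a w)" if "a \<in> carrier A" "w \<in> ?W" for a w
    unfolding tensor_power_def Let_def
    by (rule PB(2)) (fact prems that)+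
  show "?g w \<star>\<^bsub>tensor_power A C n m\<^esub> a = ?g (ract_word C w a)" if "a \<in> carrier A" "w \<in> ?W" for a w
    unfolding tensor_power_def Let_def
    by (rule PB(3)) (fact prems that)+
qed

end


subsection \<open>Free bimodules and projectivity\<close>

context
  fixes K :: "('k, 'y) ring_scheme" and A :: "('k, 'a, 'z) module_scheme"
    and S :: "'p set"
  assumes I: "unital_algebra K A"
begin

interpretation A: unital_algebra K A by (rule I)

definition "free_words = carrier A \<times> S \<times> carrier A"
definition "free_relators = {frag_of (a \<oplus>\<^bsub>A\<^esub> a', x, b) - frag_of (a, x, b) - frag_of (a', x, b)
      | a a' x b. a \<in> carrier A \<and> a' \<in> carrier A \<and> x \<in> S \<and> b \<in> carrier A} \<union>
    {frag_of (a, x, b \<oplus>\<^bsub>A\<^esub> b') - frag_of (a, x, b) - frag_of (a, x, b')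
      | a x b b'. a \<in> carrier A \<and> b' \<in> carrier A \<and> x \<in> S \<and> b \<in> carrier A} \<union>
    {frag_of (c \<odot>\<^bsub>A\<^esub> a, x, b) - frag_of (a, x, c \<odot>\<^bsub>A\<^esub> b)
      | a x b c. a \<in> carrier A \<and> c \<in> carrier K \<and> x \<in> S \<and> b \<in> carrier A}"

lemma free_relators_carrier: "free_relators \<subseteq> carrier (free_Abelian_group free_words)"
proof -
  have *: "Poly_Mapping.keys (frag_of a - frag_of b) \<subseteq> W" if "a \<in> W" "b \<in> W" for W and a b :: "'w"
    using that keys_diff[of "frag_of a" "frag_of b"] by auto
  have **: "Poly_Mapping.keys (frag_of a - frag_of b - frag_of c) \<subseteq> W" if "a \<in> W" "b \<in> W" "c \<in> W" for W and a b c :: "'w"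
    using *[OF that(1,2)] that(3) keys_diff[of "frag_of a - frag_of b" "frag_of c"] by auto
  show ?thesis unfolding free_relators_def free_words_def
    by (auto simp del: carrier_free_Abelian_group_iff
       intro!: *[THEN carrier_free_Abelian_group_iff[THEN iffD2]] **[THEN carrier_free_Abelian_group_iff[THEN iffD2]])
qed

lemma free_hom_zero:
  assumes r: "r \<in> free_relators" and M: "abelian_group M"
   and h: "h \<in> hom (free_Abelian_group free_words) (add_monoid M)"
   and 1: "\<And>a a' x b. \<lbrakk>a \<in> carrier A; a' \<in> carrier A; x \<in> S; b \<in> carrier A\<rbrakk> \<Longrightarrow>
      h (frag_of (a \<oplus>\<^bsub>A\<^esub> a', x, b)) = h (frag_of (a, x, b)) \<oplus>\<^bsub>M\<^esub> h (frag_of (a', x, b))"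
   and 2: "\<And>a x b b'. \<lbrakk>a \<in> carrier A; b' \<in> carrier A; x \<in> S; b \<in> carrier A\<rbrakk> \<Longrightarrow>
      h (frag_of (a, x, b \<oplus>\<^bsub>A\<^esub> b')) = h (frag_of (a, x, b)) \<oplus>\<^bsub>M\<^esub> h (frag_of (a, x, b'))"
   and 3: "\<And>a c x b. \<lbrakk>a \<in> carrier A; c \<in> carrier K; x \<in> S; b \<in> carrier A\<rbrakk> \<Longrightarrow>
      h (frag_of (c \<odot>\<^bsub>A\<^esub> a, x, b)) = h (frag_of (a, x, c \<odot>\<^bsub>A\<^esub> b))"
  shows "h r = \<zero>\<^bsub>M\<^esub>"
proof -
  interpret M: abelian_group M by fact
  have hc: "h (frag_of w) \<in> carrier M" if "w \<in> free_words" for w using h that by (auto simp: hom_def)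
  note D = hom_free_diff[OF free_relators_carrier M h]
  have z: "s \<oplus>\<^bsub>M\<^esub> q \<ominus>\<^bsub>M\<^esub> s \<ominus>\<^bsub>M\<^esub> q = \<zero>\<^bsub>M\<^esub>" if "s \<in> carrier M" "q \<in> carrier M" for s q
    using that by (simp add: M.minus_eq M.a_assoc[of "s \<oplus>\<^bsub>M\<^esub> q"] M.minus_add[symmetric] M.r_neg)
  have k: "Poly_Mapping.keys (frag_of p - frag_of s) \<subseteq> free_words" if "p \<in> free_words" "s \<in> free_words" for p s
    using that keys_diff[of "frag_of p" "frag_of s"] by auto
  have t: "h (frag_of p - frag_of s - frag_of q) = h (frag_of p) \<ominus>\<^bsub>M\<^esub> h (frag_of s) \<ominus>\<^bsub>M\<^esub> h (frag_of q)"
    if "p \<in> free_words" "s \<in> free_words" "q \<in> free_words" for p s q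
    using D[of "frag_of p - frag_of s" "frag_of q"] D[of "frag_of p" "frag_of s"] k that by simp
  have t2: "h (frag_of p - frag_of s) = h (frag_of p) \<ominus>\<^bsub>M\<^esub> h (frag_of s)"
    if "p \<in> free_words" "s \<in> free_words" for p s
    using D[of "frag_of p" "frag_of s"] that by simp
  from r show ?thesis
    unfolding free_relators_def
    apply (elim UnE CollectE exE conjE)
    subgoal for a a' x b
      using 1[of a a' x b] t z hc by (simp add: free_words_def)
    subgoal for a x b b'
      using 2[of a b' x b] t z hc by (simp add: free_words_def)
    subgoal for a x b c
      using 3[of a c x b] t2 hc[of "(a, x, c \<odot>\<^bsub>A\<^esub> b)"] by (simp add: free_words_def M.minus_eq M.r_neg)
    done
qed

lemma free_words_iff: "(a, x, b) \<in> free_words \<longleftrightarrow> a \<in> carrier A \<and> x \<in> S \<and> b \<in> carrier A"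
  by (simp add: free_words_def)

abbreviation "free_gen \<equiv> presented_gen free_words free_relators"
abbreviation "free_group \<equiv> presented free_words free_relators"

lemma free_gen_add_left: 
  assumes "a \<in> carrier A" "a' \<in> carrier A" "x \<in> S" "b \<in> carrier A"
  shows "free_gen (a \<oplus>\<^bsub>A\<^esub> a', x, b) = free_gen (a, x, b) \<oplus>\<^bsub>free_group\<^esub> free_gen (a', x, b)"
proof (rule presented_gen_add[OF free_relators_carrier])
  show "frag_of (a \<oplus>\<^bsub>A\<^esub> a', x, b) - frag_of (a, x, b) - frag_of (a', x, b) \<in> free_relators"
    unfolding free_relators_def using assms by blast
qed (use assms in \<open>simp_all add: free_words_iff\<close>)

lemma free_gen_add_right:
  assumes "a \<in> carrier A" "b' \<in> carrier A" "x \<in> S" "b \<in> carrier A"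
  shows "free_gen (a, x, b \<oplus>\<^bsub>A\<^esub> b') = free_gen (a, x, b) \<oplus>\<^bsub>free_group\<^esub> free_gen (a, x, b')"
proof (rule presented_gen_add[OF free_relators_carrier])
  show "frag_of (a, x, b \<oplus>\<^bsub>A\<^esub> b') - frag_of (a, x, b) - frag_of (a, x, b') \<in> free_relators"
    unfolding free_relators_def using assms by blast
qed (use assms in \<open>simp_all add: free_words_iff\<close>)

lemma free_gen_balanced:
  assumes "a \<in> carrier A" "c \<in> carrier K" "x \<in> S" "b \<in> carrier A"
  shows "free_gen (c \<odot>\<^bsub>A\<^esub> a, x, b) = free_gen (a, x, c \<odot>\<^bsub>A\<^esub> b)"
proof (rule presented_gen_eq[OF free_relators_carrier])
  show "frag_of (c \<odot>\<^bsub>A\<^esub> a, x, b) - frag_of (a, x, c \<odot>\<^bsub>A\<^esub> b) \<in> free_relators"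
    unfolding free_relators_def using assms by blast
qed (use assms in \<open>simp_all add: free_words_iff\<close>)

definition "free_lact a w = (case w of (b, x, c) \<Rightarrow> (a \<otimes>\<^bsub>A\<^esub> b, x, c))"
definition "free_ract w a = (case w of (b, x, c) \<Rightarrow> (b, x, c \<otimes>\<^bsub>A\<^esub> a))"

definition free_bimodule :: "('a, ('a \<times> 'p \<times> 'a \<Rightarrow>\<^sub>0 int) set) bimodule"
  where "free_bimodule = \<lparr>carrier = carrier free_group, monoid.mult = undefined, one = undefined, ring.zero = \<zero>\<^bsub>free_group\<^esub>, add = add free_group,
      smult = (\<lambda>a. presented_lift free_group (\<lambda>w. free_gen (free_lact a w))),
      rsmult = (\<lambda>Y a. presented_lift free_group (\<lambda>w. free_gen (free_ract w a)) Y)\<rparr>"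

lemma free_act_simps [simp]:
  "free_lact a (b, x, c) = (a \<otimes>\<^bsub>A\<^esub> b, x, c)" "free_ract (b, x, c) a = (b, x, c \<otimes>\<^bsub>A\<^esub> a)"
  by (simp_all add: free_lact_def free_ract_def)

lemma bimodule_free_bimodule:
  shows "bimodule K A free_bimodule"
   and "\<And>a w. \<lbrakk>a \<in> carrier A; w \<in> free_words\<rbrakk> \<Longrightarrow> a \<odot>\<^bsub>free_bimodule\<^esub> free_gen w = free_gen (free_lact a w)"
   and "\<And>a w. \<lbrakk>a \<in> carrier A; w \<in> free_words\<rbrakk> \<Longrightarrow> free_gen w \<star>\<^bsub>free_bimodule\<^esub> a = free_gen (free_ract w a)"
proof -
  have T: "abelian_group free_group" by (rule presented_abelian_group[OF free_relators_carrier])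
  have c: "free_lact a w \<in> free_words" "free_ract w a \<in> free_words" if "a \<in> carrier A" "w \<in> free_words" for a w
    using that by (cases w; simp add: free_words_iff)+
  have lR: "h r = \<zero>\<^bsub>free_group\<^esub>" if "a \<in> carrier A" "r \<in> free_relators" "h \<in> hom (free_Abelian_group free_words) (add_monoid free_group)"
     "\<And>w. w \<in> free_words \<Longrightarrow> h (frag_of w) = free_gen (free_lact a w)" for a r h
    by (rule free_hom_zero[OF that(2) T that(3)])
     (use that(1) in \<open>auto simp: free_words_iff that(4)  A.A.r_distr free_gen_add_left free_gen_add_right A.smult_mult_right free_gen_balanced\<close>)
  have rR: "h r = \<zero>\<^bsub>free_group\<^esub>" if "a \<in> carrier A" "r \<in> free_relators" "h \<in> hom (free_Abelian_group free_words) (add_monoid free_group)"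
     "\<And>w. w \<in> free_words \<Longrightarrow> h (frag_of w) = free_gen (free_ract w a)" for a r h
    by (rule free_hom_zero[OF that(2) T that(3)])
     (use that(1) in \<open>auto simp: free_words_iff that(4)  A.A.l_distr free_gen_add_left free_gen_add_right A.smult_mult_left free_gen_balanced\<close>)
  have x: "free_gen (free_lact \<one>\<^bsub>A\<^esub> w) = free_gen w" "free_gen (free_ract w \<one>\<^bsub>A\<^esub>) = free_gen w" if "w \<in> free_words" for w
    using that by (cases w; simp add: free_words_iff)+
  have y: "free_gen (free_lact (a \<otimes>\<^bsub>A\<^esub> b) w) = free_gen (free_lact a (free_lact b w))"
    "free_gen (free_ract w (a \<otimes>\<^bsub>A\<^esub> b)) = free_gen (free_ract (free_ract w a) b)"
    "free_gen (free_ract (free_lact a w) b) = free_gen (free_lact a (free_ract w b))"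
    "free_gen (free_lact (a \<oplus>\<^bsub>A\<^esub> b) w) = free_gen (free_lact a w) \<oplus>\<^bsub>free_group\<^esub> free_gen (free_lact b w)"
    "free_gen (free_ract w (a \<oplus>\<^bsub>A\<^esub> b)) = free_gen (free_ract w a) \<oplus>\<^bsub>free_group\<^esub> free_gen (free_ract w b)"
    if "a \<in> carrier A" "b \<in> carrier A" "w \<in> free_words" for a b w
    using that by (cases w; simp add: free_words_iff A.A.m_assoc A.A.l_distr A.A.r_distr free_gen_add_left free_gen_add_right)+
  have cen: "free_gen (free_lact (c \<odot>\<^bsub>A\<^esub> \<one>\<^bsub>A\<^esub>) w) = free_gen (free_ract w (c \<odot>\<^bsub>A\<^esub> \<one>\<^bsub>A\<^esub>))" if "c \<in> carrier K" "w \<in> free_words" for c w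
    using that by (cases w; simp add: free_words_iff A.smult_mult_left A.smult_mult_right free_gen_balanced)+
  note prems = I c lR rR x y cen
  note PB = presented_bimodule[OF free_relators_carrier, where K = K and A = A and lw = free_lact and rw = free_ract]
  show "bimodule K A free_bimodule" unfolding free_bimodule_def by (rule PB(1)) (fact prems)+
  show "a \<odot>\<^bsub>free_bimodule\<^esub> free_gen w = free_gen (free_lact a w)" if "a \<in> carrier A" "w \<in> free_words" for a w
    unfolding free_bimodule_def by (rule PB(2)) (fact prems that)+
  show "free_gen w \<star>\<^bsub>free_bimodule\<^esub> a = free_gen (free_ract w a)" if "a \<in> carrier A" "w \<in> free_words" for a w
    unfolding free_bimodule_def by (rule PB(3)) (fact prems that)+
qed

lemma free_bimodule_universal:
  assumes M: "bimodule K A (M :: ('a, 'm) bimodule)" and m: "\<And>x. x \<in> S \<Longrightarrow> \<mu> x \<in> carrier M"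
  obtains \<psi> where "\<psi> \<in> bimodule_hom A free_bimodule M" "\<And>x. x \<in> S \<Longrightarrow> \<psi> (free_gen (\<one>\<^bsub>A\<^esub>, x, \<one>\<^bsub>A\<^esub>)) = \<mu> x"
proof -
  interpret M: bimodule K A M by fact
  interpret F: bimodule K A free_bimodule by (rule bimodule_free_bimodule)
  define \<phi> where "\<phi> = (\<lambda>(a, x, b). (a \<odot>\<^bsub>M\<^esub> \<mu> x) \<star>\<^bsub>M\<^esub> b)"
  define \<psi> where "\<psi> = presented_lift M \<phi>"
  have Mg: "abelian_group M" by (rule M.M.abelian_group_axioms)
  have e: "(c \<odot>\<^bsub>A\<^esub> a) \<odot>\<^bsub>M\<^esub> y = a \<odot>\<^bsub>M\<^esub> (y \<star>\<^bsub>M\<^esub> (c \<odot>\<^bsub>A\<^esub> \<one>\<^bsub>A\<^esub>))"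
    "y \<star>\<^bsub>M\<^esub> (c \<odot>\<^bsub>A\<^esub> a) = (y \<star>\<^bsub>M\<^esub> (c \<odot>\<^bsub>A\<^esub> \<one>\<^bsub>A\<^esub>)) \<star>\<^bsub>M\<^esub> a"
    if "c \<in> carrier K" "a \<in> carrier A" "y \<in> carrier M" for c a y
  proof -
    have "c \<odot>\<^bsub>A\<^esub> a = a \<otimes>\<^bsub>A\<^esub> (c \<odot>\<^bsub>A\<^esub> \<one>\<^bsub>A\<^esub>)" using that by (simp add: A.smult_mult_right)
    then show "(c \<odot>\<^bsub>A\<^esub> a) \<odot>\<^bsub>M\<^esub> y = a \<odot>\<^bsub>M\<^esub> (y \<star>\<^bsub>M\<^esub> (c \<odot>\<^bsub>A\<^esub> \<one>\<^bsub>A\<^esub>))"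
      using that M.l_assoc[of a "c \<odot>\<^bsub>A\<^esub> \<one>\<^bsub>A\<^esub>" y] M.central by simp
    have "c \<odot>\<^bsub>A\<^esub> a = (c \<odot>\<^bsub>A\<^esub> \<one>\<^bsub>A\<^esub>) \<otimes>\<^bsub>A\<^esub> a" using that by (simp add: A.smult_mult_left)
    then show "y \<star>\<^bsub>M\<^esub> (c \<odot>\<^bsub>A\<^esub> a) = (y \<star>\<^bsub>M\<^esub> (c \<odot>\<^bsub>A\<^esub> \<one>\<^bsub>A\<^esub>)) \<star>\<^bsub>M\<^esub> a"
      using that M.r_assoc[of "c \<odot>\<^bsub>A\<^esub> \<one>\<^bsub>A\<^esub>" a y] by simp
  qed
  have e': "((c \<odot>\<^bsub>A\<^esub> a) \<odot>\<^bsub>M\<^esub> y) \<star>\<^bsub>M\<^esub> b = (a \<odot>\<^bsub>M\<^esub> y) \<star>\<^bsub>M\<^esub> (c \<odot>\<^bsub>A\<^esub> b)"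
    if c: "c \<in> carrier K" and a: "a \<in> carrier A" and b: "b \<in> carrier A" and y: "y \<in> carrier M" for c a b y
    unfolding e(1)[OF c a y] e(2)[OF c b M.l_closed[OF a y]]
    using a c y by (simp add: M.lr_assoc)
  have \<phi>c: "\<phi> w \<in> carrier M" if "w \<in> free_words" for w
    using that m by (cases w) (auto simp: free_words_iff \<phi>_def M.l_closed M.r_closed)
  have kill: "h r = \<zero>\<^bsub>M\<^esub>" if "r \<in> free_relators" "h \<in> hom (free_Abelian_group free_words) (add_monoid M)"
     "\<And>w. w \<in> free_words \<Longrightarrow> h (frag_of w) = \<phi> w" for r h
    by (rule free_hom_zero[OF that(1) Mg that(2)])
      (use m in \<open>auto simp: free_words_iff that(3) \<phi>_def M.add_l M.add_r M.r_add M.l_closed M.r_closed e'\<close>)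
  have \<psi>h: "\<psi> \<in> hom (add_monoid free_group) (add_monoid M)" and \<psi>g: "\<And>w. w \<in> free_words \<Longrightarrow> \<psi> (free_gen w) = \<phi> w"
    unfolding \<psi>_def
    using presented_lift_hom[where \<phi> = \<phi>, OF free_relators_carrier Mg] \<phi>c kill by blast+
  have FB: "carrier free_bimodule = carrier free_group" "add free_bimodule = add free_group" by (simp_all add: free_bimodule_def)
  have \<psi>c: "\<psi> x \<in> carrier M" if "x \<in> carrier free_group" for x using \<psi>h that by (auto simp: hom_def)
  have \<psi>a: "\<psi> (x \<oplus>\<^bsub>free_group\<^esub> y) = \<psi> x \<oplus>\<^bsub>M\<^esub> \<psi> y" if "x \<in> carrier free_group" "y \<in> carrier free_group" for x y using \<psi>h that by (auto simp: hom_def)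
  have "\<psi> (a \<odot>\<^bsub>free_bimodule\<^esub> x) = a \<odot>\<^bsub>M\<^esub> \<psi> x" if a: "a \<in> carrier A" and x: "x \<in> carrier free_bimodule" for a x
  proof (rule presented_hom_eq[OF free_relators_carrier Mg, of "\<lambda>x. \<psi> (a \<odot>\<^bsub>free_bimodule\<^esub> x)" "\<lambda>x. a \<odot>\<^bsub>M\<^esub> \<psi> x"])
    show "(\<lambda>x. \<psi> (a \<odot>\<^bsub>free_bimodule\<^esub> x)) \<in> hom (add_monoid free_group) (add_monoid M)"
      "(\<lambda>x. a \<odot>\<^bsub>M\<^esub> \<psi> x) \<in> hom (add_monoid free_group) (add_monoid M)"
      using a F.l_closed F.l_add by (auto intro!: homI simp: FB \<psi>c \<psi>a M.l_closed M.l_add)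
    show "\<psi> (a \<odot>\<^bsub>free_bimodule\<^esub> free_gen w) = a \<odot>\<^bsub>M\<^esub> \<psi> (free_gen w)" if wF: "w \<in> free_words" for w
    proof -
      obtain b y c where w: "w = (b, y, c)" "b \<in> carrier A" "y \<in> S" "c \<in> carrier A"
        using wF by (cases w) (auto simp: free_words_iff)
      have aw: "(a \<otimes>\<^bsub>A\<^esub> b, y, c) \<in> free_words" using w a by (simp add: free_words_iff)
      have "\<psi> (a \<odot>\<^bsub>free_bimodule\<^esub> free_gen w) = \<phi> (a \<otimes>\<^bsub>A\<^esub> b, y, c)"
        using bimodule_free_bimodule(2)[OF a that] \<psi>g[OF aw] w by simp
      also have "\<dots> = a \<odot>\<^bsub>M\<^esub> \<phi> w"
        using w a m by (simp add: \<phi>_def M.lr_assoc M.l_assoc M.l_closed M.r_closed)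
      finally show ?thesis using \<psi>g[OF that] by simp
    qed
  qed (use x in \<open>simp add: FB\<close>)
  moreover have "\<psi> (x \<star>\<^bsub>free_bimodule\<^esub> a) = \<psi> x \<star>\<^bsub>M\<^esub> a" if a: "a \<in> carrier A" and x: "x \<in> carrier free_bimodule" for a x
  proof (rule presented_hom_eq[OF free_relators_carrier Mg, of "\<lambda>x. \<psi> (x \<star>\<^bsub>free_bimodule\<^esub> a)" "\<lambda>x. \<psi> x \<star>\<^bsub>M\<^esub> a"])
    show "(\<lambda>x. \<psi> (x \<star>\<^bsub>free_bimodule\<^esub> a)) \<in> hom (add_monoid free_group) (add_monoid M)"
      "(\<lambda>x. \<psi> x \<star>\<^bsub>M\<^esub> a) \<in> hom (add_monoid free_group) (add_monoid M)"
      using a F.r_closed F.r_add by (auto intro!: homI simp: FB \<psi>c \<psi>a M.r_closed M.r_add)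
    show "\<psi> (free_gen w \<star>\<^bsub>free_bimodule\<^esub> a) = \<psi> (free_gen w) \<star>\<^bsub>M\<^esub> a" if wF: "w \<in> free_words" for w
    proof -
      obtain b y c where w: "w = (b, y, c)" "b \<in> carrier A" "y \<in> S" "c \<in> carrier A"
        using wF by (cases w) (auto simp: free_words_iff)
      have aw: "(b, y, c \<otimes>\<^bsub>A\<^esub> a) \<in> free_words" using w a by (simp add: free_words_iff)
      have "\<psi> (free_gen w \<star>\<^bsub>free_bimodule\<^esub> a) = \<phi> (b, y, c \<otimes>\<^bsub>A\<^esub> a)"
        using bimodule_free_bimodule(3)[OF a that] \<psi>g[OF aw] w by simp
      also have "\<dots> = \<phi> w \<star>\<^bsub>M\<^esub> a"
        using w a m by (simp add: \<phi>_def M.r_assoc M.l_closed)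
      finally show ?thesis using \<psi>g[OF that] by simp
    qed
  qed (use x in \<open>simp add: FB\<close>)
  ultimately have "\<psi> \<in> bimodule_hom A free_bimodule M" by (auto simp: bimodule_hom_def FB \<psi>c \<psi>a)
  moreover have "\<psi> (free_gen (\<one>\<^bsub>A\<^esub>, x, \<one>\<^bsub>A\<^esub>)) = \<mu> x" if "x \<in> S" for x
    using that m \<psi>g[of "(\<one>\<^bsub>A\<^esub>, x, \<one>\<^bsub>A\<^esub>)"] by (simp add: free_words_iff \<phi>_def M.l_one M.r_one)
  ultimately show thesis by (rule that)
qed

lemma free_gen_one_closed: "x \<in> S \<Longrightarrow> free_gen (\<one>\<^bsub>A\<^esub>, x, \<one>\<^bsub>A\<^esub>) \<in> carrier free_bimodule"
  using presented_gen_closed[OF free_relators_carrier, of "(\<one>\<^bsub>A\<^esub>, x, \<one>\<^bsub>A\<^esub>)"] by (simp add: free_bimodule_def free_words_iff)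

lemma free_bimodule_hom_eq:
  assumes M: "bimodule K A M" and p: "p \<in> bimodule_hom A free_bimodule M" and q: "q \<in> bimodule_hom A free_bimodule M"
   and pq: "\<And>x. x \<in> S \<Longrightarrow> p (free_gen (\<one>\<^bsub>A\<^esub>, x, \<one>\<^bsub>A\<^esub>)) = q (free_gen (\<one>\<^bsub>A\<^esub>, x, \<one>\<^bsub>A\<^esub>))" and y: "y \<in> carrier free_bimodule"
  shows "p y = q y"
proof -
  interpret M: bimodule K A M by fact
  interpret F: bimodule K A free_bimodule by (rule bimodule_free_bimodule)
  have FB: "carrier free_bimodule = carrier free_group" "add free_bimodule = add free_group" by (simp_all add: free_bimodule_def)
  show ?thesis
  proof (rule presented_hom_eq[OF free_relators_carrier M.M.abelian_group_axioms])
    show "p \<in> hom (add_monoid free_group) (add_monoid M)" "q \<in> hom (add_monoid free_group) (add_monoid M)"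
      using p q by (auto simp: bimodule_hom_def hom_def FB)
    fix w assume "w \<in> free_words"
    then obtain a x b where w: "w = (a, x, b)" "a \<in> carrier A" "x \<in> S" "b \<in> carrier A" by (cases w) (auto simp: free_words_iff)
    have "free_gen w = (a \<odot>\<^bsub>free_bimodule\<^esub> free_gen (\<one>\<^bsub>A\<^esub>, x, \<one>\<^bsub>A\<^esub>)) \<star>\<^bsub>free_bimodule\<^esub> b"
      using w by (simp add: bimodule_free_bimodule free_words_iff)
    then show "p (free_gen w) = q (free_gen w)" using p q pq[OF w(3)] w free_gen_one_closed[OF w(3)] F.l_closed
      by (auto simp: bimodule_hom_def)
  qed (use y in \<open>simp add: FB\<close>)
qed

end

lemma bimodule_hom_comp: "p \<in> bimodule_hom A X Y \<Longrightarrow> q \<in> bimodule_hom A Y Z \<Longrightarrow> (\<lambda>x. q (p x)) \<in> bimodule_hom A X Z"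
  by (auto simp: bimodule_hom_def Pi_def)

text \<open>The lifting property against surjections of bimodules on arbitrary types: the restriction of
  types in \<^const>\<open>projective_bimodule\<close> loses nothing.\<close>

lemma projective_bimodule_lift:
  fixes P :: "('a, 'p) bimodule" and M :: "('a, 'm) bimodule" and N :: "('a, 'n) bimodule"
  assumes P: "projective_bimodule K A P" and M: "bimodule K A M" and N: "bimodule K A N"
   and q: "q \<in> bimodule_hom A M N" "q ` carrier M = carrier N" and f: "f \<in> bimodule_hom A P N"
  shows "\<exists>h \<in> bimodule_hom A P M. \<forall>x\<in>carrier P. q (h x) = f x"
proof -
  have bP: "bimodule K A P" using P by (simp add: projective_bimodule_def)
  interpret P: bimodule K A P by fact
  interpret N: bimodule K A N by fact
  have I: "unital_algebra K A" by (rule P.unital_algebra_axioms)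
  let ?S = "carrier P"
  let ?F = "free_bimodule K A ?S"
  let ?g = "\<lambda>x. presented_gen (free_words A ?S) (free_relators K A ?S) (\<one>\<^bsub>A\<^esub>, x, \<one>\<^bsub>A\<^esub>)"
  obtain \<pi> where \<pi>: "\<pi> \<in> bimodule_hom A ?F P" "\<And>x. x \<in> ?S \<Longrightarrow> \<pi> (?g x) = x"
    using free_bimodule_universal[OF I bP, of ?S "\<lambda>x. x"] by blast
  have sur: "\<pi> ` carrier ?F = carrier P"
  proof
    show "carrier P \<subseteq> \<pi> ` carrier ?F"
      using \<pi>(2) free_gen_one_closed[OF I] by (metis image_eqI subsetI)
  qed (use \<pi>(1) in \<open>auto simp: bimodule_hom_def\<close>)
  have id: "(\<lambda>x. x) \<in> bimodule_hom A P P" by (auto simp: bimodule_hom_def)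
  obtain s where s: "s \<in> bimodule_hom A P ?F" "\<And>x. x \<in> ?S \<Longrightarrow> \<pi> (s x) = x"
    using P \<pi>(1) sur id bimodule_free_bimodule(1)[OF I, of ?S] bP unfolding projective_bimodule_def by blast
  have "\<forall>x\<in>?S. \<exists>y\<in>carrier M. q y = f x"
  proof
    fix x assume "x \<in> ?S"
    then have "f x \<in> q ` carrier M" using f q(2) by (auto simp: bimodule_hom_def)
    then show "\<exists>y\<in>carrier M. q y = f x" by auto
  qed
  then obtain \<mu> where \<mu>: "\<And>x. x \<in> ?S \<Longrightarrow> \<mu> x \<in> carrier M \<and> q (\<mu> x) = f x" by metis
  obtain \<psi> where \<psi>: "\<psi> \<in> bimodule_hom A ?F M" "\<And>x. x \<in> ?S \<Longrightarrow> \<psi> (?g x) = \<mu> x"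
    using free_bimodule_universal[OF I M, of ?S \<mu>] \<mu> by blast
  have "q (\<psi> y) = f (\<pi> y)" if "y \<in> carrier ?F" for y
    using free_bimodule_hom_eq[OF I N bimodule_hom_comp[OF \<psi>(1) q(1)] bimodule_hom_comp[OF \<pi>(1) f] _ that] \<psi>(2) \<pi>(2) \<mu> by simp
  moreover have "s x \<in> carrier ?F" if "x \<in> carrier P" for x
    using s(1) that by (auto simp: bimodule_hom_def Pi_def)
  ultimately have "\<forall>x\<in>carrier P. q (\<psi> (s x)) = f x"
    using s(2) by simp
  then show ?thesis by (intro bexI[OF _ bimodule_hom_comp[OF s(1) \<psi>(1)]])
qed

end

theory Submission
  imports Defs
begin

text \<open>Let \<open>D\<close> be the differential that \<open>d\<close> induces on the tensor powers \<open>T n\<close> of \<open>P\<close>. The \<open>A\<^sub>\<infinity>\<close>-relation of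
  index \<open>N\<close> reads \<open>D \<delta>\<^sub>N + \<delta>\<^sub>N d + o\<^sub>N = 0\<close>, where the obstruction
  \<open>o\<^sub>N = \<Sum>\<^sub>s \<partial>\<^sub>s \<delta>\<^sub>N\<^sub>+\<^sub>1\<^sub>-\<^sub>s\<close> runs over \<open>1 < s < N\<close>, and \<open>\<partial>\<^sub>s\<close>, which applies
  \<open>\<delta>\<^sub>s\<close> to one tensor factor at a time, involves earlier maps only. So the \<open>\<delta>\<^sub>N\<close> can be found one after the other: each is a
  null-homotopy of \<open>- o\<^sub>N\<close>, except that \<open>\<delta>\<^sub>2\<close> has to cover the identity of \<open>A\<close>. Two facts make this work.

  The obstruction is closed, \<open>D o\<^sub>N = o\<^sub>N d\<close>. Indeed \<open>\<partial>\<^sub>s\<close> is an odd derivation for the concatenation of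
  tensors, and the cross terms cancel in \<open>\<Sum>\<^sub>a \<partial>\<^sub>a \<partial>\<^sub>M\<^sub>+\<^sub>1\<^sub>-\<^sub>a\<close>. Therefore the relations of index
  less than \<open>N\<close> hold on all tensor powers as soon as they hold on \<open>P\<close> (\<open>square_vanishes\<close>), and closedness follows from them
  formally (\<open>obstruction_closed\<close>).

  The complex \<open>T n\<close> is a resolution of \<open>A\<close>, up to a shift, by the counit (\<open>boundary_criterion\<close>). Over a field, projective
  bimodules are projective as right modules (\<open>projective_bimodule_right_lift\<close>), so the augmented complex \<open>P \<rightarrow> A\<close> has a right
  linear contraction. Applied to the first factor, it shows that every cycle of \<open>T n\<close> is homologous to the product of a fixed
  element of degree 1 with a cycle of \<open>T (n - 1)\<close>, and induction applies.

  Hence \<open>\<delta>\<^sub>N\<close> can be lifted degree by degree, downwards from degree 1, through the projective bimodules \<open>P i\<close>. On \<open>P i\<close> the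
  element to be bounded is a cycle in degree \<open>i + 2\<close> of \<open>T N\<close>, so that a condition on its counit arises only for \<open>i + 2 = N\<close>. Since
  \<open>i \<le> 1\<close>, this leaves \<open>N = 2\<close>, \<open>i = 0\<close>, where the counit is \<open>\<mu> d = 0\<close>, and \<open>N = 3\<close>, \<open>i = 1\<close>, where the two halves of the coassociator
  cancel (\<open>counit_coassociator\<close>). The start of \<open>\<delta>\<^sub>2\<close> on \<open>P 1\<close> is a lift of \<open>\<mu>\<close> through the surjection \<open>\<mu> \<otimes> \<mu>\<close>
  (\<open>diagonal_exists\<close>). For \<open>n > 2\<close> the counit of \<open>\<delta>\<^sub>n\<close> vanishes for reasons of degree: its values have degree at most 2, so some
  tensor factor is not of degree 1.

  Tensors are handled through representatives, which are integral combinations of words, up to the congruence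
  \<open>\<simeq>\<close> that the tensor relations generate. In this way signs and sums are computed in a free abelian group.\<close>

section \<open>Tensors as formal combinations of words\<close>

type_synonym 'p fr = "'p word \<Rightarrow>\<^sub>0 int"

definition cat :: "'p fr \<Rightarrow> 'p fr \<Rightarrow> 'p fr" (infixl "\<diamondop>" 70)
  where "x \<diamondop> y = frag_extend (\<lambda>u. frag_extend (\<lambda>v. frag_of (u @ v)) y) x"

definition sgn_pow :: "int \<Rightarrow> 'p fr \<Rightarrow> 'p fr"
  where "sgn_pow e x = (if even e then x else - x)"

abbreviation letter :: "int \<Rightarrow> 'p \<Rightarrow> 'p fr" where "letter i x \<equiv> frag_of [(i, x)]"

lemma frag_induct [case_names zero one diff]:
  assumes "P 0" "\<And>w. P (frag_of w)" "\<And>a b. P a \<Longrightarrow> P b \<Longrightarrow> P (a - b)"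
  shows "P (c :: 'b \<Rightarrow>\<^sub>0 int)"
  by (rule frag_induction[of c UNIV]) (use assms in auto)

lemma cat_of [simp]: "frag_of u \<diamondop> frag_of v = frag_of (u @ v)"
  by (simp add: cat_def)

lemma cat_diff_left: "(x - y) \<diamondop> z = x \<diamondop> z - y \<diamondop> z"
  by (simp add: cat_def frag_extend_diff)

lemma frag_extend_fun_diff: "frag_extend (\<lambda>w. f w - g w) x = frag_extend f x - frag_extend g x"
  by (induction x rule: frag_induct) (simp_all add: frag_extend_diff)

lemma frag_extend_fun_zero [simp]: "frag_extend (\<lambda>w. 0) x = 0"
  by (induction x rule: frag_induct) (simp_all add: frag_extend_diff)

lemma cat_diff_right: "x \<diamondop> (y - z) = x \<diamondop> y - x \<diamondop> z"
  by (simp add: cat_def frag_extend_diff frag_extend_fun_diff)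

lemma cat_zero [simp]: "0 \<diamondop> x = 0" "x \<diamondop> 0 = 0"
  by (simp_all add: cat_def)

lemma cat_minus: "(- x) \<diamondop> y = - (x \<diamondop> y)" "x \<diamondop> (- y) = - (x \<diamondop> y)"
  using cat_diff_left[of 0 x y] cat_diff_right[of x 0 y] by simp_all

lemma cat_add: "(x + y) \<diamondop> z = x \<diamondop> z + y \<diamondop> z" "x \<diamondop> (y + z) = x \<diamondop> y + x \<diamondop> z"
  using cat_diff_left[of x "- y" z] cat_diff_right[of x y "- z"] by (simp_all add: cat_minus)

lemma cat_assoc: "(x \<diamondop> y) \<diamondop> z = x \<diamondop> (y \<diamondop> z)"
proof (induction x rule: frag_induct)
  case (one u)
  show ?case
  proof (induction y rule: frag_induct)
    case (one v)
    show ?case by (induction z rule: frag_induct) (simp_all add: cat_diff_right)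
  qed (simp_all add: cat_diff_left cat_diff_right)
qed (simp_all add: cat_diff_left cat_diff_right)

lemma cat_Nil [simp]: "frag_of [] \<diamondop> x = x" "x \<diamondop> frag_of [] = x"
  by (induction x rule: frag_induct) (simp_all add: cat_diff_left cat_diff_right)

lemma cat_sum: "(\<Sum>s\<in>S. f s) \<diamondop> y = (\<Sum>s\<in>S. f s \<diamondop> y)" "y \<diamondop> (\<Sum>s\<in>S. f s) = (\<Sum>s\<in>S. y \<diamondop> f s)"
  by (induction S rule: infinite_finite_induct) (simp_all add: cat_add)

lemma sgn_pow_simps: "sgn_pow e (x - y) = sgn_pow e x - sgn_pow e y" "sgn_pow e (x + y) = sgn_pow e x + sgn_pow e y"
  "sgn_pow e 0 = 0" "sgn_pow 0 x = x" "sgn_pow e (- x) = - sgn_pow e x"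
  by (simp_all add: sgn_pow_def)

lemma sgn_pow_cat: "sgn_pow e x \<diamondop> y = sgn_pow e (x \<diamondop> y)" "x \<diamondop> sgn_pow e y = sgn_pow e (x \<diamondop> y)"
  by (simp_all add: sgn_pow_def cat_minus)

lemma sgn_pow_comp: "sgn_pow e (sgn_pow f x) = sgn_pow (e + f) x"
  by (simp add: sgn_pow_def)

lemma sgn_pow_sum: "sgn_pow e (sum f S) = (\<Sum>s\<in>S. sgn_pow e (f s))"
  by (induction S rule: infinite_finite_induct) (simp_all add: sgn_pow_simps)

lemma frag_extend_sgn_pow: "frag_extend f (sgn_pow e x) = sgn_pow e (frag_extend f x)"
  by (simp add: sgn_pow_def frag_extend_minus)

section \<open>Tensor powers through representatives\<close>

locale bimodule_family = unital_algebra K A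
  for K :: "('k, 'y) ring_scheme" and A :: "('k, 'a, 'z) module_scheme" +
  fixes C :: "int \<Rightarrow> ('a, 'p) bimodule"
  assumes bimodules: "bimodule K A (C i)"
begin

sublocale C: bimodule K A "C i" for i
  by (rule bimodules)

abbreviation W :: "nat \<Rightarrow> int \<Rightarrow> 'p word set" where "W \<equiv> tensor_words C"

abbreviation T :: "nat \<Rightarrow> int \<Rightarrow> ('a, 'p fr set) bimodule" where "T \<equiv> tensor_power A C"

text \<open>Representatives of tensors with \<open>n\<close> factors and total degree \<open>m\<close>.\<close>

definition vec :: "nat \<Rightarrow> int \<Rightarrow> 'p fr set"
  where "vec n m = {y. Poly_Mapping.keys y \<subseteq> W n m}"

text \<open>All numbers of factors and all degrees are put together, so that the congruence needs no indices. Nothing is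
  lost by this: see \<open>relators_rel\<close> below.\<close>

inductive_set rel :: "'p fr set"
  where
    zero: "0 \<in> rel"
  | relator: "r \<in> tensor_relators A C n m \<Longrightarrow> r \<in> rel"
  | diff: "x \<in> rel \<Longrightarrow> y \<in> rel \<Longrightarrow> x - y \<in> rel"

definition cong :: "'p fr \<Rightarrow> 'p fr \<Rightarrow> bool" (infix "\<simeq>" 50)
  where "x \<simeq> y \<longleftrightarrow> x - y \<in> rel"

definition cls :: "nat \<Rightarrow> int \<Rightarrow> 'p fr \<Rightarrow> 'p fr set"
  where "cls n m y =
    generate (free_Abelian_group (W n m)) (tensor_relators A C n m) #>\<^bsub>free_Abelian_group (W n m)\<^esub> y"

subsection \<open>Homogeneous combinations\<close>

lemma W_Cons: "(i, x) # w \<in> W n m \<longleftrightarrow> x \<in> carrier (C i) \<and> n \<ge> 1 \<and> w \<in> W (n - 1) (m - i)"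
  by (cases n) (auto simp: tensor_words_iff)

lemma W_append: "u \<in> W n m \<Longrightarrow> v \<in> W n' m' \<Longrightarrow> u @ v \<in> W (n + n') (m + m')"
  by (auto simp: tensor_words_iff)

lemma W_Nil: "[] \<in> W n m \<longleftrightarrow> n = 0 \<and> m = 0"
  by (auto simp: tensor_words_iff)

lemma vec_of [simp]: "frag_of w \<in> vec n m \<longleftrightarrow> w \<in> W n m"
  by (simp add: vec_def)

lemma vec_zero [simp, intro]: "0 \<in> vec n m"
  by (simp add: vec_def)

lemma vec_diff [intro]: "x \<in> vec n m \<Longrightarrow> y \<in> vec n m \<Longrightarrow> x - y \<in> vec n m"
  using keys_diff[of x y] by (auto simp: vec_def)

lemma vec_minus [intro]: "x \<in> vec n m \<Longrightarrow> - x \<in> vec n m"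
  using vec_diff[of 0 n m x] by simp

lemma vec_add [intro]: "x \<in> vec n m \<Longrightarrow> y \<in> vec n m \<Longrightarrow> x + y \<in> vec n m"
  using vec_diff[of x n m "- y"] by auto

lemma vec_sum: "(\<And>s. s \<in> S \<Longrightarrow> f s \<in> vec n m) \<Longrightarrow> sum f S \<in> vec n m"
  by (induction S rule: infinite_finite_induct) auto

lemma vec_sgn_pow [intro]: "x \<in> vec n m \<Longrightarrow> sgn_pow e x \<in> vec n m"
  by (auto simp: sgn_pow_def)

lemma vec_induct [consumes 1, case_names zero one diff]:
  assumes "y \<in> vec n m" "P 0" "\<And>w. w \<in> W n m \<Longrightarrow> P (frag_of w)"
    "\<And>a b. a \<in> vec n m \<Longrightarrow> b \<in> vec n m \<Longrightarrow> P a \<Longrightarrow> P b \<Longrightarrow> P (a - b)"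
  shows "P y"
proof -
  have "y \<in> vec n m \<and> P y"
  proof (rule frag_induction[of y "W n m"])
    show "Poly_Mapping.keys y \<subseteq> W n m" using assms(1) by (simp add: vec_def)
  qed (use assms in auto)
  then show ?thesis ..
qed

lemma vec_extend: "y \<in> vec n m \<Longrightarrow> (\<And>w. w \<in> W n m \<Longrightarrow> f w \<in> vec n' m') \<Longrightarrow> frag_extend f y \<in> vec n' m'"
  by (induction y rule: vec_induct) (auto simp: frag_extend_diff)

lemma vec_cat: "x \<in> vec n m \<Longrightarrow> y \<in> vec n' m' \<Longrightarrow> x \<diamondop> y \<in> vec (n + n') (m + m')"
  unfolding cat_def by (rule vec_extend, assumption, rule vec_extend, assumption) (simp add: W_append)

lemma vec_cat': "x \<in> vec n m \<Longrightarrow> y \<in> vec n' m' \<Longrightarrow> n'' = n + n' \<Longrightarrow> m'' = m + m' \<Longrightarrow> x \<diamondop> y \<in> vec n'' m''"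
  using vec_cat by simp

subsection \<open>The congruence of tensor relations\<close>

lemma rel_minus: "x \<in> rel \<Longrightarrow> - x \<in> rel"
  using rel.diff[OF rel.zero, of x] by simp

lemma rel_add: "x \<in> rel \<Longrightarrow> y \<in> rel \<Longrightarrow> x + y \<in> rel"
  using rel.diff[of x "- y"] rel_minus by simp

lemma cong_zero_iff: "x \<simeq> 0 \<longleftrightarrow> x \<in> rel"
  by (simp add: cong_def)

lemma cong_refl [simp, intro]: "x \<simeq> x"
  by (simp add: cong_def rel.zero)

lemma cong_sym: "x \<simeq> y \<Longrightarrow> y \<simeq> x"
  using rel_minus[of "x - y"] by (simp add: cong_def)

lemma cong_trans [trans]: "x \<simeq> y \<Longrightarrow> y \<simeq> z \<Longrightarrow> x \<simeq> z"
  using rel_add[of "x - y" "y - z"] by (simp add: cong_def)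

lemma cong_diff: "x \<simeq> y \<Longrightarrow> x' \<simeq> y' \<Longrightarrow> x - x' \<simeq> y - y'"
  using rel.diff[of "x - y" "x' - y'"] by (simp add: cong_def algebra_simps)

lemma cong_add: "x \<simeq> y \<Longrightarrow> x' \<simeq> y' \<Longrightarrow> x + x' \<simeq> y + y'"
  using rel_add[of "x - y" "x' - y'"] by (simp add: cong_def algebra_simps)

lemma cong_minus: "x \<simeq> y \<Longrightarrow> - x \<simeq> - y"
  using cong_diff[of 0 0 x y] by simp

lemma cong_sgn_pow: "x \<simeq> y \<Longrightarrow> sgn_pow e x \<simeq> sgn_pow e y"
  by (simp add: sgn_pow_def cong_minus)

lemma cong_sum: "(\<And>s. s \<in> S \<Longrightarrow> f s \<simeq> g s) \<Longrightarrow> sum f S \<simeq> sum g S"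
  by (induction S rule: infinite_finite_induct) (auto intro: cong_add)

abbreviation word_of_C :: "'p word \<Rightarrow> bool"
  where "word_of_C w \<equiv> w \<in> W (length w) (word_deg w)"

lemma word_of_C: "w \<in> W n m \<Longrightarrow> word_of_C w"
  by (auto simp: tensor_words_iff)

text \<open>Every relator is one of two short relators between two words.\<close>

lemma rel_induct [consumes 1, case_names zero add balance diff]:
  assumes "r \<in> rel" and "P 0"
    and add: "\<And>u v i x y. word_of_C u \<Longrightarrow> word_of_C v \<Longrightarrow> x \<in> carrier (C i) \<Longrightarrow> y \<in> carrier (C i) \<Longrightarrow>
      P (frag_of u \<diamondop> (letter i (x \<oplus>\<^bsub>C i\<^esub> y) - letter i x - letter i y) \<diamondop> frag_of v)"
    and balance: "\<And>u v i x j y a. word_of_C u \<Longrightarrow> word_of_C v \<Longrightarrow> x \<in> carrier (C i) \<Longrightarrow> y \<in> carrier (C j) \<Longrightarrow>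
      a \<in> carrier A \<Longrightarrow>
      P (frag_of u \<diamondop> (frag_of [(i, x \<star>\<^bsub>C i\<^esub> a), (j, y)] - frag_of [(i, x), (j, a \<odot>\<^bsub>C j\<^esub> y)]) \<diamondop> frag_of v)"
    and "\<And>x y. x \<in> rel \<Longrightarrow> y \<in> rel \<Longrightarrow> P x \<Longrightarrow> P y \<Longrightarrow> P (x - y)"
  shows "P r"
  using assms(1)
proof induction
  case (relator r n m)
  then show ?case
    unfolding tensor_relators_def
  proof (elim UnE CollectE exE conjE, goal_cases)
    case (1 u i x y v)
    then show ?case
      using add[of u v x i y] by (simp add: cat_diff_left cat_diff_right tensor_words_iff)
  next
    case (2 u i x a j y v)
    then show ?case
      using balance[of u v x i y j a] by (simp add: cat_diff_left cat_diff_right tensor_words_iff)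
  qed
qed (use assms in auto)

lemma rel_add_core:
  assumes "word_of_C u" "word_of_C v" "x \<in> carrier (C i)" "y \<in> carrier (C i)"
  shows "frag_of u \<diamondop> (letter i (x \<oplus>\<^bsub>C i\<^esub> y) - letter i x - letter i y) \<diamondop> frag_of v \<in> rel"
proof -
  let ?w = "u @ (i, x) # v"
  have "?w \<in> W (length ?w) (word_deg ?w)" using assms by (auto simp: tensor_words_iff)
  from rel.relator[OF additivity_relator[OF this assms(4)]] show ?thesis
    by (simp add: cat_diff_left cat_diff_right)
qed

lemma rel_balance_core:
  assumes "word_of_C u" "word_of_C v" "x \<in> carrier (C i)" "y \<in> carrier (C j)" "a \<in> carrier A"
  shows "frag_of u \<diamondop> (frag_of [(i, x \<star>\<^bsub>C i\<^esub> a), (j, y)] - frag_of [(i, x), (j, a \<odot>\<^bsub>C j\<^esub> y)]) \<diamondop> frag_of v \<in> rel"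
proof -
  let ?w = "u @ (i, x) # (j, y) # v"
  have "?w \<in> W (length ?w) (word_deg ?w)" using assms by (auto simp: tensor_words_iff)
  from rel.relator[OF balance_relator[OF this assms(5)]] show ?thesis
    by (simp add: cat_diff_left cat_diff_right)
qed

lemma letter_add: "x \<in> carrier (C i) \<Longrightarrow> y \<in> carrier (C i) \<Longrightarrow> letter i (x \<oplus>\<^bsub>C i\<^esub> y) \<simeq> letter i x + letter i y"
  using rel_add_core[of "[]" "[]" x i y] by (simp add: cong_def W_Nil diff_diff_eq)

lemma rel_cat_left: "y \<in> vec n m \<Longrightarrow> r \<in> rel \<Longrightarrow> y \<diamondop> r \<in> rel"
proof (induction y rule: vec_induct)
  case (one w)
  have *: "word_of_C (w @ u)" if "word_of_C u" for u using one(1) that by (auto simp: tensor_words_iff)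
  from one(2) show ?case
  proof (induction rule: rel_induct)
    case (add u v i x y)
    then show ?case using rel_add_core[OF *, of u v x i y] by (simp add: cat_assoc[symmetric])
  next
    case (balance u v i x j y a)
    then show ?case using rel_balance_core[OF *, of u v x i y j a] by (simp add: cat_assoc[symmetric])
  qed (auto simp: cat_diff_right intro: rel.zero rel.diff)
qed (auto simp: cat_diff_left intro: rel.zero rel.diff)

lemma rel_cat_right: "y \<in> vec n m \<Longrightarrow> r \<in> rel \<Longrightarrow> r \<diamondop> y \<in> rel"
proof (induction y rule: vec_induct)
  case (one w)
  have *: "word_of_C (u @ w)" if "word_of_C u" for u using one(1) that by (auto simp: tensor_words_iff)
  from one(2) show ?case
  proof (induction rule: rel_induct)
    case (add u v i x y)
    then show ?case using rel_add_core[OF _ *, of u v x i y] by (simp add: cat_assoc)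
  next
    case (balance u v i x j y a)
    then show ?case using rel_balance_core[OF _ *, of u v x i y j a] by (simp add: cat_assoc)
  qed (auto simp: cat_diff_left intro: rel.zero rel.diff)
qed (auto simp: cat_diff_right intro: rel.zero rel.diff)

lemma cong_cat_left: "y \<in> vec n m \<Longrightarrow> x \<simeq> x' \<Longrightarrow> y \<diamondop> x \<simeq> y \<diamondop> x'"
  using rel_cat_left by (simp add: cong_def cat_diff_right[symmetric])

lemma cong_cat_right: "y \<in> vec n m \<Longrightarrow> x \<simeq> x' \<Longrightarrow> x \<diamondop> y \<simeq> x' \<diamondop> y"
  using rel_cat_right by (simp add: cong_def cat_diff_left[symmetric])

lemma letter_vec: "x \<in> carrier (C i) \<Longrightarrow> letter i x \<in> vec 1 i"
  by (simp add: W_Cons W_Nil)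

lemma letter_zero: "letter i \<zero>\<^bsub>C i\<^esub> \<simeq> 0"
  using letter_add[of "\<zero>\<^bsub>C i\<^esub>" i "\<zero>\<^bsub>C i\<^esub>"] rel_minus by (fastforce simp: cong_def)

lemma rel_extend:
  assumes "r \<in> rel"
    and "\<And>u v i x y. word_of_C u \<Longrightarrow> word_of_C v \<Longrightarrow> x \<in> carrier (C i) \<Longrightarrow> y \<in> carrier (C i) \<Longrightarrow>
      f (u @ (i, x \<oplus>\<^bsub>C i\<^esub> y) # v) \<simeq> f (u @ (i, x) # v) + f (u @ (i, y) # v)"
    and "\<And>u v i x j y a. word_of_C u \<Longrightarrow> word_of_C v \<Longrightarrow> x \<in> carrier (C i) \<Longrightarrow> y \<in> carrier (C j) \<Longrightarrow>
      a \<in> carrier A \<Longrightarrow> f (u @ (i, x \<star>\<^bsub>C i\<^esub> a) # (j, y) # v) \<simeq> f (u @ (i, x) # (j, a \<odot>\<^bsub>C j\<^esub> y) # v)"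
  shows "frag_extend f r \<in> rel"
  using assms(1)
proof (induction rule: rel_induct)
  case (add u v i x y)
  then show ?case using assms(2)[of u v x i y]
    by (simp add: cat_diff_left cat_diff_right frag_extend_diff frag_extend_add cat_add cong_def diff_diff_eq)
next
  case (balance u v i x j y a)
  then show ?case using assms(3)[of u v x i y j a]
    by (simp add: cat_diff_left cat_diff_right frag_extend_diff cong_def)
qed (auto simp: frag_extend_diff intro: rel.zero rel.diff)

subsection \<open>The actions\<close>

definition lact :: "'a \<Rightarrow> 'p fr \<Rightarrow> 'p fr" where "lact a = frag_extend (\<lambda>w. frag_of (lact_word C a w))"
definition ract :: "'a \<Rightarrow> 'p fr \<Rightarrow> 'p fr" where "ract a = frag_extend (\<lambda>w. frag_of (ract_word C w a))"

lemma lact_diff: "lact a (x - y) = lact a x - lact a y" and ract_diff: "ract a (x - y) = ract a x - ract a y"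
  and lact_zero [simp]: "lact a 0 = 0" and ract_zero [simp]: "ract a 0 = 0"
  and lact_add: "lact a (x + y) = lact a x + lact a y" and ract_add: "ract a (x + y) = ract a x + ract a y"
  and lact_sgn_pow: "lact a (sgn_pow e x) = sgn_pow e (lact a x)" and ract_sgn_pow: "ract a (sgn_pow e x) = sgn_pow e (ract a x)"
  and lact_of [simp]: "lact a (frag_of w) = frag_of (lact_word C a w)"
  and ract_of [simp]: "ract a (frag_of w) = frag_of (ract_word C w a)"
  by (simp_all add: lact_def ract_def frag_extend_diff frag_extend_add frag_extend_sgn_pow)

lemma lact_sum: "lact a (sum f S) = (\<Sum>s\<in>S. lact a (f s))" and ract_sum: "ract a (sum f S) = (\<Sum>s\<in>S. ract a (f s))"
  by (induction S rule: infinite_finite_induct) (simp_all add: lact_add ract_add)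

lemma lact_vec: "a \<in> carrier A \<Longrightarrow> y \<in> vec n m \<Longrightarrow> lact a y \<in> vec n m"
  unfolding lact_def using lact_words[OF bimodules] by (intro vec_extend) auto

lemma ract_vec: "a \<in> carrier A \<Longrightarrow> y \<in> vec n m \<Longrightarrow> ract a y \<in> vec n m"
  unfolding ract_def using ract_words[OF bimodules] by (intro vec_extend) auto

lemma lact_cat: "y \<in> vec n m \<Longrightarrow> n \<ge> 1 \<Longrightarrow> lact a (y \<diamondop> z) = lact a y \<diamondop> z"
proof (induction y rule: vec_induct)
  case (one w)
  then have "w \<noteq> []" by (auto simp: tensor_words_iff)
  then show ?case
    by (induction z rule: frag_induct) (simp_all add: cat_diff_right lact_diff lact_word_append[OF bimodules])
qed (simp_all add: cat_diff_left lact_diff)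

lemma ract_cat: "z \<in> vec n m \<Longrightarrow> n \<ge> 1 \<Longrightarrow> ract a (y \<diamondop> z) = y \<diamondop> ract a z"
proof (induction z rule: vec_induct)
  case (one w)
  then have "w \<noteq> []" by (auto simp: tensor_words_iff)
  then show ?case
    by (induction y rule: frag_induct) (simp_all add: cat_diff_left ract_diff ract_word_append[OF bimodules])
qed (simp_all add: cat_diff_right ract_diff)

text \<open>The balancing relator for the two letters that meet, extended to combinations of words.\<close>

lemma balanced:
  assumes "y \<in> vec n m" "n \<ge> 1" "z \<in> vec n' m'" "n' \<ge> 1" and a: "a \<in> carrier A"
  shows "ract a y \<diamondop> z \<simeq> y \<diamondop> lact a z"
  using assms(1)
proof (induction y rule: vec_induct)
  case (one u)
  from assms(3) show ?case
  proof (induction z rule: vec_induct)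
    case (one v)
    obtain j y v' where v: "v = (j, y) # v'" using one(1) assms(4) by (cases v) (auto simp: tensor_words_iff)
    obtain u' i x where u: "u = u' @ [(i, x)]"
      using \<open>u \<in> W n m\<close> assms(2) by (cases u rule: rev_cases) (auto simp: tensor_words_iff)
    have "word_of_C u'" "word_of_C v'" "x \<in> carrier (C i)" "y \<in> carrier (C j)"
      using \<open>u \<in> W n m\<close> one(1) by (auto simp: u v tensor_words_iff)
    from rel_balance_core[OF this a] show ?case
      by (simp add: u v cong_def cat_diff_left cat_diff_right ract_word_append[OF bimodules])
  qed (auto simp: cat_diff_right lact_diff intro: cong_diff)
qed (auto simp: cat_diff_left ract_diff intro: cong_diff)

lemma rel_lact: 
  assumes a: "a \<in> carrier A" and r: "r \<in> rel"
  shows "lact a r \<in> rel"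
  unfolding lact_def
proof (rule rel_extend[OF r])
  fix u v i x y assume w: "word_of_C u" "word_of_C v" and x: "x \<in> carrier (C i)" "y \<in> carrier (C i)"
  have "word_of_C (lact_word C a u)" using w by (intro word_of_C[OF lact_words[OF bimodules a]])
  then show "frag_of (lact_word C a (u @ (i, x \<oplus>\<^bsub>C i\<^esub> y) # v)) \<simeq>
     frag_of (lact_word C a (u @ (i, x) # v)) + frag_of (lact_word C a (u @ (i, y) # v))"
    using rel_add_core[of "lact_word C a u" v x i y] rel_add_core[of "[]" v "a \<odot>\<^bsub>C i\<^esub> x" i "a \<odot>\<^bsub>C i\<^esub> y"] w x a
    by (cases "u = []")
     (simp_all add: lact_word_append[OF bimodules] cat_diff_left cat_diff_right cat_add cong_def diff_diff_eq W_Nil C.l_add C.l_closed)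
next
  fix u v i x j y b assume w: "word_of_C u" "word_of_C v" and x: "x \<in> carrier (C i)" "y \<in> carrier (C j)" and b: "b \<in> carrier A"
  have "word_of_C (lact_word C a u)" using w by (intro word_of_C[OF lact_words[OF bimodules a]])
  then show "frag_of (lact_word C a (u @ (i, x \<star>\<^bsub>C i\<^esub> b) # (j, y) # v)) \<simeq>
     frag_of (lact_word C a (u @ (i, x) # (j, b \<odot>\<^bsub>C j\<^esub> y) # v))"
    using rel_balance_core[of "lact_word C a u" v x i y j b] rel_balance_core[of "[]" v "a \<odot>\<^bsub>C i\<^esub> x" i y j b] w x a b
    by (cases "u = []")
     (simp_all add: lact_word_append[OF bimodules] cat_diff_left cat_diff_right cong_def W_Nil C.lr_assoc C.l_closed)
qed

lemma lact_zero_scalar: "y \<in> vec n m \<Longrightarrow> n \<ge> 1 \<Longrightarrow> lact \<zero>\<^bsub>A\<^esub> y \<simeq> 0"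
proof (induction y rule: vec_induct)
  case (one w)
  then obtain i x v where w: "w = (i, x) # v" "x \<in> carrier (C i)" "v \<in> W (n - 1) (m - i)"
    by (cases w) (auto simp: W_Cons W_Nil)
  have "\<zero>\<^bsub>A\<^esub> \<odot>\<^bsub>C i\<^esub> x = \<zero>\<^bsub>C i\<^esub>"
    using C.add_l[of "\<zero>\<^bsub>A\<^esub>" "\<zero>\<^bsub>A\<^esub>" x i] w(2) C.l_closed[of "\<zero>\<^bsub>A\<^esub>" x i]
    by (simp add: C.M.add.l_cancel_one')
  then have "lact \<zero>\<^bsub>A\<^esub> (frag_of w) = letter i \<zero>\<^bsub>C i\<^esub> \<diamondop> frag_of v" using w by simp
  then show ?case using cong_cat_right[OF _ letter_zero, of "frag_of v"] w by simp
qed (auto simp: lact_diff intro: cong_diff[of _ 0 _ 0, simplified])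

subsection \<open>Classes\<close>

lemma vec_carrier: "vec n m = carrier (free_Abelian_group (W n m))"
  by (auto simp: vec_def)

text \<open>The projection of formal combinations to the words with \<open>n\<close> letters and degree \<open>m\<close> sends a relator to itself or to \<open>0\<close>.
  A combination of relators that is homogeneous is thus a combination of relators of its own type.\<close>

lemma relators_rel: "generate (free_Abelian_group (W n m)) (tensor_relators A C n m) = rel \<inter> vec n m"
proof -
  let ?F = "free_Abelian_group (W n m)" and ?R = "tensor_relators A C n m"
  interpret F: comm_group ?F by (rule abelian_free_Abelian_group)
  have sub: "?R \<subseteq> carrier ?F" by (rule tensor_relators_carrier[OF bimodules])
  have G: "subgroup (generate ?F ?R) ?F" using sub by (rule F.generate_is_subgroup)
  have 1: "x \<in> rel \<inter> vec n m" if "x \<in> generate ?F ?R" for x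
    using that
  proof induction
    case (inv h)
    then have "h \<in> vec n m" "h \<in> rel" using sub vec_carrier by (auto intro: rel.relator simp del: carrier_free_Abelian_group_iff)
    then show ?case by (auto simp: vec_def rel_minus)
  qed (use sub in \<open>auto simp: vec_carrier[symmetric] rel.zero rel_add intro: rel.relator simp del: carrier_free_Abelian_group_iff\<close>)
  have g0: "0 \<in> generate ?F ?R" using generate.one[of ?F ?R] by (simp only: one_free_Abelian_group)
  define \<pi> :: "'p fr \<Rightarrow> 'p fr" where "\<pi> = frag_extend (\<lambda>w. if length w = n \<and> word_deg w = m then frag_of w else 0)"
  have \<pi>: "\<pi> x \<in> generate ?F ?R" if "x \<in> rel" for x
    using that
  proof induction
    case zero
    show ?case unfolding \<pi>_def frag_extend_0 by (rule g0)
  next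
    case (relator r n' m')
    have kr: "r \<in> vec n' m'"
      unfolding vec_carrier by (rule subsetD[OF tensor_relators_carrier[OF bimodules] relator])
    have "\<pi> y = (if n = n' \<and> m = m' then y else 0)" if "y \<in> vec n' m'" for y
      using that by (induction y rule: vec_induct) (auto simp: \<pi>_def frag_extend_diff tensor_words_iff)
    from this[OF kr] show ?case using relator g0 generate.incl[of r ?R ?F] by (cases "n = n' \<and> m = m'") auto
  next
    case (diff x y)
    have "Poly_Mapping.keys (\<pi> y) \<subseteq> W n m" using 1[OF diff.IH(2)] by (simp add: vec_def)
    then have "\<pi> x - \<pi> y = \<pi> x \<otimes>\<^bsub>?F\<^esub> inv\<^bsub>?F\<^esub> \<pi> y" by simp
    also have "\<dots> \<in> generate ?F ?R"
      by (rule subgroup.m_closed[OF G diff.IH(1) subgroup.m_inv_closed[OF G diff.IH(2)]])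
    finally show ?case unfolding \<pi>_def frag_extend_diff .
  qed
  have "\<pi> x = x" if "x \<in> vec n m" for x
    using that by (induction x rule: vec_induct) (auto simp: \<pi>_def frag_extend_diff tensor_words_iff)
  then have "x \<in> generate ?F ?R" if "x \<in> rel \<inter> vec n m" for x using \<pi>[of x] that by simp
  with 1 show ?thesis by blast
qed

lemma T_simps: "carrier (T n m) = carrier (presented (W n m) (tensor_relators A C n m))"
  "add (T n m) = add (presented (W n m) (tensor_relators A C n m))"
  "\<zero>\<^bsub>T n m\<^esub> = \<zero>\<^bsub>presented (W n m) (tensor_relators A C n m)\<^esub>"
  by (simp_all add: tensor_power_def Let_def)

lemma cls_closed [intro]: "y \<in> vec n m \<Longrightarrow> cls n m y \<in> carrier (T n m)"
  unfolding T_simps cls_def vec_def by (rule presented_coset_closed[OF tensor_relators_carrier[OF bimodules]]) simp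

lemma cls_cases:
  assumes "Y \<in> carrier (T n m)"
  obtains y where "y \<in> vec n m" "Y = cls n m y"
  using presented_cases[OF tensor_relators_carrier[OF bimodules] assms[unfolded T_simps]]
  unfolding cls_def vec_def by blast

lemma cls_eq_iff:
  assumes "x \<in> vec n m" "y \<in> vec n m"
  shows "cls n m x = cls n m y \<longleftrightarrow> x \<simeq> y"
proof -
  let ?F = "free_Abelian_group (W n m)" and ?N = "rel \<inter> vec n m"
  interpret F: comm_group ?F by (rule abelian_free_Abelian_group)
  have G: "subgroup ?N ?F"
    unfolding relators_rel[symmetric] by (rule F.generate_is_subgroup[OF tensor_relators_carrier[OF bimodules]])
  have x: "x \<in> carrier ?F" "y \<in> carrier ?F" using assms vec_carrier by auto
  have "?N #>\<^bsub>?F\<^esub> x = ?N #>\<^bsub>?F\<^esub> y \<longleftrightarrow> x \<otimes>\<^bsub>?F\<^esub> inv\<^bsub>?F\<^esub> y \<in> ?N"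
  proof
    assume "?N #>\<^bsub>?F\<^esub> x = ?N #>\<^bsub>?F\<^esub> y"
    then have "x \<in> ?N #>\<^bsub>?F\<^esub> y" using F.rcos_self[OF x(1) G] by simp
    then obtain n where "n \<in> ?N" "x = n + y" by (auto simp: r_coset_def)
    then show "x \<otimes>\<^bsub>?F\<^esub> inv\<^bsub>?F\<^esub> y \<in> ?N" using assms by (auto simp: vec_def)
  next
    assume "x \<otimes>\<^bsub>?F\<^esub> inv\<^bsub>?F\<^esub> y \<in> ?N"
    then have "x \<in> ?N #>\<^bsub>?F\<^esub> y" using assms by (auto simp: r_coset_def vec_def intro!: bexI[of _ "x - y"])
    then show "?N #>\<^bsub>?F\<^esub> x = ?N #>\<^bsub>?F\<^esub> y" using F.repr_independence[OF _ x(2) G] by metis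
  qed
  also have "\<dots> \<longleftrightarrow> x \<simeq> y" using assms vec_diff[OF assms] by (auto simp: cong_def vec_def)
  finally show ?thesis by (simp add: cls_def relators_rel)
qed

lemma cls_of: "cls n m (frag_of w) = tensor A C n m w"
  by (simp add: cls_def presented_gen_def)

lemma cls_hom: "cls n m \<in> hom (free_Abelian_group (W n m)) (add_monoid (T n m))"
proof -
  show ?thesis
    using presented_coset_hom[OF tensor_relators_carrier[OF bimodules, where n = n and m = m]]
    by (simp add: cls_def[abs_def] hom_def T_simps)
qed

lemma cls_add: "x \<in> vec n m \<Longrightarrow> y \<in> vec n m \<Longrightarrow> cls n m (x + y) = cls n m x \<oplus>\<^bsub>T n m\<^esub> cls n m y"
  using cls_hom[of n m] unfolding hom_def vec_carrier by auto

lemma cls_zero: "cls n m 0 = \<zero>\<^bsub>T n m\<^esub>"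
proof -
  interpret F: comm_group "free_Abelian_group (W n m)" by (rule abelian_free_Abelian_group)
  have "cls n m 0 = generate (free_Abelian_group (W n m)) (tensor_relators A C n m)"
    unfolding cls_def using F.coset_mult_one[OF subgroup.subset[OF F.generate_is_subgroup[OF tensor_relators_carrier[OF bimodules]]]] by simp
  then show ?thesis by (simp add: T_simps presented_def)
qed

lemma T_bimodule: "n \<ge> 1 \<Longrightarrow> bimodule K A (T n m)"
  by (rule tensor_power_bimodule[OF bimodules])

lemma T_abelian: "abelian_group (T n m)"
proof -
  have P: "abelian_group (presented (W n m) (tensor_relators A C n m))"
    by (rule presented_abelian_group[OF tensor_relators_carrier[OF bimodules]])
  interpret P: abelian_group "presented (W n m) (tensor_relators A C n m)" by (rule P)
  show ?thesis
    by (rule abelian_groupI) (auto simp: T_simps P.a_ac intro: P.l_neg P.a_inv_closed)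
qed

lemma cls_minus: "x \<in> vec n m \<Longrightarrow> cls n m (- x) = \<ominus>\<^bsub>T n m\<^esub> cls n m x"
proof -
  assume x: "x \<in> vec n m"
  interpret T: abelian_group "T n m" by (rule T_abelian)
  show ?thesis using cls_add[of "- x" n m x] x vec_minus[OF x] cls_closed by (simp add: cls_zero T.minus_equality)
qed

lemma cls_sgn_pow: "x \<in> vec n m \<Longrightarrow> cls n m (sgn_pow e x) = koszul (T n m) e (cls n m x)"
  by (simp add: sgn_pow_def koszul_def cls_minus)

lemma cls_sum:
  assumes "finite S" "\<And>s. s \<in> S \<Longrightarrow> f s \<in> vec n m"
  shows "cls n m (sum f S) = (\<Oplus>\<^bsub>T n m\<^esub>s\<in>S. cls n m (f s))"
proof -
  interpret T: abelian_group "T n m" by (rule T_abelian)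
  show ?thesis using assms
  proof (induction S)
    case (insert s S)
    have "cls n m (sum f (insert s S)) = cls n m (f s) \<oplus>\<^bsub>T n m\<^esub> cls n m (sum f S)"
      using insert.hyps insert.prems vec_sum[of S f n m] by (simp add: cls_add)
    also have "\<dots> = cls n m (f s) \<oplus>\<^bsub>T n m\<^esub> (\<Oplus>\<^bsub>T n m\<^esub>s\<in>S. cls n m (f s))"
      using insert by simp
    also have "\<dots> = (\<Oplus>\<^bsub>T n m\<^esub>s\<in>insert s S. cls n m (f s))"
      using insert.hyps insert.prems cls_closed by (intro T.finsum_insert[symmetric]) auto
    finally show ?case .
  qed (simp add: cls_zero)
qed

lemma additive_eq:
  assumes M: "abelian_group M" and y: "y \<in> vec n m"
    and f: "\<And>x. x \<in> vec n m \<Longrightarrow> f x \<in> carrier M" "\<And>x y. x \<in> vec n m \<Longrightarrow> y \<in> vec n m \<Longrightarrow> f (x + y) = f x \<oplus>\<^bsub>M\<^esub> f y"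
    and g: "\<And>x. x \<in> vec n m \<Longrightarrow> g x \<in> carrier M" "\<And>x y. x \<in> vec n m \<Longrightarrow> y \<in> vec n m \<Longrightarrow> g (x + y) = g x \<oplus>\<^bsub>M\<^esub> g y"
    and eq: "\<And>w. w \<in> W n m \<Longrightarrow> f (frag_of w) = g (frag_of w)"
  shows "f y = g y"
proof -
  interpret M: abelian_group M by fact
  show ?thesis using y
  proof (induction y rule: vec_induct)
    case zero
    have "f 0 \<oplus>\<^bsub>M\<^esub> f 0 = f 0" "g 0 \<oplus>\<^bsub>M\<^esub> g 0 = g 0" using f(2)[of 0 0] g(2)[of 0 0] by (metis add_0 vec_zero)+
    then show ?case using f(1)[of 0] g(1)[of 0] by simp
  next
    case (diff a b)
    then have "f (a - b) \<oplus>\<^bsub>M\<^esub> f b = g (a - b) \<oplus>\<^bsub>M\<^esub> f b"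
      using f(2)[of "a - b" b] g(2)[of "a - b" b] vec_diff by simp
    then show ?case using diff f(1) g(1) by (metis M.add.right_cancel vec_diff)
  qed (use eq in auto)
qed

lemma cls_lact: 
  assumes "n \<ge> 1" "a \<in> carrier A" "y \<in> vec n m"
  shows "cls n m (lact a y) = a \<odot>\<^bsub>T n m\<^esub> cls n m y"
proof -
  interpret B: bimodule K A "T n m" by (rule T_bimodule[OF assms(1)])
  show ?thesis
    by (rule additive_eq[OF T_abelian assms(3)])
      (use assms tensor_power_bimodule(2)[OF bimodules assms(1), where m = m and a = a] in
       \<open>auto simp: lact_add cls_add lact_vec cls_closed B.l_closed B.l_add cls_of\<close>)
qed

lemma cls_ract: 
  assumes "n \<ge> 1" "a \<in> carrier A" "y \<in> vec n m"
  shows "cls n m (ract a y) = cls n m y \<star>\<^bsub>T n m\<^esub> a"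
proof -
  interpret B: bimodule K A "T n m" by (rule T_bimodule[OF assms(1)])
  show ?thesis
    by (rule additive_eq[OF T_abelian assms(3)])
      (use assms tensor_power_bimodule(3)[OF bimodules assms(1), where m = m and a = a] in
       \<open>auto simp: ract_add cls_add ract_vec cls_closed B.r_closed B.r_add cls_of\<close>)
qed

end

section \<open>Coderivations\<close>

text \<open>On words of \<open>r + 1 + t\<close> letters, \<open>insw g r\<close> is \<open>1\<^sup>r \<otimes> g \<otimes> 1\<^sup>t\<close> with the Koszul sign of an odd map. It is zero on
  words that are too short.\<close>

fun insw :: "(int \<Rightarrow> 'p \<Rightarrow> 'p fr) \<Rightarrow> nat \<Rightarrow> 'p word \<Rightarrow> 'p fr"
  where
    "insw g r [] = 0"
  | "insw g 0 ((i, x) # w) = g i x \<diamondop> frag_of w"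
  | "insw g (Suc r) ((i, x) # w) = sgn_pow i (letter i x \<diamondop> insw g r w)"

definition ins :: "(int \<Rightarrow> 'p \<Rightarrow> 'p fr) \<Rightarrow> nat \<Rightarrow> 'p fr \<Rightarrow> 'p fr"
  where "ins g r = frag_extend (insw g r)"

text \<open>The extension of \<open>g\<close> to all tensors as an odd derivation of concatenation.\<close>

definition der :: "(int \<Rightarrow> 'p \<Rightarrow> 'p fr) \<Rightarrow> 'p fr \<Rightarrow> 'p fr"
  where "der g = frag_extend (\<lambda>w. \<Sum>r<length w. insw g r w)"

lemma insw_split:
  "r < length w \<Longrightarrow> insw g r w =
    sgn_pow (word_deg (take r w)) (frag_of (take r w) \<diamondop> (case w ! r of (i, x) \<Rightarrow> g i x) \<diamondop> frag_of (drop (Suc r) w))"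
proof (induction g r w rule: insw.induct)
  case (3 g r i x w)
  have "letter i x \<diamondop> (frag_of (take r w) \<diamondop> z) = frag_of ((i, x) # take r w) \<diamondop> z" for z
    by (simp add: cat_assoc[symmetric])
  with 3 show ?case by (simp add: sgn_pow_cat sgn_pow_comp cat_assoc)
qed (auto simp: sgn_pow_simps)

lemma ins_simps: "ins g r (x - y) = ins g r x - ins g r y" "ins g r 0 = 0" "ins g r (frag_of w) = insw g r w"
  "ins g r (sgn_pow e x) = sgn_pow e (ins g r x)"
  by (simp_all add: ins_def frag_extend_diff frag_extend_sgn_pow)

lemma der_simps: "der g (x - y) = der g x - der g y" "der g (x + y) = der g x + der g y" "der g 0 = 0"
  "der g (- x) = - der g x" "der g (sgn_pow e x) = sgn_pow e (der g x)" "der g (frag_of []) = 0"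
  by (simp_all add: der_def frag_extend_diff frag_extend_add frag_extend_sgn_pow frag_extend_minus)

lemma der_sum: "der g (sum f S) = (\<Sum>s\<in>S. der g (f s))"
  by (induction S rule: infinite_finite_induct) (simp_all add: der_simps)

lemma der_letter_cat: "der g (letter i x \<diamondop> y) = g i x \<diamondop> y + sgn_pow i (letter i x \<diamondop> der g y)"
proof (induction y rule: frag_induct)
  case (one w)
  show ?case
    by (simp add: der_def sum.lessThan_Suc_shift sgn_pow_sum cat_sum del: sum.lessThan_Suc)
qed (simp_all add: cat_diff_right der_simps sgn_pow_simps)

lemma der_letter: "der g (letter i x) = g i x"
  using der_letter_cat[of g i x "frag_of []"] by (simp add: der_simps sgn_pow_simps)

context bimodule_family
begin

text \<open>The function \<open>f\<close> chooses representatives for a bimodule map; it need not itself be additive.\<close>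

definition ghom :: "nat \<Rightarrow> int \<Rightarrow> int \<Rightarrow> ('p \<Rightarrow> 'p fr) \<Rightarrow> bool"
  where "ghom n m i f \<longleftrightarrow> (\<forall>x\<in>carrier (C i). f x \<in> vec n m) \<and> (\<lambda>x. cls n m (f x)) \<in> bimodule_hom A (C i) (T n m)"

lemma ghom_iff:
  assumes "n \<ge> 1"
  shows "ghom n m i f \<longleftrightarrow> (\<forall>x\<in>carrier (C i). f x \<in> vec n m) \<and>
    (\<forall>x\<in>carrier (C i). \<forall>y\<in>carrier (C i). f (x \<oplus>\<^bsub>C i\<^esub> y) \<simeq> f x + f y) \<and>
    (\<forall>a\<in>carrier A. \<forall>x\<in>carrier (C i). f (a \<odot>\<^bsub>C i\<^esub> x) \<simeq> lact a (f x)) \<and>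
    (\<forall>a\<in>carrier A. \<forall>x\<in>carrier (C i). f (x \<star>\<^bsub>C i\<^esub> a) \<simeq> ract a (f x))"
  unfolding ghom_def
proof (rule conj_cong[OF refl])
  assume f: "\<forall>x\<in>carrier (C i). f x \<in> vec n m"
  have 1: "cls n m (f (x \<oplus>\<^bsub>C i\<^esub> y)) = cls n m (f x) \<oplus>\<^bsub>T n m\<^esub> cls n m (f y) \<longleftrightarrow> f (x \<oplus>\<^bsub>C i\<^esub> y) \<simeq> f x + f y"
    if "x \<in> carrier (C i)" "y \<in> carrier (C i)" for x y
    using that f by (simp add: cls_add[symmetric] cls_eq_iff vec_add)
  have 2: "cls n m (f (a \<odot>\<^bsub>C i\<^esub> x)) = a \<odot>\<^bsub>T n m\<^esub> cls n m (f x) \<longleftrightarrow> f (a \<odot>\<^bsub>C i\<^esub> x) \<simeq> lact a (f x)"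
    "cls n m (f (x \<star>\<^bsub>C i\<^esub> a)) = cls n m (f x) \<star>\<^bsub>T n m\<^esub> a \<longleftrightarrow> f (x \<star>\<^bsub>C i\<^esub> a) \<simeq> ract a (f x)"
    if "x \<in> carrier (C i)" "a \<in> carrier A" for x a
    using that f assms
    by (simp_all add: cls_lact[symmetric] cls_ract[symmetric] cls_eq_iff lact_vec ract_vec C.l_closed C.r_closed)
  show "((\<lambda>x. cls n m (f x)) \<in> bimodule_hom A (C i) (T n m)) \<longleftrightarrow>
    (\<forall>x\<in>carrier (C i). \<forall>y\<in>carrier (C i). f (x \<oplus>\<^bsub>C i\<^esub> y) \<simeq> f x + f y) \<and>
    (\<forall>a\<in>carrier A. \<forall>x\<in>carrier (C i). f (a \<odot>\<^bsub>C i\<^esub> x) \<simeq> lact a (f x)) \<and>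
    (\<forall>a\<in>carrier A. \<forall>x\<in>carrier (C i). f (x \<star>\<^bsub>C i\<^esub> a) \<simeq> ract a (f x))"
    using f by (simp add: bimodule_hom_def 1 2 cls_closed Pi_def)
qed

lemma ghom_vec: "ghom n m i f \<Longrightarrow> x \<in> carrier (C i) \<Longrightarrow> f x \<in> vec n m"
  by (simp add: ghom_def)

lemma ghom_zero:
  assumes "ghom n m i f" "n \<ge> 1"
  shows "f \<zero>\<^bsub>C i\<^esub> \<simeq> 0"
proof -
  have "f (\<zero>\<^bsub>C i\<^esub> \<oplus>\<^bsub>C i\<^esub> \<zero>\<^bsub>C i\<^esub>) \<simeq> f \<zero>\<^bsub>C i\<^esub> + f \<zero>\<^bsub>C i\<^esub>" using assms unfolding ghom_iff[OF assms(2)] by blast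
  then show ?thesis using rel_minus by (fastforce simp: cong_def)
qed

definition gmap :: "nat \<Rightarrow> (int \<Rightarrow> 'p \<Rightarrow> 'p fr) \<Rightarrow> bool"
  where "gmap s g \<longleftrightarrow> s \<ge> 1 \<and> (\<forall>i. ghom s (i + 1) i (g i))"

context
  fixes s g assumes g: "gmap s g"
begin

lemma gmap_pos: "s \<ge> 1"
  using g by (simp add: gmap_def)

lemma gmap_vec: "x \<in> carrier (C i) \<Longrightarrow> g i x \<in> vec s (i + 1)"
  using g by (simp add: gmap_def ghom_def)

lemma gmap_add: "x \<in> carrier (C i) \<Longrightarrow> y \<in> carrier (C i) \<Longrightarrow> g i (x \<oplus>\<^bsub>C i\<^esub> y) \<simeq> g i x + g i y"
  and gmap_lact: "x \<in> carrier (C i) \<Longrightarrow> a \<in> carrier A \<Longrightarrow> g i (a \<odot>\<^bsub>C i\<^esub> x) \<simeq> lact a (g i x)"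
  and gmap_ract: "x \<in> carrier (C i) \<Longrightarrow> a \<in> carrier A \<Longrightarrow> g i (x \<star>\<^bsub>C i\<^esub> a) \<simeq> ract a (g i x)"
  using g gmap_pos by (simp_all add: gmap_def ghom_iff)

lemma insw_vec: "w \<in> W n m \<Longrightarrow> insw g r w \<in> vec (n + s - 1) (m + 1)"
proof (induction g\<equiv>g r w arbitrary: n m rule: insw.induct)
  case (2 i x w)
  then have x: "x \<in> carrier (C i)" "n \<ge> 1" "frag_of w \<in> vec (n - 1) (m - i)" by (simp_all add: W_Cons)
  show ?case unfolding insw.simps by (rule vec_cat'[OF gmap_vec[OF x(1)] x(3)]) (use x(2) in auto)
next
  case (3 r i x w)
  have x: "x \<in> carrier (C i)" "n \<ge> 1" "w \<in> W (n - 1) (m - i)" using "3.prems" by (simp_all add: W_Cons)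
  show ?case
  proof (cases "w = []")
    case False
    then have "n \<ge> 2" using x(3) by (cases "n - 1") (auto simp: tensor_words_iff)
    then show ?thesis unfolding insw.simps
      by (intro vec_sgn_pow vec_cat'[OF letter_vec[OF x(1)] "3.hyps"[OF x(3)]]) auto
  qed (simp add: sgn_pow_simps)
qed simp

lemma ins_vec: "y \<in> vec n m \<Longrightarrow> n' = n + s - 1 \<Longrightarrow> m' = m + 1 \<Longrightarrow> ins g r y \<in> vec n' m'"
  unfolding ins_def using insw_vec by (simp add: vec_extend)

lemma insw_lact:
  assumes "w \<in> W n m" and a: "a \<in> carrier A"
  shows "insw g r (lact_word C a w) \<simeq> lact a (insw g r w)"
proof (cases "(g, r, w)" rule: insw.cases)
  case (2 h i x w')
  then have x: "x \<in> carrier (C i)" "w' \<in> W (n - 1) (m - i)" using assms by (simp_all add: W_Cons)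
  then show ?thesis using 2 cong_cat_right[OF _ gmap_lact[OF x(1) a], of "frag_of w'"] lact_cat[OF gmap_vec[OF x(1)] gmap_pos]
    by simp
next
  case (3 h r' i x w')
  then have x: "x \<in> carrier (C i)" using assms by (simp add: W_Cons)
  then show ?thesis using 3 by (simp add: lact_sgn_pow lact_cat[OF letter_vec[OF x]])
qed auto

lemma insw_ract:
  assumes "w \<in> W n m" and a: "a \<in> carrier A"
  shows "insw g r (ract_word C w a) \<simeq> ract a (insw g r w)"
  using assms(1)
proof (induction g\<equiv>g r w arbitrary: n m rule: insw.induct)
  case (2 i x w)
  then have x: "x \<in> carrier (C i)" "w \<in> W (n - 1) (m - i)" by (simp_all add: W_Cons)
  show ?case
  proof (cases w)
    case Nil
    then show ?thesis using gmap_ract[OF x(1) a] by simp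
  next
    case (Cons p w')
    then have "n - 1 \<ge> 1" using x(2) by (cases "n - 1") (auto simp: tensor_words_iff)
    then show ?thesis using Cons x(2) ract_cat[of "frag_of w" "n - 1" "m - i"] by simp
  qed
next
  case (3 r i x w)
  then have x: "x \<in> carrier (C i)" "w \<in> W (n - 1) (m - i)" by (simp_all add: W_Cons)
  show ?case
  proof (cases w)
    case Nil
    then show ?thesis by (simp add: sgn_pow_simps)
  next
    case (Cons p w')
    then have n: "n - 1 \<ge> 1" using x(2) by (cases "n - 1") (auto simp: tensor_words_iff)
    have "insw g (Suc r) (ract_word C ((i, x) # w) a) = sgn_pow i (letter i x \<diamondop> insw g r (ract_word C w a))"
      using Cons by simp
    also have "\<dots> \<simeq> sgn_pow i (letter i x \<diamondop> ract a (insw g r w))"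
      using "3.hyps"[OF x(2)] by (intro cong_sgn_pow cong_cat_left[OF letter_vec[OF x(1)]])
    also have "\<dots> = ract a (insw g (Suc r) ((i, x) # w))"
      using ract_cat[OF insw_vec[OF x(2)], of _ "letter i x"] n gmap_pos by (simp add: ract_sgn_pow)
    finally show ?thesis .
  qed
qed auto

lemma insw_add:
  assumes "word_of_C u" "word_of_C v" "x \<in> carrier (C i)" "y \<in> carrier (C i)"
  shows "insw g r (u @ (i, x \<oplus>\<^bsub>C i\<^esub> y) # v) \<simeq> insw g r (u @ (i, x) # v) + insw g r (u @ (i, y) # v)"
  using assms(1)
proof (induction u arbitrary: r)
  case Nil
  show ?case
  proof (cases r)
    case 0
    then show ?thesis using cong_cat_right[OF _ gmap_add[OF assms(3,4)], of "frag_of v"] assms(2) by (simp add: cat_add)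
  next
    case (Suc r')
    have "letter i (x \<oplus>\<^bsub>C i\<^esub> y) \<diamondop> insw g r' v \<simeq> (letter i x + letter i y) \<diamondop> insw g r' v"
      by (rule cong_cat_right[OF insw_vec[OF assms(2)] letter_add[OF assms(3,4)]])
    from cong_sgn_pow[OF this, of i] Suc show ?thesis by (simp add: cat_add sgn_pow_simps)
  qed
next
  case (Cons p u)
  obtain j z where p: "p = (j, z)" by (cases p)
  have z: "z \<in> carrier (C j)" and u: "word_of_C u" using Cons.prems p by (auto simp: tensor_words_iff)
  have w: "u @ (i, x) # v \<in> W (length (u @ (i, x) # v)) (word_deg (u @ (i, x) # v))"
    "u @ (i, y) # v \<in> W (length (u @ (i, x) # v)) (word_deg (u @ (i, x) # v))"
    using assms u by (auto simp: tensor_words_iff)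
  show ?case
  proof (cases r)
    case 0
    have "frag_of (u @ (i, x \<oplus>\<^bsub>C i\<^esub> y) # v) \<simeq> frag_of (u @ (i, x) # v) + frag_of (u @ (i, y) # v)"
      using rel_add_core[OF u assms(2-4)] by (simp add: cong_def cat_diff_left cat_diff_right cat_add diff_diff_eq)
    from cong_cat_left[OF gmap_vec[OF z] this] 0 p show ?thesis by (simp add: cat_add)
  next
    case (Suc r')
    from cong_sgn_pow[OF cong_cat_left[OF letter_vec[OF z] Cons.IH[OF u, of r']], of j] Suc p
    show ?thesis by (simp add: cat_add sgn_pow_simps)
  qed
qed

text \<open>If \<open>g\<close> replaces the left one of the two letters that are balanced, this is its right linearity; if it replaces the right one, its
  left linearity.\<close>

lemma insw_balanced:
  assumes "word_of_C u" "word_of_C v" "x \<in> carrier (C i)" "y \<in> carrier (C j)" and a: "a \<in> carrier A"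
  shows "insw g r (u @ (i, x \<star>\<^bsub>C i\<^esub> a) # (j, y) # v) \<simeq> insw g r (u @ (i, x) # (j, a \<odot>\<^bsub>C j\<^esub> y) # v)"
  using assms(1)
proof (induction u arbitrary: r)
  case Nil
  have v: "(j, y) # v \<in> W (Suc (length v)) (j + word_deg v)" using assms(2,4) by (simp add: tensor_words_iff)
  show ?case
  proof (cases r)
    case 0
    have "g i (x \<star>\<^bsub>C i\<^esub> a) \<diamondop> frag_of ((j, y) # v) \<simeq> ract a (g i x) \<diamondop> frag_of ((j, y) # v)"
      using v by (intro cong_cat_right[OF _ gmap_ract[OF assms(3) a], of _ "Suc (length v)" "j + word_deg v"]) simp
    also have "\<dots> \<simeq> g i x \<diamondop> lact a (frag_of ((j, y) # v))"
      using v gmap_pos by (intro balanced[OF gmap_vec[OF assms(3)] _ _ _ a, of _ "Suc (length v)" "j + word_deg v"]) auto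
    finally show ?thesis using 0 by simp
  next
    case (Suc r')
    have "letter i (x \<star>\<^bsub>C i\<^esub> a) \<diamondop> insw g r' ((j, y) # v) = ract a (letter i x) \<diamondop> insw g r' ((j, y) # v)" by simp
    also have "\<dots> \<simeq> letter i x \<diamondop> lact a (insw g r' ((j, y) # v))"
      using gmap_pos by (intro balanced[OF letter_vec[OF assms(3)] _ insw_vec[OF v] _ a]) auto
    also have "\<dots> \<simeq> letter i x \<diamondop> insw g r' (lact_word C a ((j, y) # v))"
      by (rule cong_sym, rule cong_cat_left[OF letter_vec[OF assms(3)]], rule insw_lact[OF v a])
    finally show ?thesis using Suc by (simp add: cong_sgn_pow)
  qed
next
  case (Cons p u)
  obtain k z where p: "p = (k, z)" by (cases p)
  have z: "z \<in> carrier (C k)" and u: "word_of_C u" using Cons.prems p by (auto simp: tensor_words_iff)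
  show ?case
  proof (cases r)
    case 0
    have "frag_of (u @ (i, x \<star>\<^bsub>C i\<^esub> a) # (j, y) # v) \<simeq> frag_of (u @ (i, x) # (j, a \<odot>\<^bsub>C j\<^esub> y) # v)"
      using rel_balance_core[OF u assms(2-4) a] by (simp add: cong_def cat_diff_left cat_diff_right)
    from cong_cat_left[OF gmap_vec[OF z] this] 0 p show ?thesis by simp
  next
    case (Suc r')
    from cong_sgn_pow[OF cong_cat_left[OF letter_vec[OF z] Cons.IH[OF u, of r']], of k] Suc p
    show ?thesis by simp
  qed
qed

lemma ins_rel: "z \<in> rel \<Longrightarrow> ins g r z \<in> rel"
  unfolding ins_def by (erule rel_extend) (simp_all only: insw_add insw_balanced)

lemma der_sum_ins: "y \<in> vec n m \<Longrightarrow> der g y = (\<Sum>r<n. ins g r y)"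
proof (induction y rule: vec_induct)
  case (one w)
  then have "length w = n" by (simp add: tensor_words_iff)
  then show ?case by (simp add: der_def ins_simps)
qed (simp_all add: der_simps ins_simps sum_subtractf)

lemma der_vec: "y \<in> vec n m \<Longrightarrow> n' = n + s - 1 \<Longrightarrow> m' = m + 1 \<Longrightarrow> der g y \<in> vec n' m'"
  by (auto simp: der_sum_ins intro!: vec_sum ins_vec)

lemma der_rel: "z \<in> rel \<Longrightarrow> der g z \<in> rel"
  unfolding der_def
proof (erule rel_extend)
  fix u v i x y assume *: "word_of_C u" "word_of_C v" "x \<in> carrier (C i)" "y \<in> carrier (C i)"
  let ?L = "{..<length (u @ (i, x) # v)}"
  have "(\<Sum>r\<in>?L. insw g r (u @ (i, x \<oplus>\<^bsub>C i\<^esub> y) # v)) \<simeq> (\<Sum>r\<in>?L. insw g r (u @ (i, x) # v) + insw g r (u @ (i, y) # v))"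
    by (rule cong_sum, rule insw_add[OF *])
  then show "(\<Sum>r<length (u @ (i, x \<oplus>\<^bsub>C i\<^esub> y) # v). insw g r (u @ (i, x \<oplus>\<^bsub>C i\<^esub> y) # v)) \<simeq>
     (\<Sum>r<length (u @ (i, x) # v). insw g r (u @ (i, x) # v)) + (\<Sum>r<length (u @ (i, y) # v). insw g r (u @ (i, y) # v))"
    by (simp add: sum.distrib del: sum.lessThan_Suc)
next
  fix u v i x j y a assume *: "word_of_C u" "word_of_C v" "x \<in> carrier (C i)" "y \<in> carrier (C j)" "a \<in> carrier A"
  let ?L = "{..<length (u @ (i, x) # (j, y) # v)}"
  have "(\<Sum>r\<in>?L. insw g r (u @ (i, x \<star>\<^bsub>C i\<^esub> a) # (j, y) # v)) \<simeq> (\<Sum>r\<in>?L. insw g r (u @ (i, x) # (j, a \<odot>\<^bsub>C j\<^esub> y) # v))"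
    by (rule cong_sum, rule insw_balanced[OF *])
  then show "(\<Sum>r<length (u @ (i, x \<star>\<^bsub>C i\<^esub> a) # (j, y) # v). insw g r (u @ (i, x \<star>\<^bsub>C i\<^esub> a) # (j, y) # v)) \<simeq>
     (\<Sum>r<length (u @ (i, x) # (j, a \<odot>\<^bsub>C j\<^esub> y) # v). insw g r (u @ (i, x) # (j, a \<odot>\<^bsub>C j\<^esub> y) # v))"
    by (simp del: sum.lessThan_Suc)
qed

lemma cong_der: "x \<simeq> y \<Longrightarrow> der g x \<simeq> der g y"
  using der_rel[of "x - y"] by (simp add: cong_def der_simps)

lemma der_lact: "y \<in> vec n m \<Longrightarrow> a \<in> carrier A \<Longrightarrow> der g (lact a y) \<simeq> lact a (der g y)"
proof (induction y rule: vec_induct)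
  case (one w)
  have "lact a (\<Sum>r<n. insw g r w) = (\<Sum>r<n. lact a (insw g r w))" by (simp add: lact_sum)
  then show ?case
    using one insw_lact[of w n m a] der_sum_ins[of "frag_of w" n m] der_sum_ins[of "frag_of (lact_word C a w)" n m]
      lact_words[OF bimodules one(2,1)]
    by (auto simp: ins_simps intro: cong_sum)
qed (auto simp: der_simps lact_diff intro: cong_diff)

lemma der_ract: "y \<in> vec n m \<Longrightarrow> a \<in> carrier A \<Longrightarrow> der g (ract a y) \<simeq> ract a (der g y)"
proof (induction y rule: vec_induct)
  case (one w)
  have "ract a (\<Sum>r<n. insw g r w) = (\<Sum>r<n. ract a (insw g r w))" by (simp add: ract_sum)
  then show ?case
    using one insw_ract[of w n m a] der_sum_ins[of "frag_of w" n m] der_sum_ins[of "frag_of (ract_word C w a)" n m]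
      ract_words[OF bimodules one(2,1)]
    by (auto simp: ins_simps intro: cong_sum)
qed (auto simp: der_simps ract_diff intro: cong_diff)

end

text \<open>The Leibniz rule. The sign comes from moving the odd map past a factor of degree \<open>m\<close>.\<close>

lemma der_cat: 
  assumes "y \<in> vec n m"
  shows "der g (y \<diamondop> z) = der g y \<diamondop> z + sgn_pow m (y \<diamondop> der g z)"
  using assms
proof (induction y rule: vec_induct)
  case (one w)
  then show ?case
  proof (induction w arbitrary: n m)
    case Nil
    then show ?case by (simp add: W_Nil der_simps sgn_pow_simps)
  next
    case (Cons p w)
    obtain i x where p: "p = (i, x)" by (cases p)
    have w: "w \<in> W (n - 1) (m - i)" using Cons.prems by (simp add: p W_Cons)
    have "der g (frag_of (p # w) \<diamondop> z) = der g (letter i x \<diamondop> (frag_of w \<diamondop> z))"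
      by (simp add: p cat_assoc[symmetric])
    also have "\<dots> = g i x \<diamondop> frag_of w \<diamondop> z + sgn_pow i (letter i x \<diamondop> (der g (frag_of w) \<diamondop> z + sgn_pow (m - i) (frag_of w \<diamondop> der g z)))"
      unfolding der_letter_cat Cons.IH[OF w] by (simp add: cat_assoc)
    also have "\<dots> = der g (letter i x \<diamondop> frag_of w) \<diamondop> z + sgn_pow m (letter i x \<diamondop> frag_of w \<diamondop> der g z)"
      unfolding der_letter_cat by (simp only: cat_add sgn_pow_cat sgn_pow_simps sgn_pow_comp cat_assoc) (simp add: algebra_simps)
    finally show ?case by (simp add: p)
  qed
qed (simp_all add: cat_diff_left der_simps sgn_pow_simps)

end

subsection \<open>Squares of coderivations\<close>

lemma sum_antisymmetric:
  fixes F :: "nat \<Rightarrow> nat \<Rightarrow> 'g :: ab_group_add"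
  shows "(\<Sum>a=1..M. F a (M + 1 - a)) = (\<Sum>a=1..M. F (M + 1 - a) a)"
  by (rule sum.reindex_bij_witness[of _ "\<lambda>a. M + 1 - a" "\<lambda>a. M + 1 - a"]) auto

text \<open>Both sides run over the triples of numbers at least 2 with sum \<open>N + 2\<close>.\<close>

lemma sum_triples:
  fixes F :: "nat \<Rightarrow> nat \<Rightarrow> nat \<Rightarrow> 'g :: ab_group_add"
  shows "(\<Sum>s=2..N-1. \<Sum>a=2..s-1. F a (s + 1 - a) (N + 1 - s)) = (\<Sum>s=2..N-1. \<Sum>b=2..N-s. F s b (N + 2 - s - b))"
  unfolding sum.Sigma[OF finite_atLeastAtMost ballI[OF finite_atLeastAtMost]]
  by (rule sum.reindex_bij_witness[of _ "\<lambda>(s, b). (s + b - 1, s)" "\<lambda>(s, a). (a, s + 1 - a)"]) auto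

context bimodule_family
begin

text \<open>Expanding both derivations on a product \<open>x \<otimes> w\<close> leaves, besides the squares on \<open>x\<close> and on \<open>w\<close>, the mixed terms in
  which one map hits \<open>x\<close> and the other one \<open>w\<close>. They occur with both orders of the maps, and the maps being odd, with
  opposite signs.\<close>

lemma square_vanishes:
  assumes G: "\<And>a. 1 \<le> a \<Longrightarrow> a \<le> M \<Longrightarrow> gmap a (G a)"
    and sq: "\<And>i x. x \<in> carrier (C i) \<Longrightarrow> (\<Sum>a=1..M. der (G a) (G (M + 1 - a) i x)) \<simeq> 0"
    and y: "y \<in> vec n m"
  shows "(\<Sum>a=1..M. der (G a) (der (G (M + 1 - a)) y)) \<simeq> 0"
  using y
proof (induction y rule: vec_induct)
  case (one w)
  then show ?case
  proof (induction w arbitrary: n m)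
    case (Cons p w)
    obtain i x where p: "p = (i, x)" by (cases p)
    have x: "x \<in> carrier (C i)" and w: "w \<in> W (n - 1) (m - i)" using Cons.prems by (simp_all add: p W_Cons)
    have pw: "frag_of (p # w) = letter i x \<diamondop> frag_of w" by (simp add: p)
    let ?w = "frag_of w"
    have G': "G (M + 1 - a) i x \<in> vec (M + 1 - a) (i + 1)" if "a \<in> {1..M}" for a
      using that by (intro gmap_vec[OF G x]) auto
    have "(\<Sum>a=1..M. der (G a) (der (G (M + 1 - a)) (frag_of (p # w)))) =
      (\<Sum>a=1..M. (der (G a) (G (M + 1 - a) i x) \<diamondop> ?w + letter i x \<diamondop> der (G a) (der (G (M + 1 - a)) ?w)) +
        (sgn_pow i (G a i x \<diamondop> der (G (M + 1 - a)) ?w) - sgn_pow i (G (M + 1 - a) i x \<diamondop> der (G a) ?w)))"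
    proof (rule sum.cong[OF refl])
      fix a assume a: "a \<in> {1..M}"
      show "der (G a) (der (G (M + 1 - a)) (frag_of (p # w))) =
        (der (G a) (G (M + 1 - a) i x) \<diamondop> ?w + letter i x \<diamondop> der (G a) (der (G (M + 1 - a)) ?w)) +
        (sgn_pow i (G a i x \<diamondop> der (G (M + 1 - a)) ?w) - sgn_pow i (G (M + 1 - a) i x \<diamondop> der (G a) ?w))"
        unfolding pw der_letter_cat der_simps der_cat[OF G'[OF a]]
        by (simp add: sgn_pow_simps sgn_pow_comp) (simp add: sgn_pow_def)
    qed
    also have "\<dots> = (\<Sum>a=1..M. der (G a) (G (M + 1 - a) i x)) \<diamondop> ?w
        + letter i x \<diamondop> (\<Sum>a=1..M. der (G a) (der (G (M + 1 - a)) ?w))"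
      unfolding sum.distrib sum_subtractf
        sum_antisymmetric[of "\<lambda>a b. sgn_pow i (G a i x \<diamondop> der (G b) ?w)" M]
      by (simp add: cat_sum)
    also have "\<dots> \<simeq> 0 \<diamondop> ?w + letter i x \<diamondop> 0"
      using w by (intro cong_add cong_cat_right[OF _ sq[OF x], of _ "n - 1" "m - i"] cong_cat_left[OF letter_vec[OF x] Cons.IH[OF w]]) simp
    finally show ?case by simp
  qed (simp add: der_simps)
next
  case (diff a b)
  from cong_diff[OF diff.IH] show ?case by (simp add: der_simps sum_subtractf)
qed (simp add: der_simps)

text \<open>Move the differential past the outer map and then past the inner map, each time by a relation of lower index. Each of the two moves
  leaves a triple composition behind, in one or the other bracketing, and these cancel.\<close>

lemma obstruction_closed:
  assumes N: "N \<ge> 2" and G: "\<And>a. 1 \<le> a \<Longrightarrow> a < N \<Longrightarrow> gmap a (G a)"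
    and sq: "\<And>M i x. 1 \<le> M \<Longrightarrow> M < N \<Longrightarrow> x \<in> carrier (C i) \<Longrightarrow> (\<Sum>a=1..M. der (G a) (G (M + 1 - a) i x)) \<simeq> 0"
    and y: "y \<in> vec n m"
  shows "der (G 1) (\<Sum>s=2..N-1. der (G s) (der (G (N + 1 - s)) y)) \<simeq> (\<Sum>s=2..N-1. der (G s) (der (G (N + 1 - s)) (der (G 1) y)))"
proof -
  let ?D = "\<lambda>s. der (G s)"
  have sq': "?D 1 (?D s z) \<simeq> - ?D s (?D 1 z) - (\<Sum>a=2..s-1. ?D a (?D (s + 1 - a) z))"
    if s: "2 \<le> s" "s < N" and z: "z \<in> vec n' m'" for s z n' m'
  proof -
    have "{1..s} = insert 1 (insert s {2..s-1})" using s by auto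
    then have "(\<Sum>a=1..s. ?D a (?D (s + 1 - a) z)) = ?D 1 (?D s z) + (?D s (?D 1 z) + (\<Sum>a=2..s-1. ?D a (?D (s + 1 - a) z)))"
      using s by (simp add: sum.insert_if)
    moreover have "(\<Sum>a=1..s. ?D a (?D (s + 1 - a) z)) \<simeq> 0"
      by (rule square_vanishes[OF G sq z]) (use s in auto)
    ultimately show ?thesis by (simp add: cong_def algebra_simps)
  qed
  have E1: "?D 1 (\<Sum>s=2..N-1. ?D s (?D (N + 1 - s) y)) = (\<Sum>s=2..N-1. ?D 1 (?D s (?D (N + 1 - s) y)))"
    by (rule der_sum)
  have E2: "(\<Sum>s=2..N-1. ?D 1 (?D s (?D (N + 1 - s) y))) \<simeq> (\<Sum>s=2..N-1. - ?D s (- ?D (N + 1 - s) (?D 1 y) - (\<Sum>b=2..N-s. ?D b (?D (N + 2 - s - b) y)))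
      - (\<Sum>a=2..s-1. ?D a (?D (s + 1 - a) (?D (N + 1 - s) y))))"
  proof (rule cong_sum)
    fix s assume s: "s \<in> {2..N-1}"
    have "?D (N + 1 - s) y \<in> vec (n + (N + 1 - s) - 1) (m + 1)"
      by (rule der_vec[OF G y]) (use s in auto)
    then have "?D 1 (?D s (?D (N + 1 - s) y)) \<simeq> - ?D s (?D 1 (?D (N + 1 - s) y)) - (\<Sum>a=2..s-1. ?D a (?D (s + 1 - a) (?D (N + 1 - s) y)))"
      using s by (intro sq') auto
    moreover have "?D 1 (?D (N + 1 - s) y) \<simeq> - ?D (N + 1 - s) (?D 1 y) - (\<Sum>b=2..N-s. ?D b (?D (N + 2 - s - b) y))"
    proof -
      have "N + 1 - s - 1 = N - s" "N + 1 - s + 1 - b = N + 2 - s - b" "2 \<le> N + 1 - s" "N + 1 - s < N" for b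
        using s by auto
      then show ?thesis using sq'[of "N + 1 - s", OF _ _ y] by simp
    qed
    then have "?D s (?D 1 (?D (N + 1 - s) y)) \<simeq> ?D s (- ?D (N + 1 - s) (?D 1 y) - (\<Sum>b=2..N-s. ?D b (?D (N + 2 - s - b) y)))"
      using s by (intro cong_der[OF G]) auto
    ultimately show "?D 1 (?D s (?D (N + 1 - s) y)) \<simeq> - ?D s (- ?D (N + 1 - s) (?D 1 y) - (\<Sum>b=2..N-s. ?D b (?D (N + 2 - s - b) y)))
      - (\<Sum>a=2..s-1. ?D a (?D (s + 1 - a) (?D (N + 1 - s) y)))"
      by (blast intro: cong_trans cong_diff cong_minus cong_refl)
  qed
  have "(\<Sum>s=2..N-1. - ?D s (- ?D (N + 1 - s) (?D 1 y) - (\<Sum>b=2..N-s. ?D b (?D (N + 2 - s - b) y)))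
      - (\<Sum>a=2..s-1. ?D a (?D (s + 1 - a) (?D (N + 1 - s) y)))) =
    (\<Sum>s=2..N-1. ?D s (?D (N + 1 - s) (?D 1 y)) +
      ((\<Sum>b=2..N-s. ?D s (?D b (?D (N + 2 - s - b) y))) -
       (\<Sum>a=2..s-1. ?D a (?D (s + 1 - a) (?D (N + 1 - s) y)))))"
  proof (rule sum.cong[OF refl])
    have *: "- (- X - Y) - Z = X + (Y - Z)" for X Y Z :: "'p fr" by simp
    show "- ?D s (- ?D (N + 1 - s) (?D 1 y) - (\<Sum>b=2..N-s. ?D b (?D (N + 2 - s - b) y)))
        - (\<Sum>a=2..s-1. ?D a (?D (s + 1 - a) (?D (N + 1 - s) y))) =
      ?D s (?D (N + 1 - s) (?D 1 y)) + ((\<Sum>b=2..N-s. ?D s (?D b (?D (N + 2 - s - b) y))) -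
        (\<Sum>a=2..s-1. ?D a (?D (s + 1 - a) (?D (N + 1 - s) y))))" for s
      unfolding der_simps der_sum by (rule *)
  qed
  also have "\<dots> = (\<Sum>s=2..N-1. ?D s (?D (N + 1 - s) (?D 1 y)))
     + ((\<Sum>s=2..N-1. \<Sum>b=2..N-s. ?D s (?D b (?D (N + 2 - s - b) y))) -
        (\<Sum>s=2..N-1. \<Sum>a=2..s-1. ?D a (?D (s + 1 - a) (?D (N + 1 - s) y))))"
    by (simp only: sum.distrib sum_subtractf)
  also have "\<dots> = (\<Sum>s=2..N-1. ?D s (?D (N + 1 - s) (?D 1 y)))"
    using sum_triples[of "\<lambda>a b c. ?D a (?D b (?D c y))" N] by (simp only: diff_self add_0_right)
  finally show ?thesis using E2 unfolding E1 by (simp only:)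
qed

end

section \<open>Right linear maps out of projective bimodules\<close>

text \<open>A linear map from the algebra to \<open>N\<close> is lifted along \<open>q\<close>. The scalars act on bimodules through the algebra,
  from either side; the right action is used here because right linear maps are wanted in the end.\<close>

locale right_linear_lifting = M: bimodule K A M + N: bimodule K A N
  for K :: "('k, 'y) ring_scheme" and A :: "('k, 'a, 'z) module_scheme"
    and M :: "('a, 'm) bimodule" and N :: "('a, 'n) bimodule" +
  fixes q :: "'m \<Rightarrow> 'n"
  assumes q: "q \<in> bimodule_hom A M N" and q_surj: "q ` carrier M = carrier N"
begin

abbreviation sc :: "'k \<Rightarrow> 'a" where "sc c \<equiv> c \<odot>\<^bsub>A\<^esub> \<one>\<^bsub>A\<^esub>"

text \<open>Graphs of linear lifts of \<open>\<phi>\<close> along \<open>q\<close> that are defined on a subspace of the algebra. By linearity the last clause is enough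
  to make the relation single-valued.\<close>

definition partial_lift :: "('a \<Rightarrow> 'n) \<Rightarrow> ('a \<times> 'm) set \<Rightarrow> bool"
  where "partial_lift \<phi> S \<longleftrightarrow> S \<subseteq> carrier A \<times> carrier M \<and> (\<zero>\<^bsub>A\<^esub>, \<zero>\<^bsub>M\<^esub>) \<in> S \<and>
    (\<forall>(a, m)\<in>S. \<forall>(b, m')\<in>S. (a \<oplus>\<^bsub>A\<^esub> b, m \<oplus>\<^bsub>M\<^esub> m') \<in> S) \<and>
    (\<forall>(a, m)\<in>S. \<forall>c\<in>carrier K. (c \<odot>\<^bsub>A\<^esub> a, m \<star>\<^bsub>M\<^esub> sc c) \<in> S) \<and>
    (\<forall>(a, m)\<in>S. q m = \<phi> a) \<and> (\<forall>m. (\<zero>\<^bsub>A\<^esub>, m) \<in> S \<longrightarrow> m = \<zero>\<^bsub>M\<^esub>)"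

lemma q_simps: "m \<in> carrier M \<Longrightarrow> q m \<in> carrier N"
  "m \<in> carrier M \<Longrightarrow> m' \<in> carrier M \<Longrightarrow> q (m \<oplus>\<^bsub>M\<^esub> m') = q m \<oplus>\<^bsub>N\<^esub> q m'"
  "m \<in> carrier M \<Longrightarrow> a \<in> carrier A \<Longrightarrow> q (m \<star>\<^bsub>M\<^esub> a) = q m \<star>\<^bsub>N\<^esub> a"
  using q by (auto simp: bimodule_hom_def)

lemma sc_closed [simp]: "c \<in> carrier K \<Longrightarrow> sc c \<in> carrier A" by simp

lemma sc_mult: "c \<in> carrier K \<Longrightarrow> d \<in> carrier K \<Longrightarrow> sc (c \<otimes>\<^bsub>K\<^esub> d) = sc c \<otimes>\<^bsub>A\<^esub> sc d"
  by (simp add: M.KA.smult_assoc1 M.smult_mult_left)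

lemma sc_plus: "c \<in> carrier K \<Longrightarrow> d \<in> carrier K \<Longrightarrow> sc (c \<oplus>\<^bsub>K\<^esub> d) = sc c \<oplus>\<^bsub>A\<^esub> sc d"
  by (simp add: M.KA.smult_l_distr)

lemma partial_lift_diff:
  assumes S: "partial_lift \<phi> S" and "(a, m) \<in> S" "(b, m') \<in> S"
  shows "(a \<ominus>\<^bsub>A\<^esub> b, m \<ominus>\<^bsub>M\<^esub> m') \<in> S"
proof -
  have c: "a \<in> carrier A" "m \<in> carrier M" "b \<in> carrier A" "m' \<in> carrier M" using assms by (auto simp: partial_lift_def)
  have "\<ominus>\<^bsub>K\<^esub> \<one>\<^bsub>K\<^esub> \<in> carrier K" by simp
  then have "(\<ominus>\<^bsub>K\<^esub> \<one>\<^bsub>K\<^esub> \<odot>\<^bsub>A\<^esub> b, m' \<star>\<^bsub>M\<^esub> sc (\<ominus>\<^bsub>K\<^esub> \<one>\<^bsub>K\<^esub>)) \<in> S"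
    using assms(1,3) unfolding partial_lift_def by blast
  moreover have "\<ominus>\<^bsub>K\<^esub> \<one>\<^bsub>K\<^esub> \<odot>\<^bsub>A\<^esub> b = \<ominus>\<^bsub>A\<^esub> b" using c by (simp add: M.KA.smult_l_minus)
  moreover have "m' \<star>\<^bsub>M\<^esub> sc (\<ominus>\<^bsub>K\<^esub> \<one>\<^bsub>K\<^esub>) = \<ominus>\<^bsub>M\<^esub> m'"
  proof -
    have z: "m' \<star>\<^bsub>M\<^esub> \<zero>\<^bsub>A\<^esub> = \<zero>\<^bsub>M\<^esub>"
      using M.add_r[of "\<zero>\<^bsub>A\<^esub>" "\<zero>\<^bsub>A\<^esub>" m'] c M.r_closed[of "\<zero>\<^bsub>A\<^esub>" m'] by (simp add: M.M.add.l_cancel_one')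
    have "m' \<star>\<^bsub>M\<^esub> (\<ominus>\<^bsub>A\<^esub> \<one>\<^bsub>A\<^esub>) \<oplus>\<^bsub>M\<^esub> m' = \<zero>\<^bsub>M\<^esub>"
      using M.add_r[of "\<ominus>\<^bsub>A\<^esub> \<one>\<^bsub>A\<^esub>" "\<one>\<^bsub>A\<^esub>" m'] c z by (simp add: M.r_one M.A.l_neg)
    then show ?thesis using c M.r_closed[of "\<ominus>\<^bsub>A\<^esub> \<one>\<^bsub>A\<^esub>" m'] by (simp add: M.KA.smult_l_minus M.M.minus_equality[symmetric])
  qed
  ultimately have "(\<ominus>\<^bsub>A\<^esub> b, \<ominus>\<^bsub>M\<^esub> m') \<in> S" by simp
  then show ?thesis
    using assms(1,2) unfolding partial_lift_def M.A.minus_eq M.M.minus_eq by blast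
qed

text \<open>By Zorn's lemma there is a maximal partial lift. If \<open>a\<close> were outside of its domain, it could be extended by any preimage of
  \<open>\<phi> a\<close>.\<close>

lemma linear_lift:
  assumes \<phi>: "\<And>a. a \<in> carrier A \<Longrightarrow> \<phi> a \<in> carrier N"
    "\<And>a b. a \<in> carrier A \<Longrightarrow> b \<in> carrier A \<Longrightarrow> \<phi> (a \<oplus>\<^bsub>A\<^esub> b) = \<phi> a \<oplus>\<^bsub>N\<^esub> \<phi> b"
    "\<And>c a. c \<in> carrier K \<Longrightarrow> a \<in> carrier A \<Longrightarrow> \<phi> (c \<odot>\<^bsub>A\<^esub> a) = \<phi> a \<star>\<^bsub>N\<^esub> sc c"
  obtains \<psi> where "\<And>a. a \<in> carrier A \<Longrightarrow> \<psi> a \<in> carrier M"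
    "\<And>a b. a \<in> carrier A \<Longrightarrow> b \<in> carrier A \<Longrightarrow> \<psi> (a \<oplus>\<^bsub>A\<^esub> b) = \<psi> a \<oplus>\<^bsub>M\<^esub> \<psi> b"
    "\<And>c a. c \<in> carrier K \<Longrightarrow> a \<in> carrier A \<Longrightarrow> \<psi> (c \<odot>\<^bsub>A\<^esub> a) = \<psi> a \<star>\<^bsub>M\<^esub> sc c"
    "\<And>a. a \<in> carrier A \<Longrightarrow> q (\<psi> a) = \<phi> a"
proof -
  have q0: "q \<zero>\<^bsub>M\<^esub> = \<zero>\<^bsub>N\<^esub>" using q_simps(2)[of "\<zero>\<^bsub>M\<^esub>" "\<zero>\<^bsub>M\<^esub>"] q_simps(1)[of "\<zero>\<^bsub>M\<^esub>"] by simp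
  have \<phi>0: "\<phi> \<zero>\<^bsub>A\<^esub> = \<zero>\<^bsub>N\<^esub>" using \<phi>(2)[of "\<zero>\<^bsub>A\<^esub>" "\<zero>\<^bsub>A\<^esub>"] \<phi>(1)[of "\<zero>\<^bsub>A\<^esub>"] by simp
  have r0: "\<zero>\<^bsub>M\<^esub> \<star>\<^bsub>M\<^esub> a = \<zero>\<^bsub>M\<^esub>" if "a \<in> carrier A" for a
    using M.r_add[of a "\<zero>\<^bsub>M\<^esub>" "\<zero>\<^bsub>M\<^esub>"] that M.r_closed[of a "\<zero>\<^bsub>M\<^esub>"] by simp
  have 0: "partial_lift \<phi> {(\<zero>\<^bsub>A\<^esub>, \<zero>\<^bsub>M\<^esub>)}"
    by (simp add: partial_lift_def q0 \<phi>0 r0)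
  have "\<exists>S\<in>{S. partial_lift \<phi> S}. \<forall>X\<in>{S. partial_lift \<phi> S}. S \<subseteq> X \<longrightarrow> X = S"
  proof (rule subset_Zorn_nonempty)
    fix \<C> assume ne: "\<C> \<noteq> {}" and ch: "subset.chain {S. partial_lift \<phi> S} \<C>"
    then have P: "\<And>S. S \<in> \<C> \<Longrightarrow> partial_lift \<phi> S" and L: "\<And>S S'. S \<in> \<C> \<Longrightarrow> S' \<in> \<C> \<Longrightarrow> S \<subseteq> S' \<or> S' \<subseteq> S"
      by (auto simp: subset_chain_def)
    have U0: "(a \<oplus>\<^bsub>A\<^esub> b, m \<oplus>\<^bsub>M\<^esub> m') \<in> \<Union>\<C>" if ab: "(a, m) \<in> \<Union>\<C>" "(b, m') \<in> \<Union>\<C>" for a m b m'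
    proof -
      obtain S S' where *: "(a, m) \<in> S" "S \<in> \<C>" "(b, m') \<in> S'" "S' \<in> \<C>" using ab by (meson UnionE)
      define S'' where "S'' = (if S \<subseteq> S' then S' else S)"
      have S'': "S'' \<in> \<C>" "(a, m) \<in> S''" "(b, m') \<in> S''" using L[OF *(2,4)] * by (auto simp: S''_def)
      have "(a \<oplus>\<^bsub>A\<^esub> b, m \<oplus>\<^bsub>M\<^esub> m') \<in> S''" using P[OF S''(1)] S''(2,3) unfolding partial_lift_def by blast
      then show ?thesis using S''(1) by (rule UnionI[rotated])
    qed
    obtain S0 where "S0 \<in> \<C>" using ne by blast
    have S0: "(\<zero>\<^bsub>A\<^esub>, \<zero>\<^bsub>M\<^esub>) \<in> S0" using P[OF \<open>S0 \<in> \<C>\<close>] by (simp add: partial_lift_def)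
    have U: "p \<in> carrier A \<times> carrier M" "\<forall>c\<in>carrier K. (c \<odot>\<^bsub>A\<^esub> fst p, snd p \<star>\<^bsub>M\<^esub> sc c) \<in> \<Union>\<C>"
      "q (snd p) = \<phi> (fst p)" "fst p = \<zero>\<^bsub>A\<^esub> \<longrightarrow> snd p = \<zero>\<^bsub>M\<^esub>" if p: "p \<in> \<Union>\<C>" for p
    proof -
      obtain S where S: "p \<in> S" "S \<in> \<C>" using p by (meson UnionE)
      obtain a m where am: "p = (a, m)" by (cases p)
      note PS = P[OF S(2), unfolded partial_lift_def]
      show "p \<in> carrier A \<times> carrier M" using PS S(1) by blast
      have "(c \<odot>\<^bsub>A\<^esub> a, m \<star>\<^bsub>M\<^esub> sc c) \<in> S" if "c \<in> carrier K" for c using PS S(1) that am by blast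
      then show "\<forall>c\<in>carrier K. (c \<odot>\<^bsub>A\<^esub> fst p, snd p \<star>\<^bsub>M\<^esub> sc c) \<in> \<Union>\<C>" using S(2) am by auto
      show "q (snd p) = \<phi> (fst p)" "fst p = \<zero>\<^bsub>A\<^esub> \<longrightarrow> snd p = \<zero>\<^bsub>M\<^esub>" using PS S(1) am by auto
    qed
    show "\<Union>\<C> \<in> {S. partial_lift \<phi> S}"
      unfolding mem_Collect_eq partial_lift_def
    proof (intro conjI subsetI ballI allI impI)
      show "(\<zero>\<^bsub>A\<^esub>, \<zero>\<^bsub>M\<^esub>) \<in> \<Union>\<C>" using \<open>S0 \<in> \<C>\<close> S0 by (rule UnionI)
      show "m = \<zero>\<^bsub>M\<^esub>" if "(\<zero>\<^bsub>A\<^esub>, m) \<in> \<Union>\<C>" for m using U(4)[OF that] by simp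
      fix p assume p: "p \<in> \<Union>\<C>"
      obtain a m where am: "p = (a, m)" by (cases p)
      show "p \<in> carrier A \<times> carrier M" by (rule U(1)[OF p])
      show "case p of (a, m) \<Rightarrow> q m = \<phi> a" "case p of (a, m) \<Rightarrow> \<forall>c\<in>carrier K. (c \<odot>\<^bsub>A\<^esub> a, m \<star>\<^bsub>M\<^esub> sc c) \<in> \<Union>\<C>"
        using U(2,3)[OF p] by (simp_all add: am)
      show "case p of (a, m) \<Rightarrow> \<forall>(b, m')\<in>\<Union>\<C>. (a \<oplus>\<^bsub>A\<^esub> b, m \<oplus>\<^bsub>M\<^esub> m') \<in> \<Union>\<C>"
        unfolding am split_conv
      proof
        fix p' assume p': "p' \<in> \<Union>\<C>"
        obtain b m' where bm: "p' = (b, m')" by (cases p')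
        show "case p' of (b, m') \<Rightarrow> (a \<oplus>\<^bsub>A\<^esub> b, m \<oplus>\<^bsub>M\<^esub> m') \<in> \<Union>\<C>"
          unfolding bm split_conv by (rule U0) (use p p' am bm in simp_all)
      qed
    qed
  qed (use 0 in blast)
  then obtain S where S: "partial_lift \<phi> S" and max: "\<And>X. partial_lift \<phi> X \<Longrightarrow> S \<subseteq> X \<Longrightarrow> X = S" by auto
  note S' = S[unfolded partial_lift_def]
  have uniq: "m = m'" if "(a, m) \<in> S" "(a, m') \<in> S" for a m m'
  proof -
    have c: "a \<in> carrier A" "m \<in> carrier M" "m' \<in> carrier M" using that S' by auto
    have "m \<ominus>\<^bsub>M\<^esub> m' = \<zero>\<^bsub>M\<^esub>" using partial_lift_diff[OF S that] S' c by (simp add: M.A.minus_eq M.A.r_neg)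
    then show ?thesis using c M.M.minus_equality[of m "\<ominus>\<^bsub>M\<^esub> m'"] by (simp add: M.M.minus_eq)
  qed
  have tot: "\<exists>m. (a, m) \<in> S" if a: "a \<in> carrier A" for a
  proof (rule ccontr)
    assume no: "\<nexists>m. (a, m) \<in> S"
    obtain m where m: "m \<in> carrier M" "q m = \<phi> a" using \<phi>(1)[OF a] q_surj by (metis imageE)
    \<comment> \<open>The extension of \<open>S\<close> by the line through \<open>(a, m)\<close>.\<close>
    define X where "X = {(b \<oplus>\<^bsub>A\<^esub> c \<odot>\<^bsub>A\<^esub> a, m' \<oplus>\<^bsub>M\<^esub> m \<star>\<^bsub>M\<^esub> sc c) | b m' c. (b, m') \<in> S \<and> c \<in> carrier K}"
    have mem: "(b \<oplus>\<^bsub>A\<^esub> c \<odot>\<^bsub>A\<^esub> a, m' \<oplus>\<^bsub>M\<^esub> m \<star>\<^bsub>M\<^esub> sc c) \<in> X" if "(b, m') \<in> S" "c \<in> carrier K" for b m' c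
      using that unfolding X_def by blast
    have Sc: "b \<in> carrier A" "m' \<in> carrier M" "q m' = \<phi> b" if "(b, m') \<in> S" for b m' using S' that by auto
    have mc: "m \<star>\<^bsub>M\<^esub> sc c \<in> carrier M" if "c \<in> carrier K" for c using that m M.r_closed by simp
    have sc0: "sc \<zero>\<^bsub>K\<^esub> = \<zero>\<^bsub>A\<^esub>" by (simp add: M.KA.smult_l_null)
    have m0: "m \<star>\<^bsub>M\<^esub> sc \<zero>\<^bsub>K\<^esub> = \<zero>\<^bsub>M\<^esub>"
      unfolding sc0 using M.add_r[of "\<zero>\<^bsub>A\<^esub>" "\<zero>\<^bsub>A\<^esub>" m] m M.r_closed[of "\<zero>\<^bsub>A\<^esub>" m] by simp
    have sub: "S \<subseteq> X"
    proof
      fix p assume "p \<in> S"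
      moreover obtain b m' where "p = (b, m')" by (cases p)
      ultimately show "p \<in> X" using mem[of b m' "\<zero>\<^bsub>K\<^esub>"] Sc[of b m'] a m0 by (simp add: M.KA.smult_l_null)
    qed
    have "partial_lift \<phi> X"
      unfolding partial_lift_def
    proof (intro conjI subsetI ballI allI impI)
      fix p assume pX: "p \<in> X"
      then obtain b n c where p: "p = (b \<oplus>\<^bsub>A\<^esub> c \<odot>\<^bsub>A\<^esub> a, n \<oplus>\<^bsub>M\<^esub> m \<star>\<^bsub>M\<^esub> sc c)" and bn: "(b, n) \<in> S" and c: "c \<in> carrier K"
        unfolding X_def by blast
      note bn' = Sc[OF bn]
      show "p \<in> carrier A \<times> carrier M" "case p of (x, y) \<Rightarrow> q y = \<phi> x"
        using a mc[OF c] bn' m c by (auto simp: p q_simps \<phi>)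
      show "case p of (x, y) \<Rightarrow> \<forall>(x', y')\<in>X. (x \<oplus>\<^bsub>A\<^esub> x', y \<oplus>\<^bsub>M\<^esub> y') \<in> X"
        unfolding p split_conv
      proof
        fix p' assume "p' \<in> X"
        then obtain b' n' c' where p': "p' = (b' \<oplus>\<^bsub>A\<^esub> c' \<odot>\<^bsub>A\<^esub> a, n' \<oplus>\<^bsub>M\<^esub> m \<star>\<^bsub>M\<^esub> sc c')" and bm: "(b', n') \<in> S" and c': "c' \<in> carrier K"
          unfolding X_def by blast
        note bm' = Sc[OF bm]
        have "(b \<oplus>\<^bsub>A\<^esub> b', n \<oplus>\<^bsub>M\<^esub> n') \<in> S" using bn bm S' by blast
        from mem[OF this, of "c \<oplus>\<^bsub>K\<^esub> c'"]
        show "case p' of (x', y') \<Rightarrow> (b \<oplus>\<^bsub>A\<^esub> c \<odot>\<^bsub>A\<^esub> a \<oplus>\<^bsub>A\<^esub> x', n \<oplus>\<^bsub>M\<^esub> m \<star>\<^bsub>M\<^esub> sc c \<oplus>\<^bsub>M\<^esub> y') \<in> X"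
          using a m bn' bm' mc c c'
          by (simp add: p' sc_plus M.add_r M.KA.smult_l_distr M.A.a_ac M.M.a_ac)
      qed
      show "case p of (x, y) \<Rightarrow> \<forall>d\<in>carrier K. (d \<odot>\<^bsub>A\<^esub> x, y \<star>\<^bsub>M\<^esub> sc d) \<in> X"
        unfolding p split_conv
      proof
        fix d assume d: "d \<in> carrier K"
        have "(d \<odot>\<^bsub>A\<^esub> b, n \<star>\<^bsub>M\<^esub> sc d) \<in> S" using bn S' d by blast
        moreover have "m \<star>\<^bsub>M\<^esub> sc (d \<otimes>\<^bsub>K\<^esub> c) = (m \<star>\<^bsub>M\<^esub> sc c) \<star>\<^bsub>M\<^esub> sc d"
          unfolding M.K.m_comm[OF d c] sc_mult[OF c d] using m d c by (simp add: M.r_assoc)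
        ultimately show "(d \<odot>\<^bsub>A\<^esub> (b \<oplus>\<^bsub>A\<^esub> c \<odot>\<^bsub>A\<^esub> a), (n \<oplus>\<^bsub>M\<^esub> m \<star>\<^bsub>M\<^esub> sc c) \<star>\<^bsub>M\<^esub> sc d) \<in> X"
          using mem[of "d \<odot>\<^bsub>A\<^esub> b" "n \<star>\<^bsub>M\<^esub> sc d" "d \<otimes>\<^bsub>K\<^esub> c"] d a bn' mc[OF c] c
          by (simp add: M.KA.smult_r_distr M.KA.smult_assoc1 M.r_add)
      qed
    next
      show "(\<zero>\<^bsub>A\<^esub>, \<zero>\<^bsub>M\<^esub>) \<in> X" by (rule subsetD[OF sub]) (use S' in blast)
    next
      fix y assume "(\<zero>\<^bsub>A\<^esub>, y) \<in> X"
      then obtain b n c where *: "(b, n) \<in> S" "c \<in> carrier K" "\<zero>\<^bsub>A\<^esub> = b \<oplus>\<^bsub>A\<^esub> c \<odot>\<^bsub>A\<^esub> a" "y = n \<oplus>\<^bsub>M\<^esub> m \<star>\<^bsub>M\<^esub> sc c"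
        unfolding X_def by blast
      \<comment> \<open>Otherwise \<open>a\<close> would be a scalar multiple of \<open>b\<close>, which lies in the domain.\<close>
      have "c = \<zero>\<^bsub>K\<^esub>"
      proof (rule ccontr)
        assume "c \<noteq> \<zero>\<^bsub>K\<^esub>"
        then have cu: "c \<in> Units K" using *(2) by (simp add: M.K.field_Units)
        let ?d = "\<ominus>\<^bsub>K\<^esub> (inv\<^bsub>K\<^esub> c)"
        have ic: "inv\<^bsub>K\<^esub> c \<in> carrier K" using cu by (rule M.K.Units_inv_closed)
        have "?d \<odot>\<^bsub>A\<^esub> b = a"
        proof -
          have b: "b = \<ominus>\<^bsub>A\<^esub> (c \<odot>\<^bsub>A\<^esub> a)"
            using *(3) Sc[OF *(1)] *(2) a by (metis M.A.minus_equality M.KA.smult_closed)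
          have "?d \<odot>\<^bsub>A\<^esub> b = inv\<^bsub>K\<^esub> c \<odot>\<^bsub>A\<^esub> (c \<odot>\<^bsub>A\<^esub> a)"
            unfolding b using ic *(2) a by (simp add: M.KA.smult_l_minus M.KA.smult_r_minus)
          also have "\<dots> = a" using ic *(2) a cu by (simp add: M.KA.smult_assoc1[symmetric])
          finally show ?thesis .
        qed
        moreover have "(?d \<odot>\<^bsub>A\<^esub> b, n \<star>\<^bsub>M\<^esub> sc ?d) \<in> S" using *(1) S' ic by blast
        ultimately show False using no by metis
      qed
      then show "y = \<zero>\<^bsub>M\<^esub>" using * Sc[OF *(1)] a m0 S' by (simp add: M.KA.smult_l_null)
    qed
    from max[OF this sub] have "X = S" .
    moreover have "(a, m) \<in> X"
      using mem[of "\<zero>\<^bsub>A\<^esub>" "\<zero>\<^bsub>M\<^esub>" "\<one>\<^bsub>K\<^esub>"] S' a m by (simp add: M.r_one)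
    ultimately show False using no by blast
  qed
  define \<psi> where "\<psi> a = (THE m. (a, m) \<in> S)" for a
  have \<psi>: "(a, \<psi> a) \<in> S" if "a \<in> carrier A" for a
    unfolding \<psi>_def using tot[OF that] uniq by (metis the_equality)
  have \<psi>e: "\<psi> a = m" if "(a, m) \<in> S" for a m
  proof -
    have "a \<in> carrier A" using S' that by blast
    from uniq[OF \<psi>[OF this] that] show ?thesis .
  qed
  show thesis
  proof (rule that[of \<psi>])
    fix a assume a: "a \<in> carrier A"
    show "\<psi> a \<in> carrier M" "q (\<psi> a) = \<phi> a" using \<psi>[OF a] S' by blast+
    fix b assume b: "b \<in> carrier A"
    show "\<psi> (a \<oplus>\<^bsub>A\<^esub> b) = \<psi> a \<oplus>\<^bsub>M\<^esub> \<psi> b" using \<psi>[OF a] \<psi>[OF b] S' by (intro \<psi>e) blast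
  next
    fix c a assume c: "c \<in> carrier K" and a: "a \<in> carrier A"
    show "\<psi> (c \<odot>\<^bsub>A\<^esub> a) = \<psi> a \<star>\<^bsub>M\<^esub> sc c" using \<psi>[OF a] S' c by (intro \<psi>e) blast
  qed
qed

end

context bimodule
begin

text \<open>Extensionality makes equality of maps the equality of their values on the algebra.\<close>

definition linear_maps :: "('a \<Rightarrow> 'm) set"
  where "linear_maps = {\<phi> \<in> extensional (carrier A).
    (\<forall>a\<in>carrier A. \<phi> a \<in> carrier M) \<and>
    (\<forall>a\<in>carrier A. \<forall>b\<in>carrier A. \<phi> (a \<oplus>\<^bsub>A\<^esub> b) = \<phi> a \<oplus>\<^bsub>M\<^esub> \<phi> b) \<and>
    (\<forall>c\<in>carrier K. \<forall>a\<in>carrier A. \<phi> (c \<odot>\<^bsub>A\<^esub> a) = \<phi> a \<star>\<^bsub>M\<^esub> (c \<odot>\<^bsub>A\<^esub> \<one>\<^bsub>A\<^esub>))}"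

text \<open>The coinduced bimodule of linear maps from the algebra to \<open>M\<close>; bimodule maps into it
  are the same thing as right linear maps into \<open>M\<close>, by evaluation at the unit.\<close>

definition coinduced :: "('a, 'a \<Rightarrow> 'm) bimodule"
  where "coinduced = \<lparr>carrier = linear_maps, monoid.mult = undefined, one = undefined,
    ring.zero = (\<lambda>b\<in>carrier A. \<zero>\<^bsub>M\<^esub>), add = (\<lambda>\<phi> \<psi>. \<lambda>b\<in>carrier A. \<phi> b \<oplus>\<^bsub>M\<^esub> \<psi> b),
    smult = (\<lambda>a \<phi>. \<lambda>b\<in>carrier A. \<phi> (b \<otimes>\<^bsub>A\<^esub> a)), rsmult = (\<lambda>\<phi> a. \<lambda>b\<in>carrier A. \<phi> b \<star>\<^bsub>M\<^esub> a)\<rparr>"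

lemma zero_ract: "a \<in> carrier A \<Longrightarrow> \<zero>\<^bsub>M\<^esub> \<star>\<^bsub>M\<^esub> a = \<zero>\<^bsub>M\<^esub>"
  using r_add[of a "\<zero>\<^bsub>M\<^esub>" "\<zero>\<^bsub>M\<^esub>"] r_closed[of a "\<zero>\<^bsub>M\<^esub>"] by simp

lemma minus_ract: "a \<in> carrier A \<Longrightarrow> x \<in> carrier M \<Longrightarrow> (\<ominus>\<^bsub>M\<^esub> x) \<star>\<^bsub>M\<^esub> a = \<ominus>\<^bsub>M\<^esub> (x \<star>\<^bsub>M\<^esub> a)"
  using r_add[of a "\<ominus>\<^bsub>M\<^esub> x" x] r_closed[of a x] r_closed[of a "\<ominus>\<^bsub>M\<^esub> x"] zero_ract
  by (simp add: M.l_neg M.minus_equality)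

text \<open>Needed for the coinduced right action to preserve linearity: scalars are central in the algebra.\<close>

lemma scalar_commutes:
  assumes "c \<in> carrier K" "a \<in> carrier A" "x \<in> carrier M"
  shows "(x \<star>\<^bsub>M\<^esub> a) \<star>\<^bsub>M\<^esub> (c \<odot>\<^bsub>A\<^esub> \<one>\<^bsub>A\<^esub>) = (x \<star>\<^bsub>M\<^esub> (c \<odot>\<^bsub>A\<^esub> \<one>\<^bsub>A\<^esub>)) \<star>\<^bsub>M\<^esub> a"
  using assms by (simp add: r_assoc[symmetric] smult_mult_left smult_mult_right)

lemma linear_mapsD:
  assumes "\<phi> \<in> linear_maps"
  shows "a \<in> carrier A \<Longrightarrow> \<phi> a \<in> carrier M"
    "a \<in> carrier A \<Longrightarrow> b \<in> carrier A \<Longrightarrow> \<phi> (a \<oplus>\<^bsub>A\<^esub> b) = \<phi> a \<oplus>\<^bsub>M\<^esub> \<phi> b"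
    "c \<in> carrier K \<Longrightarrow> a \<in> carrier A \<Longrightarrow> \<phi> (c \<odot>\<^bsub>A\<^esub> a) = \<phi> a \<star>\<^bsub>M\<^esub> (c \<odot>\<^bsub>A\<^esub> \<one>\<^bsub>A\<^esub>)"
    "\<phi> \<in> extensional (carrier A)"
  using assms by (simp_all add: linear_maps_def)

lemma linear_mapsI:
  assumes "\<And>a. a \<in> carrier A \<Longrightarrow> f a \<in> carrier M"
    "\<And>a b. a \<in> carrier A \<Longrightarrow> b \<in> carrier A \<Longrightarrow> f (a \<oplus>\<^bsub>A\<^esub> b) = f a \<oplus>\<^bsub>M\<^esub> f b"
    "\<And>c a. c \<in> carrier K \<Longrightarrow> a \<in> carrier A \<Longrightarrow> f (c \<odot>\<^bsub>A\<^esub> a) = f a \<star>\<^bsub>M\<^esub> (c \<odot>\<^bsub>A\<^esub> \<one>\<^bsub>A\<^esub>)"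
  shows "(\<lambda>b\<in>carrier A. f b) \<in> linear_maps"
  unfolding linear_maps_def using assms by auto

lemma coinduced_simps: "carrier coinduced = linear_maps" "\<zero>\<^bsub>coinduced\<^esub> = (\<lambda>b\<in>carrier A. \<zero>\<^bsub>M\<^esub>)"
  "\<phi> \<oplus>\<^bsub>coinduced\<^esub> \<psi> = (\<lambda>b\<in>carrier A. \<phi> b \<oplus>\<^bsub>M\<^esub> \<psi> b)" "a \<odot>\<^bsub>coinduced\<^esub> \<phi> = (\<lambda>b\<in>carrier A. \<phi> (b \<otimes>\<^bsub>A\<^esub> a))"
  "\<phi> \<star>\<^bsub>coinduced\<^esub> a = (\<lambda>b\<in>carrier A. \<phi> b \<star>\<^bsub>M\<^esub> a)"
  by (simp_all add: coinduced_def)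

lemma linear_maps_eqI: "\<phi> \<in> linear_maps \<Longrightarrow> \<psi> \<in> linear_maps \<Longrightarrow> (\<And>b. b \<in> carrier A \<Longrightarrow> \<phi> b = \<psi> b) \<Longrightarrow> \<phi> = \<psi>"
  by (rule extensionalityI[of _ "carrier A"]) (auto simp: linear_maps_def)

lemma coinduced_closed: 
  shows "\<phi> \<in> linear_maps \<Longrightarrow> \<psi> \<in> linear_maps \<Longrightarrow> (\<lambda>b\<in>carrier A. \<phi> b \<oplus>\<^bsub>M\<^esub> \<psi> b) \<in> linear_maps"
    and "(\<lambda>b\<in>carrier A. \<zero>\<^bsub>M\<^esub>) \<in> linear_maps"
    and "\<phi> \<in> linear_maps \<Longrightarrow> (\<lambda>b\<in>carrier A. \<ominus>\<^bsub>M\<^esub> \<phi> b) \<in> linear_maps"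
    and "a \<in> carrier A \<Longrightarrow> \<phi> \<in> linear_maps \<Longrightarrow> (\<lambda>b\<in>carrier A. \<phi> (b \<otimes>\<^bsub>A\<^esub> a)) \<in> linear_maps"
    and "a \<in> carrier A \<Longrightarrow> \<phi> \<in> linear_maps \<Longrightarrow> (\<lambda>b\<in>carrier A. \<phi> b \<star>\<^bsub>M\<^esub> a) \<in> linear_maps"
proof -
  show "(\<lambda>b\<in>carrier A. \<phi> b \<oplus>\<^bsub>M\<^esub> \<psi> b) \<in> linear_maps" if "\<phi> \<in> linear_maps" "\<psi> \<in> linear_maps"
    by (rule linear_mapsI) (simp_all add: linear_mapsD[OF that(1)] linear_mapsD[OF that(2)] M.a_ac r_add)
  show "(\<lambda>b\<in>carrier A. \<zero>\<^bsub>M\<^esub>) \<in> linear_maps"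
    by (rule linear_mapsI) (simp_all add: zero_ract)
  show "(\<lambda>b\<in>carrier A. \<ominus>\<^bsub>M\<^esub> \<phi> b) \<in> linear_maps" if "\<phi> \<in> linear_maps"
    by (rule linear_mapsI) (simp_all add: linear_mapsD[OF that] M.minus_add minus_ract)
  show "(\<lambda>b\<in>carrier A. \<phi> (b \<otimes>\<^bsub>A\<^esub> a)) \<in> linear_maps" if "a \<in> carrier A" "\<phi> \<in> linear_maps"
    by (rule linear_mapsI) (simp_all add: linear_mapsD[OF that(2)] that(1) A.l_distr smult_mult_left)
  show "(\<lambda>b\<in>carrier A. \<phi> b \<star>\<^bsub>M\<^esub> a) \<in> linear_maps" if "a \<in> carrier A" "\<phi> \<in> linear_maps"
    by (rule linear_mapsI) (simp_all add: linear_mapsD[OF that(2)] that(1) r_closed r_add scalar_commutes)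
qed

lemma bimodule_coinduced: "bimodule K A coinduced"
proof (intro bimodule.intro bimodule_axioms.intro unital_algebra_axioms, goal_cases)
  case 1
  show ?case
  proof (rule abelian_groupI; unfold coinduced_simps)
    fix \<phi> assume \<phi>: "\<phi> \<in> linear_maps"
    show "\<exists>\<psi>\<in>linear_maps. (\<lambda>b\<in>carrier A. \<psi> b \<oplus>\<^bsub>M\<^esub> \<phi> b) = (\<lambda>b\<in>carrier A. \<zero>\<^bsub>M\<^esub>)"
      by (rule bexI[OF _ coinduced_closed(3)[OF \<phi>]]) (auto simp: linear_mapsD[OF \<phi>] M.l_neg intro!: restrict_ext)
    show "(\<lambda>b\<in>carrier A. (\<lambda>b\<in>carrier A. \<zero>\<^bsub>M\<^esub>) b \<oplus>\<^bsub>M\<^esub> \<phi> b) = \<phi>"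
      by (rule linear_maps_eqI[OF coinduced_closed(1)[OF coinduced_closed(2) \<phi>] \<phi>]) (simp add: linear_mapsD[OF \<phi>])
  qed (auto simp: coinduced_closed linear_mapsD M.a_ac intro!: restrict_ext)
next
  case (10 \<phi>)
  then have \<phi>: "\<phi> \<in> linear_maps" by (simp add: coinduced_simps)
  show ?case unfolding coinduced_simps
    by (rule linear_maps_eqI[OF coinduced_closed(4)[OF A.one_closed \<phi>] \<phi>]) (simp add: linear_mapsD[OF \<phi>])
next
  case (11 \<phi>)
  then have \<phi>: "\<phi> \<in> linear_maps" by (simp add: coinduced_simps)
  show ?case unfolding coinduced_simps
    by (rule linear_maps_eqI[OF coinduced_closed(5)[OF A.one_closed \<phi>] \<phi>]) (simp add: linear_mapsD[OF \<phi>] r_one)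
next
  case (13 c \<phi>)
  then have \<phi>: "\<phi> \<in> linear_maps" and c: "c \<in> carrier K" by (simp_all add: coinduced_simps)
  show ?case unfolding coinduced_simps
    by (intro restrict_ext) (simp add: c smult_mult_right linear_mapsD[OF \<phi>])
qed (auto simp: coinduced_simps coinduced_closed linear_mapsD A.r_distr A.m_assoc r_add add_r r_assoc intro!: restrict_ext)

end

text \<open>Over a field, a projective bimodule is projective as a right module: a right linear map into
  \<open>N\<close> corresponds to a bimodule map into the coinduced bimodule of \<open>N\<close>, and coinduction preserves surjections
  because the algebra is a vector space.\<close>

lemma projective_bimodule_right_lift:
  assumes P: "projective_bimodule K A P" and M: "bimodule K A M" and N: "bimodule K A N"
    and q: "q \<in> bimodule_hom A M N" "q ` carrier M = carrier N"
    and f: "\<And>x. x \<in> carrier P \<Longrightarrow> f x \<in> carrier N"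
      "\<And>x y. x \<in> carrier P \<Longrightarrow> y \<in> carrier P \<Longrightarrow> f (x \<oplus>\<^bsub>P\<^esub> y) = f x \<oplus>\<^bsub>N\<^esub> f y"
      "\<And>x a. x \<in> carrier P \<Longrightarrow> a \<in> carrier A \<Longrightarrow> f (x \<star>\<^bsub>P\<^esub> a) = f x \<star>\<^bsub>N\<^esub> a"
  obtains h where "\<And>x. x \<in> carrier P \<Longrightarrow> h x \<in> carrier M"
      "\<And>x y. x \<in> carrier P \<Longrightarrow> y \<in> carrier P \<Longrightarrow> h (x \<oplus>\<^bsub>P\<^esub> y) = h x \<oplus>\<^bsub>M\<^esub> h y"
      "\<And>x a. x \<in> carrier P \<Longrightarrow> a \<in> carrier A \<Longrightarrow> h (x \<star>\<^bsub>P\<^esub> a) = h x \<star>\<^bsub>M\<^esub> a"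
      "\<And>x. x \<in> carrier P \<Longrightarrow> q (h x) = f x"
proof -
  have bP: "bimodule K A P" using P by (simp add: projective_bimodule_def)
  interpret P: bimodule K A P by fact
  interpret R: right_linear_lifting K A M N q
    by (intro right_linear_lifting.intro right_linear_lifting_axioms.intro M N q)
  let ?M = "R.M.coinduced" and ?N = "R.N.coinduced"
  let ?q = "\<lambda>\<phi>. \<lambda>b\<in>carrier A. q (\<phi> b)"
  let ?f = "\<lambda>x. \<lambda>b\<in>carrier A. f (b \<odot>\<^bsub>P\<^esub> x)"
  note cs = R.M.coinduced_simps R.N.coinduced_simps
  have qN: "?q \<phi> \<in> R.N.linear_maps" if "\<phi> \<in> R.M.linear_maps" for \<phi>
    by (rule R.N.linear_mapsI) (simp_all add: R.M.linear_mapsD[OF that] R.q_simps)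
  have "?q \<in> bimodule_hom A ?M ?N"
    unfolding bimodule_hom_def cs
    by (auto simp: qN R.q_simps R.M.linear_mapsD intro!: restrict_ext)
  moreover have "?q ` carrier ?M = carrier ?N"
  proof
    show "carrier ?N \<subseteq> ?q ` carrier ?M"
    proof
      fix \<phi> assume "\<phi> \<in> carrier ?N"
      then have \<phi>: "\<phi> \<in> R.N.linear_maps" by (simp add: cs)
      obtain \<psi> where \<psi>: "\<And>a. a \<in> carrier A \<Longrightarrow> \<psi> a \<in> carrier M"
        "\<And>a b. a \<in> carrier A \<Longrightarrow> b \<in> carrier A \<Longrightarrow> \<psi> (a \<oplus>\<^bsub>A\<^esub> b) = \<psi> a \<oplus>\<^bsub>M\<^esub> \<psi> b"
        "\<And>c a. c \<in> carrier K \<Longrightarrow> a \<in> carrier A \<Longrightarrow> \<psi> (c \<odot>\<^bsub>A\<^esub> a) = \<psi> a \<star>\<^bsub>M\<^esub> (c \<odot>\<^bsub>A\<^esub> \<one>\<^bsub>A\<^esub>)"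
        "\<And>a. a \<in> carrier A \<Longrightarrow> q (\<psi> a) = \<phi> a"
        using R.linear_lift[OF R.N.linear_mapsD(1-3)[OF \<phi>]] by blast
      have r: "restrict \<psi> (carrier A) \<in> R.M.linear_maps" by (rule R.M.linear_mapsI) (simp_all add: \<psi>)
      have "\<phi> = ?q (restrict \<psi> (carrier A))"
        by (rule R.N.linear_maps_eqI[OF \<phi> qN[OF r]]) (simp add: \<psi>)
      then show "\<phi> \<in> ?q ` carrier ?M" unfolding cs using r by (rule image_eqI)
    qed
  qed (auto simp: cs qN)
  moreover have "?f \<in> bimodule_hom A P ?N"
  proof -
    have "?f x \<in> R.N.linear_maps" if x: "x \<in> carrier P" for x
    proof (rule R.N.linear_mapsI)
      fix c a assume c: "c \<in> carrier K" and a: "a \<in> carrier A"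
      have "(c \<odot>\<^bsub>A\<^esub> a) \<odot>\<^bsub>P\<^esub> x = ((c \<odot>\<^bsub>A\<^esub> \<one>\<^bsub>A\<^esub>) \<otimes>\<^bsub>A\<^esub> a) \<odot>\<^bsub>P\<^esub> x"
        using a c by (simp add: P.smult_mult_left)
      also have "\<dots> = (a \<odot>\<^bsub>P\<^esub> x) \<star>\<^bsub>P\<^esub> (c \<odot>\<^bsub>A\<^esub> \<one>\<^bsub>A\<^esub>)"
        using a c x by (simp add: P.l_assoc P.central P.l_closed)
      finally show "f ((c \<odot>\<^bsub>A\<^esub> a) \<odot>\<^bsub>P\<^esub> x) = f (a \<odot>\<^bsub>P\<^esub> x) \<star>\<^bsub>N\<^esub> (c \<odot>\<^bsub>A\<^esub> \<one>\<^bsub>A\<^esub>)"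
        using a c x by (simp add: f P.l_closed)
    qed (simp_all add: x f P.l_closed P.add_l)
    then show ?thesis
      unfolding bimodule_hom_def cs
      by (auto simp: f P.l_closed P.r_closed P.l_add P.l_assoc P.lr_assoc[symmetric] intro!: restrict_ext)
  qed
  ultimately obtain h where h: "h \<in> bimodule_hom A P ?M" and qh: "\<And>x. x \<in> carrier P \<Longrightarrow> ?q (h x) = ?f x"
    using projective_bimodule_lift[OF P R.M.bimodule_coinduced R.N.bimodule_coinduced] by meson
  have hc: "h x \<in> R.M.linear_maps" if "x \<in> carrier P" for x
    using h that by (auto simp: bimodule_hom_def cs)
  show thesis
  proof (rule that[of "\<lambda>x. h x \<one>\<^bsub>A\<^esub>"])
    show "h x \<one>\<^bsub>A\<^esub> \<in> carrier M" if "x \<in> carrier P" for x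
      by (rule R.M.linear_mapsD(1)[OF hc[OF that]]) simp
    show "h (x \<oplus>\<^bsub>P\<^esub> y) \<one>\<^bsub>A\<^esub> = h x \<one>\<^bsub>A\<^esub> \<oplus>\<^bsub>M\<^esub> h y \<one>\<^bsub>A\<^esub>" if "x \<in> carrier P" "y \<in> carrier P" for x y
      using h that by (simp add: bimodule_hom_def cs)
    show "h (x \<star>\<^bsub>P\<^esub> a) \<one>\<^bsub>A\<^esub> = h x \<one>\<^bsub>A\<^esub> \<star>\<^bsub>M\<^esub> a" if "x \<in> carrier P" "a \<in> carrier A" for x a
      using h that by (simp add: bimodule_hom_def cs)
    show "q (h x \<one>\<^bsub>A\<^esub>) = f x" if "x \<in> carrier P" for x
      using fun_cong[OF qh[OF that], of "\<one>\<^bsub>A\<^esub>"] that by (simp add: P.l_one)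
  qed
qed

section \<open>Exactness of the tensor powers of a resolution\<close>

lemma image_bimodule:
  assumes M: "bimodule K A M" and L: "bimodule K A L" and g: "g \<in> bimodule_hom A M L"
  shows "bimodule K A (L\<lparr>carrier := g ` carrier M\<rparr>)"
proof -
  interpret M: bimodule K A M by fact
  interpret L: bimodule K A L by fact
  have gs: "\<And>x. x \<in> carrier M \<Longrightarrow> g x \<in> carrier L"
    "\<And>x y. x \<in> carrier M \<Longrightarrow> y \<in> carrier M \<Longrightarrow> g x \<oplus>\<^bsub>L\<^esub> g y = g (x \<oplus>\<^bsub>M\<^esub> y)"
    "\<And>x a. x \<in> carrier M \<Longrightarrow> a \<in> carrier A \<Longrightarrow> a \<odot>\<^bsub>L\<^esub> g x = g (a \<odot>\<^bsub>M\<^esub> x)"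
    "\<And>x a. x \<in> carrier M \<Longrightarrow> a \<in> carrier A \<Longrightarrow> g x \<star>\<^bsub>L\<^esub> a = g (x \<star>\<^bsub>M\<^esub> a)"
    using g by (auto simp: bimodule_hom_def)
  have g0: "g \<zero>\<^bsub>M\<^esub> = \<zero>\<^bsub>L\<^esub>" using gs(2)[of "\<zero>\<^bsub>M\<^esub>" "\<zero>\<^bsub>M\<^esub>"] gs(1)[of "\<zero>\<^bsub>M\<^esub>"] by simp
  let ?L = "L\<lparr>carrier := g ` carrier M\<rparr>"
  have sub: "x \<in> carrier L" if "x \<in> g ` carrier M" for x using that gs(1) by auto
  show ?thesis
  proof (intro bimodule.intro bimodule_axioms.intro M.unital_algebra_axioms)
    show "abelian_group ?L"
    proof (rule abelian_groupI; simp)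
      show "\<zero>\<^bsub>L\<^esub> \<in> g ` carrier M" using g0 by (metis M.M.zero_closed image_eqI)
      fix x assume x: "x \<in> g ` carrier M"
      then obtain z where z: "z \<in> carrier M" "x = g z" by blast
      have "g (\<ominus>\<^bsub>M\<^esub> z) \<oplus>\<^bsub>L\<^esub> x = \<zero>\<^bsub>L\<^esub>" using z gs(2)[of "\<ominus>\<^bsub>M\<^esub> z" z] g0 by (simp add: M.M.l_neg)
      then show "\<exists>y\<in>carrier M. g y \<oplus>\<^bsub>L\<^esub> x = \<zero>\<^bsub>L\<^esub>" using z by blast
    qed (auto simp: gs sub L.M.a_ac)
  qed (use sub in \<open>auto simp: gs M.l_closed M.r_closed L.l_add L.r_add L.add_l L.add_r L.l_assoc L.r_assoc L.l_one L.r_one L.lr_assoc L.central\<close>)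
qed

text \<open>The lifting properties in the form used for chain complexes: a map out of a projective bimodule
  lifts through \<open>g\<close> as soon as its values lie in the image of \<open>g\<close>.\<close>

lemma projective_lift_through:
  assumes P: "projective_bimodule K A P" and M: "bimodule K A M" and L: "bimodule K A L"
    and g: "g \<in> bimodule_hom A M L" and f: "f \<in> bimodule_hom A P L"
    and im: "\<And>x. x \<in> carrier P \<Longrightarrow> f x \<in> g ` carrier M"
  shows "\<exists>h\<in>bimodule_hom A P M. \<forall>x\<in>carrier P. g (h x) = f x"
  using g f im
  by (intro projective_bimodule_lift[OF P M image_bimodule[OF M L g]]) (auto simp: bimodule_hom_def)

lemma projective_right_lift_through:
  assumes P: "projective_bimodule K A P" and M: "bimodule K A M" and L: "bimodule K A L"
    and g: "g \<in> bimodule_hom A M L"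
    and f: "\<And>x. x \<in> carrier P \<Longrightarrow> f x \<in> g ` carrier M"
      "\<And>x y. x \<in> carrier P \<Longrightarrow> y \<in> carrier P \<Longrightarrow> f (x \<oplus>\<^bsub>P\<^esub> y) = f x \<oplus>\<^bsub>L\<^esub> f y"
      "\<And>x a. x \<in> carrier P \<Longrightarrow> a \<in> carrier A \<Longrightarrow> f (x \<star>\<^bsub>P\<^esub> a) = f x \<star>\<^bsub>L\<^esub> a"
  obtains h where "\<And>x. x \<in> carrier P \<Longrightarrow> h x \<in> carrier M"
      "\<And>x y. x \<in> carrier P \<Longrightarrow> y \<in> carrier P \<Longrightarrow> h (x \<oplus>\<^bsub>P\<^esub> y) = h x \<oplus>\<^bsub>M\<^esub> h y"
      "\<And>x a. x \<in> carrier P \<Longrightarrow> a \<in> carrier A \<Longrightarrow> h (x \<star>\<^bsub>P\<^esub> a) = h x \<star>\<^bsub>M\<^esub> a"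
      "\<And>x. x \<in> carrier P \<Longrightarrow> g (h x) = f x"
proof -
  have g': "g \<in> bimodule_hom A M (L\<lparr>carrier := g ` carrier M\<rparr>)" using g by (auto simp: bimodule_hom_def)
  show thesis
  proof (rule projective_bimodule_right_lift[OF P M image_bimodule[OF M L g] g', where f = f])
    fix h assume "\<And>x. x \<in> carrier P \<Longrightarrow> h x \<in> carrier M"
      "\<And>x y. x \<in> carrier P \<Longrightarrow> y \<in> carrier P \<Longrightarrow> h (x \<oplus>\<^bsub>P\<^esub> y) = h x \<oplus>\<^bsub>M\<^esub> h y"
      "\<And>x a. x \<in> carrier P \<Longrightarrow> a \<in> carrier A \<Longrightarrow> h (x \<star>\<^bsub>P\<^esub> a) = h x \<star>\<^bsub>M\<^esub> a"
      "\<And>x. x \<in> carrier P \<Longrightarrow> g (h x) = f x"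
    then show thesis by (rule that)
  qed (use f in simp_all)
qed

context bimodule
begin

lemma ract_zero_scalar: "x \<in> carrier M \<Longrightarrow> x \<star>\<^bsub>M\<^esub> \<zero>\<^bsub>A\<^esub> = \<zero>\<^bsub>M\<^esub>"
  using add_r[of "\<zero>\<^bsub>A\<^esub>" "\<zero>\<^bsub>A\<^esub>" x] r_closed[of "\<zero>\<^bsub>A\<^esub>" x] by simp

lemma ract_minus_scalar: "x \<in> carrier M \<Longrightarrow> a \<in> carrier A \<Longrightarrow> x \<star>\<^bsub>M\<^esub> (\<ominus>\<^bsub>A\<^esub> a) = \<ominus>\<^bsub>M\<^esub> (x \<star>\<^bsub>M\<^esub> a)"
  using add_r[of "\<ominus>\<^bsub>A\<^esub> a" a x] r_closed[of a x] r_closed[of "\<ominus>\<^bsub>A\<^esub> a" x] ract_zero_scalar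
  by (simp add: A.l_neg M.minus_equality)

lemma ract_diff: "x \<in> carrier M \<Longrightarrow> y \<in> carrier M \<Longrightarrow> a \<in> carrier A \<Longrightarrow>
    (x \<ominus>\<^bsub>M\<^esub> y) \<star>\<^bsub>M\<^esub> a = x \<star>\<^bsub>M\<^esub> a \<ominus>\<^bsub>M\<^esub> y \<star>\<^bsub>M\<^esub> a"
  by (simp add: M.minus_eq r_add minus_ract)

lemma add_diff_add: "x \<in> carrier M \<Longrightarrow> y \<in> carrier M \<Longrightarrow> x' \<in> carrier M \<Longrightarrow> y' \<in> carrier M \<Longrightarrow>
    (x \<oplus>\<^bsub>M\<^esub> y) \<ominus>\<^bsub>M\<^esub> (x' \<oplus>\<^bsub>M\<^esub> y') = (x \<ominus>\<^bsub>M\<^esub> x') \<oplus>\<^bsub>M\<^esub> (y \<ominus>\<^bsub>M\<^esub> y')"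
  by (simp add: M.minus_eq M.minus_add M.a_ac)

end

locale shifted_resolution = bimodule_family K A C
  for K :: "('k, 'y) ring_scheme" and A :: "('k, 'a, 'z) module_scheme"
    and C :: "int \<Rightarrow> ('a, 'p) bimodule" +
  fixes d :: "int \<Rightarrow> 'p \<Rightarrow> 'p" and \<mu> :: "int \<Rightarrow> 'p \<Rightarrow> 'a"
  assumes proj: "projective_bimodule K A (C i)"
    and top: "i > 1 \<Longrightarrow> carrier (C i) = {\<zero>\<^bsub>C i\<^esub>}"
    and d_hom: "d i \<in> bimodule_hom A (C i) (C (i + 1))"
    and \<mu>_hom: "\<mu> 1 \<in> bimodule_hom A (C 1) (regular_bimodule A)"
    and \<mu>_surj: "\<mu> 1 ` carrier (C 1) = carrier A"
    and \<mu>_zero: "i \<noteq> 1 \<Longrightarrow> x \<in> carrier (C i) \<Longrightarrow> \<mu> i x = \<zero>\<^bsub>A\<^esub>"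
    and exact_\<mu>: "{x \<in> carrier (C 1). \<mu> 1 x = \<zero>\<^bsub>A\<^esub>} = d 0 ` carrier (C 0)"
    and exact_d: "i < 1 \<Longrightarrow> {x \<in> carrier (C i). d i x = \<zero>\<^bsub>C (i + 1)\<^esub>} = d (i - 1) ` carrier (C (i - 1))"
begin

lemma d_simps:
  "x \<in> carrier (C i) \<Longrightarrow> d i x \<in> carrier (C (i + 1))"
  "x \<in> carrier (C i) \<Longrightarrow> y \<in> carrier (C i) \<Longrightarrow> d i (x \<oplus>\<^bsub>C i\<^esub> y) = d i x \<oplus>\<^bsub>C (i + 1)\<^esub> d i y"
  "x \<in> carrier (C i) \<Longrightarrow> a \<in> carrier A \<Longrightarrow> d i (a \<odot>\<^bsub>C i\<^esub> x) = a \<odot>\<^bsub>C (i + 1)\<^esub> d i x"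
  "x \<in> carrier (C i) \<Longrightarrow> a \<in> carrier A \<Longrightarrow> d i (x \<star>\<^bsub>C i\<^esub> a) = d i x \<star>\<^bsub>C (i + 1)\<^esub> a"
  using d_hom[of i] by (auto simp: bimodule_hom_def)

lemma d_zero: "d i \<zero>\<^bsub>C i\<^esub> = \<zero>\<^bsub>C (i + 1)\<^esub>"
  using d_simps(2)[of "\<zero>\<^bsub>C i\<^esub>" i "\<zero>\<^bsub>C i\<^esub>"] d_simps(1)[of "\<zero>\<^bsub>C i\<^esub>" i] by simp

lemma d_minus: "x \<in> carrier (C i) \<Longrightarrow> d i (\<ominus>\<^bsub>C i\<^esub> x) = \<ominus>\<^bsub>C (i + 1)\<^esub> d i x"
  using d_simps(2)[of "\<ominus>\<^bsub>C i\<^esub> x" i x] d_simps(1)[of x i] d_simps(1)[of "\<ominus>\<^bsub>C i\<^esub> x" i]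
  by (simp add: C.M.l_neg d_zero C.M.minus_equality)

lemma d_diff: "x \<in> carrier (C i) \<Longrightarrow> y \<in> carrier (C i) \<Longrightarrow> d i (x \<ominus>\<^bsub>C i\<^esub> y) = d i x \<ominus>\<^bsub>C (i + 1)\<^esub> d i y"
  by (simp add: C.M.minus_eq d_simps d_minus)

lemma \<mu>_simps:
  "x \<in> carrier (C i) \<Longrightarrow> \<mu> i x \<in> carrier A"
  "x \<in> carrier (C i) \<Longrightarrow> y \<in> carrier (C i) \<Longrightarrow> \<mu> i (x \<oplus>\<^bsub>C i\<^esub> y) = \<mu> i x \<oplus>\<^bsub>A\<^esub> \<mu> i y"
  "x \<in> carrier (C i) \<Longrightarrow> a \<in> carrier A \<Longrightarrow> \<mu> i (a \<odot>\<^bsub>C i\<^esub> x) = a \<otimes>\<^bsub>A\<^esub> \<mu> i x"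
  "x \<in> carrier (C i) \<Longrightarrow> a \<in> carrier A \<Longrightarrow> \<mu> i (x \<star>\<^bsub>C i\<^esub> a) = \<mu> i x \<otimes>\<^bsub>A\<^esub> a"
  using \<mu>_hom \<mu>_zero by (cases "i = 1"; force simp: bimodule_hom_def regular_bimodule_def C.l_closed C.r_closed)+

lemma in_top: "i > 1 \<Longrightarrow> x \<in> carrier (C i) \<Longrightarrow> x = \<zero>\<^bsub>C i\<^esub>"
  using top by auto

lemma dd_zero: "x \<in> carrier (C i) \<Longrightarrow> d (i + 1) (d i x) = \<zero>\<^bsub>C (i + 2)\<^esub>"
proof (cases "i < 0")
  case True
  assume x: "x \<in> carrier (C i)"
  have e: "i + 1 + 1 = i + 2" "i + 1 - 1 = i" "i + 1 < 1" using True by simp_all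
  have "d i x \<in> {y \<in> carrier (C (i + 1)). d (i + 1) y = \<zero>\<^bsub>C (i + 1 + 1)\<^esub>}"
    unfolding exact_d[OF e(3)] unfolding e(2) using x by (rule imageI)
  then show ?thesis unfolding e(1) by simp
next
  case False
  assume "x \<in> carrier (C i)"
  then show ?thesis using in_top[of "i + 2" "d (i + 1) (d i x)"] False d_simps(1)[OF d_simps(1)] by (auto simp: add.assoc)
qed

lemma \<mu>d_zero: "x \<in> carrier (C i) \<Longrightarrow> \<mu> (i + 1) (d i x) = \<zero>\<^bsub>A\<^esub>"
  using exact_\<mu> \<mu>_zero[of "i + 1" "d i x"] d_simps(1)[of x i] by (cases "i = 0") auto

subsection \<open>A right linear contraction\<close>

text \<open>A fixed element on which the augmentation is 1. Its right multiples split the augmentation right linearly.\<close>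

definition pt :: 'p where "pt = (SOME x. x \<in> carrier (C 1) \<and> \<mu> 1 x = \<one>\<^bsub>A\<^esub>)"

lemma pt: "pt \<in> carrier (C 1)" "\<mu> 1 pt = \<one>\<^bsub>A\<^esub>"
proof -
  have "\<exists>x. x \<in> carrier (C 1) \<and> \<mu> 1 x = \<one>\<^bsub>A\<^esub>" using \<mu>_surj A.one_closed by (metis imageE)
  from someI_ex[OF this] show "pt \<in> carrier (C 1)" "\<mu> 1 pt = \<one>\<^bsub>A\<^esub>" by (simp_all add: pt_def)
qed

definition right_linear :: "int \<Rightarrow> int \<Rightarrow> ('p \<Rightarrow> 'p) \<Rightarrow> bool"
  where "right_linear i j f \<longleftrightarrow> (\<forall>x\<in>carrier (C i). f x \<in> carrier (C j)) \<and>
    (\<forall>x\<in>carrier (C i). \<forall>y\<in>carrier (C i). f (x \<oplus>\<^bsub>C i\<^esub> y) = f x \<oplus>\<^bsub>C j\<^esub> f y) \<and>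
    (\<forall>x\<in>carrier (C i). \<forall>a\<in>carrier A. f (x \<star>\<^bsub>C i\<^esub> a) = f x \<star>\<^bsub>C j\<^esub> a)"

lemma right_linear_zero: 
  assumes "right_linear i j f"
  shows "f \<zero>\<^bsub>C i\<^esub> = \<zero>\<^bsub>C j\<^esub>"
proof -
  have "f \<zero>\<^bsub>C i\<^esub> \<in> carrier (C j)" "f (\<zero>\<^bsub>C i\<^esub> \<oplus>\<^bsub>C i\<^esub> \<zero>\<^bsub>C i\<^esub>) = f \<zero>\<^bsub>C i\<^esub> \<oplus>\<^bsub>C j\<^esub> f \<zero>\<^bsub>C i\<^esub>"
    using assms unfolding right_linear_def by blast+
  then show ?thesis by simp
qed

text \<open>The usual construction of a contracting homotopy of a resolution by projectives, downwards from degree 1. It takes place among right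
  modules, because the augmentation \<open>P \<rightarrow> A\<close> splits right linearly but in general not as a map of bimodules.\<close>

lemma contraction_exists:
  "\<exists>h. (\<forall>i. right_linear i (i - 1) (h i)) \<and>
    (\<forall>i. \<forall>x\<in>carrier (C i). d (i - 1) (h i x) \<oplus>\<^bsub>C i\<^esub> h (i + 1) (d i x) =
      (if i = 1 then x \<ominus>\<^bsub>C 1\<^esub> pt \<star>\<^bsub>C 1\<^esub> \<mu> 1 x else x))"
proof -
  \<comment> \<open>Degrees are counted down: stage \<open>k\<close> concerns \<open>C (1 - k)\<close>. The new map
    \<open>r\<close> has to satisfy \<open>d (r x) = x - prev x\<close>, where \<open>prev\<close> comes from the splitting in degree 1 and from the preceding stage below it.\<close>
  define prev where "prev H k x = (if k = 0 then pt \<star>\<^bsub>C 1\<^esub> \<mu> 1 x else H (k - 1) (d (1 - int k) x))"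
    for H :: "nat \<Rightarrow> 'p \<Rightarrow> 'p" and k x
  define good where "good H k r \<longleftrightarrow> right_linear (1 - int k) (- int k) r \<and>
    (\<forall>x\<in>carrier (C (1 - int k)). d (- int k) (r x) = x \<ominus>\<^bsub>C (1 - int k)\<^esub> prev H k x)"
    for H :: "nat \<Rightarrow> 'p \<Rightarrow> 'p" and k r
  have "\<exists>H. \<forall>k. good H k (H k)"
  proof (rule dependent_wellorder_choice)
    show "good f k r = good g k r" if "\<And>y. y < k \<Longrightarrow> f y = g y" for r f g k
    proof -
      have "prev f k x = prev g k x" for x using that[of "k - 1"] by (simp add: prev_def)
      then show ?thesis by (simp add: good_def)
    qed
    fix k and H :: "nat \<Rightarrow> 'p \<Rightarrow> 'p" assume IH: "\<And>y. y < k \<Longrightarrow> good H y (H y)"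
    let ?i = "1 - int k"
    have prev: "right_linear ?i ?i (prev H k)"
    proof (cases "k = 0")
      case True
      then show ?thesis using pt by (auto simp: right_linear_def prev_def \<mu>_simps C.r_closed C.add_r C.r_assoc)
    next
      case False
      define j where "j = ?i"
      have e: "1 - int (k - 1) = j + 1" "- int (k - 1) = j" using False by (auto simp: j_def)
      have "good H (k - 1) (H (k - 1))" using IH[of "k - 1"] False by simp
      then have "right_linear (j + 1) j (H (k - 1))" unfolding good_def e by blast
      then have "right_linear j j (\<lambda>x. H (k - 1) (d j x))" by (simp add: right_linear_def d_simps)
      then show ?thesis using False by (simp add: right_linear_def prev_def j_def)
    qed
    let ?f = "\<lambda>x. x \<ominus>\<^bsub>C ?i\<^esub> prev H k x"
    note pr = prev[unfolded right_linear_def]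
    have fC: "?f x \<in> carrier (C ?i)" if "x \<in> carrier (C ?i)" for x using pr that by simp
    have im: "?f x \<in> d (- int k) ` carrier (C (- int k))" if x: "x \<in> carrier (C ?i)" for x
    proof (cases "k = 0")
      case True
      have m: "\<mu> 1 (\<ominus>\<^bsub>C 1\<^esub> y) = \<ominus>\<^bsub>A\<^esub> \<mu> 1 y" if "y \<in> carrier (C 1)" for y
      proof -
        have "\<mu> 1 \<zero>\<^bsub>C 1\<^esub> = \<zero>\<^bsub>A\<^esub>" using \<mu>_simps(2)[of "\<zero>\<^bsub>C 1\<^esub>" 1 "\<zero>\<^bsub>C 1\<^esub>"] \<mu>_simps(1)[of "\<zero>\<^bsub>C 1\<^esub>" 1] by simp
        then show ?thesis using \<mu>_simps(2)[of "\<ominus>\<^bsub>C 1\<^esub> y" 1 y] that \<mu>_simps(1)[of y 1] \<mu>_simps(1)[of "\<ominus>\<^bsub>C 1\<^esub> y" 1]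
          by (simp add: C.M.l_neg A.minus_equality)
      qed
      have "\<mu> 1 (?f x) = \<zero>\<^bsub>A\<^esub>"
        using x True pt \<mu>_simps(1)[of x 1] by (simp add: prev_def C.M.minus_eq \<mu>_simps m C.r_closed A.r_neg)
      then show ?thesis using exact_\<mu> fC[OF x] True by auto
    next
      case False
      then have k: "?i < 1" by simp
      have dx: "d ?i x \<in> carrier (C (1 - int (k - 1)))" using d_simps(1)[OF x] False by (simp add: of_nat_diff)
      have "good H (k - 1) (H (k - 1))" using IH[of "k - 1"] False by simp
      then have 1: "d (- int (k - 1)) (H (k - 1) (d ?i x)) = d ?i x \<ominus>\<^bsub>C (1 - int (k - 1))\<^esub> prev H (k - 1) (d ?i x)"
        using dx by (simp add: good_def)
      have 2: "prev H (k - 1) (d ?i x) = \<zero>\<^bsub>C (1 - int (k - 1))\<^esub>"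
      proof (cases "k = 1")
        case True
        then show ?thesis using \<mu>d_zero[OF x] pt by (simp add: prev_def C.ract_zero_scalar)
      next
        case k2: False
        have rl: "right_linear (1 - int (k - 2)) (- int (k - 2)) (H (k - 2))" using IH[of "k - 2"] False by (simp add: good_def)
        have e: "1 - int (k - 1) = ?i + 1" "1 - int (k - 2) = ?i + 2" "- int (k - 2) = ?i + 1" "k - 1 \<noteq> 0"
          using False k2 by auto
        have "prev H (k - 1) (d ?i x) = H (k - 2) (d (?i + 1) (d ?i x))"
          unfolding prev_def e(1) using e(4) by (simp add: numeral_2_eq_2)
        then show ?thesis using right_linear_zero[OF rl] unfolding e dd_zero[OF x] by simp
      qed
      have e: "1 - int (k - 1) = ?i + 1" "- int (k - 1) = ?i" using False by auto
      have Hd: "H (k - 1) (d ?i x) = prev H k x" using False by (simp add: prev_def)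
      have "d ?i (prev H k x) = d ?i x"
        using 1 d_simps(1)[OF x] unfolding 2 unfolding e Hd by (simp add: C.M.minus_eq)
      moreover have "d ?i (?f x) = d ?i x \<ominus>\<^bsub>C (?i + 1)\<^esub> d ?i (prev H k x)"
        by (rule d_diff[OF x]) (use x pr in blast)
      ultimately have "d ?i (?f x) = \<zero>\<^bsub>C (?i + 1)\<^esub>"
        using d_simps(1)[OF x] by (simp add: C.M.minus_eq C.M.r_neg)
      then have "?f x \<in> d (?i - 1) ` carrier (C (?i - 1))" using exact_d[OF k] fC[OF x] by blast
      then show ?thesis by simp
    qed
    have dk: "d (- int k) \<in> bimodule_hom A (C (- int k)) (C ?i)" using d_hom[of "- int k"] by simp
    obtain r where "\<And>x. x \<in> carrier (C ?i) \<Longrightarrow> r x \<in> carrier (C (- int k))"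
      "\<And>x y. x \<in> carrier (C ?i) \<Longrightarrow> y \<in> carrier (C ?i) \<Longrightarrow> r (x \<oplus>\<^bsub>C ?i\<^esub> y) = r x \<oplus>\<^bsub>C (- int k)\<^esub> r y"
      "\<And>x a. x \<in> carrier (C ?i) \<Longrightarrow> a \<in> carrier A \<Longrightarrow> r (x \<star>\<^bsub>C ?i\<^esub> a) = r x \<star>\<^bsub>C (- int k)\<^esub> a"
      "\<And>x. x \<in> carrier (C ?i) \<Longrightarrow> d (- int k) (r x) = ?f x"
    proof (rule projective_right_lift_through[OF proj[of ?i] bimodules bimodules dk, where f = ?f])
      show "?f x \<in> d (- int k) ` carrier (C (- int k))" if "x \<in> carrier (C ?i)" for x by (rule im[OF that])
      show "?f (x \<oplus>\<^bsub>C ?i\<^esub> y) = ?f x \<oplus>\<^bsub>C ?i\<^esub> ?f y" if "x \<in> carrier (C ?i)" "y \<in> carrier (C ?i)" for x y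
        using pr that by (simp add: C.add_diff_add)
      show "?f (x \<star>\<^bsub>C ?i\<^esub> a) = ?f x \<star>\<^bsub>C ?i\<^esub> a" if "x \<in> carrier (C ?i)" "a \<in> carrier A" for x a
        using pr that by (simp add: C.ract_diff)
    qed blast
    then have "good H k r" by (simp add: good_def right_linear_def)
    then show "\<exists>r. good H k r" by blast
  qed
  then obtain H where H: "\<And>k. good H k (H k)" by blast
  define h where "h i x = (if i \<le> 1 then H (nat (1 - i)) x else \<zero>\<^bsub>C (i - 1)\<^esub>)" for i x
  have hrl: "right_linear i (i - 1) (h i)" for i
  proof (cases "i \<le> 1")
    case True
    then show ?thesis using H[of "nat (1 - i)"] by (simp add: good_def h_def right_linear_def)
  next
    case False
    then show ?thesis by (simp add: h_def right_linear_def C.zero_ract)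
  qed
  have "d (i - 1) (h i x) \<oplus>\<^bsub>C i\<^esub> h (i + 1) (d i x) = (if i = 1 then x \<ominus>\<^bsub>C 1\<^esub> pt \<star>\<^bsub>C 1\<^esub> \<mu> 1 x else x)"
    if x: "x \<in> carrier (C i)" for i x
  proof (cases "i \<le> 1")
    case True
    let ?k = "nat (1 - i)"
    have e: "1 - int ?k = i" "- int ?k = i - 1" using True by auto
    have "good H ?k (H ?k)" by (rule H)
    then have *: "d (i - 1) (h i x) = x \<ominus>\<^bsub>C i\<^esub> prev H ?k x"
      using x True unfolding good_def e by (simp add: h_def)
    show ?thesis
    proof (cases "i = 1")
      case True
      then show ?thesis using * x pt by (simp add: prev_def h_def \<mu>_simps C.r_closed)
    next
      case False
      then have k: "?k \<noteq> 0" "nat (1 - (i + 1)) = ?k - 1" using True by auto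
      have "prev H ?k x = h (i + 1) (d i x)" using True False k e by (simp add: prev_def h_def)
      moreover have "h (i + 1) (d i x) \<in> carrier (C i)" using hrl[of "i + 1"] d_simps(1)[OF x] by (simp add: right_linear_def)
      ultimately show ?thesis using * x False by (simp add: C.M.minus_eq C.M.a_assoc C.M.l_neg)
    qed
  next
    case False
    then have xz: "x = \<zero>\<^bsub>C i\<^esub>" using in_top x by simp
    have dz: "d (i - 1) \<zero>\<^bsub>C (i - 1)\<^esub> = \<zero>\<^bsub>C i\<^esub>" using d_zero[of "i - 1"] by simp
    show ?thesis unfolding xz d_zero
      using False dz right_linear_zero[OF hrl[of i]] right_linear_zero[OF hrl[of "i + 1"]] by simp
  qed
  with hrl show ?thesis by blast
qed

subsection \<open>The counit on tensor powers\<close>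

abbreviation cw :: "'p word \<Rightarrow> 'a" where "cw \<equiv> counit_word A \<mu>"

lemma koszul_A:
  "x \<in> carrier A \<Longrightarrow> koszul A e x \<in> carrier A"
  "x \<in> carrier A \<Longrightarrow> y \<in> carrier A \<Longrightarrow> koszul A e x \<otimes>\<^bsub>A\<^esub> y = koszul A e (x \<otimes>\<^bsub>A\<^esub> y)"
  "x \<in> carrier A \<Longrightarrow> y \<in> carrier A \<Longrightarrow> x \<otimes>\<^bsub>A\<^esub> koszul A e y = koszul A e (x \<otimes>\<^bsub>A\<^esub> y)"
  "x \<in> carrier A \<Longrightarrow> koszul A e (koszul A f x) = koszul A (e + f) x"
  "x \<in> carrier A \<Longrightarrow> y \<in> carrier A \<Longrightarrow> koszul A e (x \<oplus>\<^bsub>A\<^esub> y) = koszul A e x \<oplus>\<^bsub>A\<^esub> koszul A e y"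
  "koszul A e \<zero>\<^bsub>A\<^esub> = \<zero>\<^bsub>A\<^esub>"
  by (auto simp: koszul_def A.l_minus A.r_minus A.minus_add)

lemma cw_closed: "word_of_C w \<Longrightarrow> cw w \<in> carrier A"
  by (induction w) (auto simp: tensor_words_iff koszul_A \<mu>_simps)

text \<open>The sign arises because each of the \<open>length v\<close> counits for \<open>v\<close> has degree \<open>-1\<close> and passes the word \<open>u\<close>.\<close>

lemma cw_append:
  "word_of_C u \<Longrightarrow> word_of_C v \<Longrightarrow> cw (u @ v) = koszul A (int (length v) * word_deg u) (cw u \<otimes>\<^bsub>A\<^esub> cw v)"
proof (induction u)
  case Nil
  then show ?case by (simp add: cw_closed koszul_def)
next
  case (Cons p u)
  obtain i x where p: "p = (i, x)" by (cases p)
  have x: "x \<in> carrier (C i)" and u: "word_of_C u" using Cons.prems by (auto simp: p tensor_words_iff)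
  have "cw ((p # u) @ v) = koszul A (int (length u + length v) * i + int (length v) * word_deg u) (\<mu> i x \<otimes>\<^bsub>A\<^esub> (cw u \<otimes>\<^bsub>A\<^esub> cw v))"
    using Cons.IH[OF u Cons.prems(2)] x cw_closed[OF u] cw_closed[OF Cons.prems(2)] by (simp add: p koszul_A \<mu>_simps)
  also have "\<dots> = koszul A (int (length v) * word_deg (p # u)) (cw (p # u) \<otimes>\<^bsub>A\<^esub> cw v)"
    using x cw_closed[OF u] cw_closed[OF Cons.prems(2)]
    by (simp add: p koszul_A \<mu>_simps A.m_assoc) (simp add: algebra_simps)
  finally show ?case .
qed

lemma cw_add:
  assumes "word_of_C u" "word_of_C v" "x \<in> carrier (C i)" "y \<in> carrier (C i)"
  shows "cw (u @ (i, x \<oplus>\<^bsub>C i\<^esub> y) # v) = cw (u @ (i, x) # v) \<oplus>\<^bsub>A\<^esub> cw (u @ (i, y) # v)"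
proof -
  have "word_of_C ((i, z) # v)" if "z \<in> carrier (C i)" for z using assms that by (simp add: tensor_words_iff)
  then show ?thesis
    using assms cw_closed[OF assms(1)] cw_closed[OF assms(2)]
    by (simp add: cw_append \<mu>_simps koszul_A A.l_distr A.r_distr)
qed

lemma cw_balanced:
  assumes "word_of_C u" "word_of_C v" "x \<in> carrier (C i)" "y \<in> carrier (C j)" "a \<in> carrier A"
  shows "cw (u @ (i, x \<star>\<^bsub>C i\<^esub> a) # (j, y) # v) = cw (u @ (i, x) # (j, a \<odot>\<^bsub>C j\<^esub> y) # v)"
proof -
  have "word_of_C ((i, z) # (j, z') # v)" if "z \<in> carrier (C i)" "z' \<in> carrier (C j)" for z z'
    using assms that by (simp add: tensor_words_iff)
  then show ?thesis
    using assms cw_closed[OF assms(1)] cw_closed[OF assms(2)]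
    by (simp add: cw_append \<mu>_simps koszul_A A.m_assoc C.r_closed C.l_closed)
qed

lemma cw_lact: "w \<in> W n m \<Longrightarrow> n \<ge> 1 \<Longrightarrow> a \<in> carrier A \<Longrightarrow> cw (lact_word C a w) = a \<otimes>\<^bsub>A\<^esub> cw w"
  by (cases w) (auto simp: W_Cons W_Nil koszul_A \<mu>_simps A.m_assoc cw_closed[OF word_of_C])

lemma cw_ract: "w \<in> W n m \<Longrightarrow> n \<ge> 1 \<Longrightarrow> a \<in> carrier A \<Longrightarrow> cw (ract_word C w a) = cw w \<otimes>\<^bsub>A\<^esub> a"
proof (induction w arbitrary: n m)
  case (Cons p w)
  obtain i x where p: "p = (i, x)" by (cases p)
  have x: "x \<in> carrier (C i)" and w: "w \<in> W (n - 1) (m - i)" using Cons.prems by (auto simp: p W_Cons)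
  show ?case
  proof (cases "w = []")
    case True
    then show ?thesis using x Cons.prems by (simp add: p koszul_A \<mu>_simps)
  next
    case False
    have l: "length (ract_word C w a) = length w"
      using w ract_words[OF bimodules Cons.prems(3) w] by (simp add: tensor_words_iff)
    have "n - 1 \<ge> 1" using w False by (cases "n - 1") (auto simp: tensor_words_iff)
    from Cons.IH[OF w this Cons.prems(3)] have "cw (ract_word C w a) = cw w \<otimes>\<^bsub>A\<^esub> a" .
    moreover have "ract_word C (p # w) a = p # ract_word C w a" using False by (cases w) auto
    ultimately show ?thesis using x Cons.prems cw_closed[OF word_of_C[OF w]] l
      by (simp add: p koszul_A \<mu>_simps A.m_assoc)
  qed
qed (simp add: W_Nil)

lemma A_abelian: "abelian_group A"
  by (rule A.abelian_group_axioms)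

abbreviation cu :: "'p fr set \<Rightarrow> 'a" where "cu \<equiv> presented_lift A cw"

text \<open>The iterated counit on representatives. Since the class depends on \<open>n\<close> and \<open>m\<close>, so does this function.\<close>

definition counit :: "nat \<Rightarrow> int \<Rightarrow> 'p fr \<Rightarrow> 'a" where "counit n m y = cu (cls n m y)"

lemma cu_hom: "cu \<in> hom (add_monoid (presented (W n m) (tensor_relators A C n m))) (add_monoid A)"
  and cu_of: "w \<in> W n m \<Longrightarrow> cu (tensor A C n m w) = cw w"
proof -
  have 0: "h r = \<zero>\<^bsub>A\<^esub>" if r: "r \<in> tensor_relators A C n m" and h: "h \<in> hom (free_Abelian_group (W n m)) (add_monoid A)"
     and hw: "\<And>w. w \<in> W n m \<Longrightarrow> h (frag_of w) = cw w" for r h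
  proof (rule tensor_hom_zero[OF bimodules r A_abelian h])
    fix u i x y v assume w: "u @ (i, x) # v \<in> W n m" and y: "y \<in> carrier (C i)"
    then have "u @ (i, x \<oplus>\<^bsub>C i\<^esub> y) # v \<in> W n m" "u @ (i, y) # v \<in> W n m" "word_of_C u" "word_of_C v" "x \<in> carrier (C i)"
      by (auto simp: tensor_words_iff)
    then show "h (frag_of (u @ (i, x \<oplus>\<^bsub>C i\<^esub> y) # v)) = h (frag_of (u @ (i, x) # v)) \<oplus>\<^bsub>A\<^esub> h (frag_of (u @ (i, y) # v))"
      using w y by (simp add: hw cw_add)
  next
    fix u i x j y v a assume w: "u @ (i, x) # (j, y) # v \<in> W n m" and a: "a \<in> carrier A"
    then have "u @ (i, x \<star>\<^bsub>C i\<^esub> a) # (j, y) # v \<in> W n m" "u @ (i, x) # (j, a \<odot>\<^bsub>C j\<^esub> y) # v \<in> W n m" "word_of_C u" "word_of_C v"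
      "x \<in> carrier (C i)" "y \<in> carrier (C j)"
      by (auto simp: tensor_words_iff C.l_closed C.r_closed)
    then show "h (frag_of (u @ (i, x \<star>\<^bsub>C i\<^esub> a) # (j, y) # v)) = h (frag_of (u @ (i, x) # (j, a \<odot>\<^bsub>C j\<^esub> y) # v))"
      using w a by (simp add: hw cw_balanced)
  qed
  note L = presented_lift_hom[where \<phi> = cw and M = A, OF tensor_relators_carrier[OF bimodules] A_abelian]
  show "cu \<in> hom (add_monoid (presented (W n m) (tensor_relators A C n m))) (add_monoid A)"
    by (rule L(1)) (use 0 cw_closed[OF word_of_C] in blast)+
  show "cu (tensor A C n m w) = cw w" if "w \<in> W n m"
    by (rule L(2)) (use 0 cw_closed[OF word_of_C] that in blast)+
qed

lemma cu_closed: "Y \<in> carrier (T n m) \<Longrightarrow> cu Y \<in> carrier A"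
  and cu_add: "Y \<in> carrier (T n m) \<Longrightarrow> Z \<in> carrier (T n m) \<Longrightarrow> cu (Y \<oplus>\<^bsub>T n m\<^esub> Z) = cu Y \<oplus>\<^bsub>A\<^esub> cu Z"
  using cu_hom[of n m] by (auto simp: hom_def T_simps)

lemma counit_closed: "y \<in> vec n m \<Longrightarrow> counit n m y \<in> carrier A"
  unfolding counit_def by (rule cu_closed[OF cls_closed])

lemma counit_add: "x \<in> vec n m \<Longrightarrow> y \<in> vec n m \<Longrightarrow> counit n m (x + y) = counit n m x \<oplus>\<^bsub>A\<^esub> counit n m y"
  by (simp add: counit_def cls_add cu_add cls_closed)

lemma counit_of: "w \<in> W n m \<Longrightarrow> counit n m (frag_of w) = cw w"
  by (simp add: counit_def cls_of cu_of)

lemma counit_cong: "x \<in> vec n m \<Longrightarrow> y \<in> vec n m \<Longrightarrow> x \<simeq> y \<Longrightarrow> counit n m x = counit n m y"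
  by (simp add: counit_def cls_eq_iff[symmetric])

lemma counit_zero: "counit n m 0 = \<zero>\<^bsub>A\<^esub>"
proof -
  have "counit n m 0 \<oplus>\<^bsub>A\<^esub> counit n m 0 = counit n m 0" using counit_add[of 0 n m 0] by simp
  then show ?thesis using counit_closed[of 0 n m] by simp
qed

lemma counit_minus: "y \<in> vec n m \<Longrightarrow> counit n m (- y) = \<ominus>\<^bsub>A\<^esub> counit n m y"
  using counit_add[of "- y" n m y] counit_closed[of y n m] counit_closed[of "- y" n m] vec_minus[of y n m]
  by (simp add: counit_zero A.minus_equality)

lemma counit_diff: "x \<in> vec n m \<Longrightarrow> y \<in> vec n m \<Longrightarrow> counit n m (x - y) = counit n m x \<ominus>\<^bsub>A\<^esub> counit n m y"
  using counit_add[of x n m "- y"] vec_minus[of y n m] by (simp add: counit_minus A.minus_eq)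

lemma counit_sgn_pow: "y \<in> vec n m \<Longrightarrow> counit n m (sgn_pow e y) = koszul A e (counit n m y)"
  by (simp add: sgn_pow_def koszul_def counit_minus)

lemma cw_off_diagonal: "w \<in> W n m \<Longrightarrow> m \<noteq> int n \<Longrightarrow> cw w = \<zero>\<^bsub>A\<^esub>"
proof (induction w arbitrary: n m)
  case (Cons p w)
  obtain i x where p: "p = (i, x)" by (cases p)
  have x: "x \<in> carrier (C i)" and n: "n \<ge> 1" and w: "w \<in> W (n - 1) (m - i)" using Cons.prems by (auto simp: p W_Cons)
  show ?case
  proof (cases "i = 1")
    case True
    then have "cw w = \<zero>\<^bsub>A\<^esub>" using Cons.IH[OF w] Cons.prems(2) n by (simp add: of_nat_diff)
    then show ?thesis using x by (simp add: p \<mu>_simps koszul_A)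
  next
    case False
    then show ?thesis using x cw_closed[OF word_of_C[OF w]] by (simp add: p \<mu>_zero koszul_A)
  qed
qed (simp add: W_Nil)

text \<open>A word of \<open>n\<close> letters whose total degree is not \<open>n\<close> has a letter of degree other than 1, which the counit kills.\<close>

lemma counit_off_diagonal: "y \<in> vec n m \<Longrightarrow> m \<noteq> int n \<Longrightarrow> counit n m y = \<zero>\<^bsub>A\<^esub>"
proof (induction y rule: vec_induct)
  case (one w)
  then show ?case by (simp add: counit_of cw_off_diagonal)
next
  case (diff a b)
  then show ?case by (simp add: counit_diff A.minus_eq)
qed (simp add: counit_zero)

lemma counit_cat:
  assumes y: "y \<in> vec n m" and z: "z \<in> vec n' m'"
  shows "counit (n + n') (m + m') (y \<diamondop> z) = koszul A (int n' * m) (counit n m y \<otimes>\<^bsub>A\<^esub> counit n' m' z)"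
proof (rule additive_eq[OF A_abelian y])
  fix w assume w: "w \<in> W n m"
  show "counit (n + n') (m + m') (frag_of w \<diamondop> z) = koszul A (int n' * m) (counit n m (frag_of w) \<otimes>\<^bsub>A\<^esub> counit n' m' z)"
  proof (rule additive_eq[OF A_abelian z])
    fix v assume v: "v \<in> W n' m'"
    have "length v = n'" "word_deg w = m" using v w by (auto simp: tensor_words_iff)
    then show "counit (n + n') (m + m') (frag_of w \<diamondop> frag_of v) = koszul A (int n' * m) (counit n m (frag_of w) \<otimes>\<^bsub>A\<^esub> counit n' m' (frag_of v))"
      using w v W_append[OF w v] cw_append[OF word_of_C[OF w] word_of_C[OF v]] by (simp add: counit_of)
  qed (use w in \<open>auto simp: cat_add counit_add counit_closed koszul_A A.r_distr vec_cat\<close>)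
qed (use z in \<open>auto simp: cat_add counit_add counit_closed koszul_A A.l_distr vec_cat\<close>)

lemma counit_lact: "n \<ge> 1 \<Longrightarrow> y \<in> vec n m \<Longrightarrow> a \<in> carrier A \<Longrightarrow> counit n m (lact a y) = a \<otimes>\<^bsub>A\<^esub> counit n m y"
  using additive_eq[OF A_abelian, of y n m "\<lambda>y. counit n m (lact a y)" "\<lambda>y. a \<otimes>\<^bsub>A\<^esub> counit n m y"]
    lact_words[OF bimodules]
  by (simp add: lact_add counit_add counit_closed lact_vec A.r_distr counit_of cw_lact)

lemma counit_ract: "n \<ge> 1 \<Longrightarrow> y \<in> vec n m \<Longrightarrow> a \<in> carrier A \<Longrightarrow> counit n m (ract a y) = counit n m y \<otimes>\<^bsub>A\<^esub> a"
  using additive_eq[OF A_abelian, of y n m "\<lambda>y. counit n m (ract a y)" "\<lambda>y. counit n m y \<otimes>\<^bsub>A\<^esub> a"]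
    ract_words[OF bimodules]
  by (simp add: ract_add counit_add counit_closed ract_vec A.l_distr counit_of cw_ract)

subsection \<open>The differential and its contraction\<close>

text \<open>The differential in terms of one-letter words.\<close>

definition dl :: "int \<Rightarrow> 'p \<Rightarrow> 'p fr" where "dl i x = letter (i + 1) (d i x)"

abbreviation D :: "'p fr \<Rightarrow> 'p fr" where "D \<equiv> der dl"

lemma gmap_dl: "gmap 1 dl"
  unfolding gmap_def
proof (intro conjI allI)
  show "ghom 1 (i + 1) i (dl i)" for i
    by (subst ghom_iff) (auto simp: dl_def d_simps letter_add letter_vec[unfolded One_nat_def] simp del: vec_of)
qed simp

lemma D_vec: "y \<in> vec n m \<Longrightarrow> D y \<in> vec n (m + 1)"
  by (rule der_vec[OF gmap_dl]) auto

lemmas cong_D = cong_der[OF gmap_dl] and D_rel = der_rel[OF gmap_dl] and D_lact = der_lact[OF gmap_dl]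
  and D_ract = der_ract[OF gmap_dl]

text \<open>Right linear maps on the first factor are balanced against the second one. This is why a right linear contraction of \<open>C\<close> acts
  on the tensor powers.\<close>

definition on_first :: "int \<Rightarrow> (int \<Rightarrow> 'p \<Rightarrow> 'p) \<Rightarrow> 'p fr \<Rightarrow> 'p fr"
  where "on_first e f = frag_extend (\<lambda>w. case w of [] \<Rightarrow> 0 | (i, x) # w' \<Rightarrow> frag_of ((i + e, f i x) # w'))"

lemma on_first_diff: "on_first e f (x - y) = on_first e f x - on_first e f y"
  and on_first_add: "on_first e f (x + y) = on_first e f x + on_first e f y"
  and on_first_zero: "on_first e f 0 = 0"
  and on_first_sgn_pow: "on_first e f (sgn_pow k x) = sgn_pow k (on_first e f x)"
  by (simp_all add: on_first_def frag_extend_diff frag_extend_add frag_extend_sgn_pow)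

lemma on_first_letter: "on_first e f (letter i x \<diamondop> y) = letter (i + e) (f i x) \<diamondop> y"
  by (induction y rule: frag_induct) (simp_all add: cat_diff_right on_first_diff, simp_all add: on_first_def)

lemma on_first_vec:
  assumes f: "\<And>i. right_linear i (i + e) (f i)" and y: "y \<in> vec n m"
  shows "on_first e f y \<in> vec n (m + e)"
  unfolding on_first_def
proof (rule vec_extend[OF y])
  fix w assume "w \<in> W n m"
  then show "(case w of [] \<Rightarrow> 0 | (i, x) # w' \<Rightarrow> frag_of ((i + e, f i x) # w')) \<in> vec n (m + e)"
    using f by (cases w) (auto simp: W_Cons right_linear_def)
qed

lemma on_first_rel:
  assumes f: "\<And>i. right_linear i (i + e) (f i)" and r: "r \<in> rel"
  shows "on_first e f r \<in> rel"
  unfolding on_first_def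
proof (rule rel_extend[OF r])
  have fc: "f i x \<in> carrier (C (i + e))" "y \<in> carrier (C i) \<Longrightarrow> f i (x \<oplus>\<^bsub>C i\<^esub> y) = f i x \<oplus>\<^bsub>C (i + e)\<^esub> f i y"
    "a \<in> carrier A \<Longrightarrow> f i (x \<star>\<^bsub>C i\<^esub> a) = f i x \<star>\<^bsub>C (i + e)\<^esub> a" if "x \<in> carrier (C i)" for i x y a
    using f that by (auto simp: right_linear_def)
  let ?F = "\<lambda>w. case w of [] \<Rightarrow> 0 | (i, x) # w' \<Rightarrow> frag_of ((i + e, f i x) # w')"
  fix u v i x y assume *: "word_of_C u" "word_of_C v" "x \<in> carrier (C i)" "y \<in> carrier (C i)"
  show "?F (u @ (i, x \<oplus>\<^bsub>C i\<^esub> y) # v) \<simeq> ?F (u @ (i, x) # v) + ?F (u @ (i, y) # v)"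
  proof (cases u)
    case Nil
    then show ?thesis using rel_add_core[of "[]" v "f i x" "i + e" "f i y"] * fc
      by (simp add: cong_def cat_diff_left cat_add diff_diff_eq W_Nil)
  next
    case (Cons p u')
    then have "word_of_C ((fst p + e, f (fst p) (snd p)) # u')" using *(1) fc by (cases p) (auto simp: tensor_words_iff)
    then show ?thesis using rel_add_core[of "(fst p + e, f (fst p) (snd p)) # u'" v x i y] * Cons
      by (cases p) (simp add: cong_def cat_diff_left cat_diff_right cat_add diff_diff_eq)
  qed
next
  have fc: "f i x \<in> carrier (C (i + e))" "a \<in> carrier A \<Longrightarrow> f i (x \<star>\<^bsub>C i\<^esub> a) = f i x \<star>\<^bsub>C (i + e)\<^esub> a"
    if "x \<in> carrier (C i)" for i x a
    using f that by (auto simp: right_linear_def)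
  let ?F = "\<lambda>w. case w of [] \<Rightarrow> 0 | (i, x) # w' \<Rightarrow> frag_of ((i + e, f i x) # w')"
  fix u v i x j y a assume *: "word_of_C u" "word_of_C v" "x \<in> carrier (C i)" "y \<in> carrier (C j)" "a \<in> carrier A"
  show "?F (u @ (i, x \<star>\<^bsub>C i\<^esub> a) # (j, y) # v) \<simeq> ?F (u @ (i, x) # (j, a \<odot>\<^bsub>C j\<^esub> y) # v)"
  proof (cases u)
    case Nil
    then show ?thesis using rel_balance_core[of "[]" v "f i x" "i + e" y j a] * fc
      by (simp add: cong_def cat_diff_left W_Nil)
  next
    case (Cons p u')
    then have "word_of_C ((fst p + e, f (fst p) (snd p)) # u')" using *(1) fc by (cases p) (auto simp: tensor_words_iff)
    then show ?thesis using rel_balance_core[of "(fst p + e, f (fst p) (snd p)) # u'" v x i y j a] * Cons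
      by (cases p) (simp add: cong_def cat_diff_left cat_diff_right)
  qed
qed

definition contraction :: "int \<Rightarrow> 'p \<Rightarrow> 'p"
  where "contraction = (SOME h. (\<forall>i. right_linear i (i - 1) (h i)) \<and>
    (\<forall>i. \<forall>x\<in>carrier (C i). d (i - 1) (h i x) \<oplus>\<^bsub>C i\<^esub> h (i + 1) (d i x) =
      (if i = 1 then x \<ominus>\<^bsub>C 1\<^esub> pt \<star>\<^bsub>C 1\<^esub> \<mu> 1 x else x)))"

lemma contraction: "right_linear i (i - 1) (contraction i)"
  "x \<in> carrier (C i) \<Longrightarrow> d (i - 1) (contraction i x) \<oplus>\<^bsub>C i\<^esub> contraction (i + 1) (d i x) =
      (if i = 1 then x \<ominus>\<^bsub>C 1\<^esub> pt \<star>\<^bsub>C 1\<^esub> \<mu> 1 x else x)"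
  using someI_ex[OF contraction_exists] unfolding contraction_def[symmetric] by blast+

definition H :: "'p fr \<Rightarrow> 'p fr" where "H = on_first (- 1) contraction"

text \<open>The right linear idempotent of \<open>C\<close> that is left over by the contraction, applied to the first tensor factor.\<close>

definition E :: "'p fr \<Rightarrow> 'p fr"
  where "E = frag_extend (\<lambda>w. case w of [] \<Rightarrow> 0 | (i, x) # w' \<Rightarrow>
    if i = 1 then frag_of ((1, pt \<star>\<^bsub>C 1\<^esub> \<mu> 1 x) # w') else 0)"

lemma letter_minus: "x \<in> carrier (C i) \<Longrightarrow> letter i (\<ominus>\<^bsub>C i\<^esub> x) \<simeq> - letter i x"
proof -
  assume x: "x \<in> carrier (C i)"
  have "letter i (\<ominus>\<^bsub>C i\<^esub> x) + letter i x \<simeq> letter i (\<ominus>\<^bsub>C i\<^esub> x \<oplus>\<^bsub>C i\<^esub> x)"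
    using letter_add[of "\<ominus>\<^bsub>C i\<^esub> x" i x] x by (simp add: cong_sym)
  also have "\<dots> \<simeq> 0" using x letter_zero by (simp add: C.M.l_neg)
  finally show ?thesis by (simp add: cong_def)
qed

lemma letter_diff: "x \<in> carrier (C i) \<Longrightarrow> y \<in> carrier (C i) \<Longrightarrow> letter i (x \<ominus>\<^bsub>C i\<^esub> y) \<simeq> letter i x - letter i y"
  using cong_trans[OF letter_add[of x i "\<ominus>\<^bsub>C i\<^esub> y"] cong_add[OF cong_refl letter_minus[of y i]]]
  by (simp add: C.M.minus_eq)

text \<open>On the first factor, this is the equation for the contraction. On the other factors, the contraction and the differential have odd
  degree and so their two mixed terms cancel.\<close>

lemma homotopy:
  assumes "y \<in> vec n m" "n \<ge> 1"
  shows "D (H y) + H (D y) \<simeq> y - E y"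
  using assms(1)
proof (induction y rule: vec_induct)
  case (one w)
  then obtain i x w' where w: "w = (i, x) # w'" and x: "x \<in> carrier (C i)" and w': "w' \<in> W (n - 1) (m - i)"
    using assms(2) by (cases w) (auto simp: W_Cons W_Nil)
  let ?v = "frag_of w'"
  have h: "contraction i x \<in> carrier (C (i - 1))" "contraction (i + 1) (d i x) \<in> carrier (C i)" "d (i - 1) (contraction i x) \<in> carrier (C i)"
    using contraction(1)[of i] contraction(1)[of "i + 1"] x d_simps(1)[OF x] d_simps(1)[of "contraction i x" "i - 1"] by (auto simp: right_linear_def)
  have wl: "frag_of w = letter i x \<diamondop> ?v" by (simp add: w)
  have "D (H (frag_of w)) + H (D (frag_of w)) = (letter i (d (i - 1) (contraction i x)) + letter i (contraction (i + 1) (d i x))) \<diamondop> ?v"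
    unfolding wl H_def on_first_letter der_letter_cat on_first_add on_first_sgn_pow dl_def
    by (simp add: cat_add) (simp add: sgn_pow_def)
  also have "\<dots> \<simeq> letter i (d (i - 1) (contraction i x) \<oplus>\<^bsub>C i\<^esub> contraction (i + 1) (d i x)) \<diamondop> ?v"
    using w' h by (intro cong_cat_right[OF _ cong_sym[OF letter_add], of _ "n - 1" "m - i"]) simp_all
  also have "\<dots> \<simeq> frag_of w - E (frag_of w)"
  proof (cases "i = 1")
    case True
    have "letter 1 (x \<ominus>\<^bsub>C 1\<^esub> pt \<star>\<^bsub>C 1\<^esub> \<mu> 1 x) \<diamondop> ?v \<simeq> (letter 1 x - letter 1 (pt \<star>\<^bsub>C 1\<^esub> \<mu> 1 x)) \<diamondop> ?v"
      using w' x True pt by (intro cong_cat_right[OF _ letter_diff, of _ "n - 1" "m - i"]) (simp_all add: C.r_closed \<mu>_simps)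
    then show ?thesis using contraction(2)[OF x] True by (simp add: wl cat_diff_left E_def)
  next
    case False
    then show ?thesis using contraction(2)[OF x] by (simp add: wl E_def)
  qed
  finally show ?case .
next
  case (diff a b)
  from cong_diff[OF diff.IH] show ?case
    by (simp add: der_simps H_def on_first_diff E_def frag_extend_diff algebra_simps)
qed (simp add: der_simps H_def on_first_zero E_def)

subsection \<open>Reduction to fewer factors\<close>

text \<open>This is \<open>\<mu> \<otimes> 1\<close>, where the value of \<open>\<mu>\<close> acts on the remaining factors. One-letter words are sent to zero: they leave
  no factor to act on, and the empty tensor power is not the algebra.\<close>

definition red :: "'p fr \<Rightarrow> 'p fr"
  where "red = frag_extend (\<lambda>w. case w of [] \<Rightarrow> 0 | (i, x) # w' \<Rightarrow>
    if i = 1 \<and> w' \<noteq> [] then frag_of (lact_word C (\<mu> 1 x) w') else 0)"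

lemma red_diff: "red (x - y) = red x - red y" and red_add: "red (x + y) = red x + red y" and red_zero: "red 0 = 0"
  and red_sgn_pow: "red (sgn_pow k x) = sgn_pow k (red x)"
  by (simp_all add: red_def frag_extend_diff frag_extend_add frag_extend_sgn_pow)

lemma red_letter:
  "y \<in> vec n m \<Longrightarrow> n \<ge> 1 \<Longrightarrow> red (letter i x \<diamondop> y) = (if i = 1 then lact (\<mu> 1 x) y else 0)"
proof (induction y rule: vec_induct)
  case (one w)
  then have "w \<noteq> []" by (auto simp: W_Nil)
  then show ?case by (simp add: red_def)
qed (auto simp: cat_diff_right red_diff lact_diff red_zero)

lemma red_vec: 
  assumes y: "y \<in> vec n m" and n: "n \<ge> 2"
  shows "red y \<in> vec (n - 1) (m - 1)"
  unfolding red_def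
proof (rule vec_extend[OF y])
  fix w assume "w \<in> W n m"
  then show "(case w of [] \<Rightarrow> 0 | (i, x) # w' \<Rightarrow> if i = 1 \<and> w' \<noteq> [] then frag_of (lact_word C (\<mu> 1 x) w') else 0) \<in> vec (n - 1) (m - 1)"
    using lact_words[OF bimodules] \<mu>_simps(1) by (cases w) (auto simp: W_Cons)
qed

lemma red_rel: "r \<in> rel \<Longrightarrow> red r \<in> rel"
  unfolding red_def
proof (erule rel_extend)
  let ?F = "\<lambda>w. case w of [] \<Rightarrow> 0 | (i, x) # w' \<Rightarrow> if i = 1 \<and> w' \<noteq> [] then frag_of (lact_word C (\<mu> 1 x) w') else 0"
  {
    fix u v i x y assume *: "word_of_C u" "word_of_C v" "x \<in> carrier (C i)" "y \<in> carrier (C i)"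
    show "?F (u @ (i, x \<oplus>\<^bsub>C i\<^esub> y) # v) \<simeq> ?F (u @ (i, x) # v) + ?F (u @ (i, y) # v)"
    proof (cases u)
      case Nil
      show ?thesis
      proof (cases v)
        case (Cons q v')
        obtain j z where q: "q = (j, z)" by (cases q)
        have z: "z \<in> carrier (C j)" "word_of_C v'" using *(2) Cons q by (auto simp: tensor_words_iff)
        show ?thesis using rel_add_core[of "[]" v' "\<mu> i x \<odot>\<^bsub>C j\<^esub> z" j "\<mu> i y \<odot>\<^bsub>C j\<^esub> z"] * z Nil Cons q
          by (cases "i = 1") (simp_all add: cong_def cat_diff_left cat_add diff_diff_eq W_Nil \<mu>_simps C.l_closed C.add_l rel.zero)
      qed (use Nil in simp)
    next
      case (Cons p u')
      obtain k z where p: "p = (k, z)" by (cases p)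
      have z: "z \<in> carrier (C k)" "word_of_C u'" using *(1) Cons p by (auto simp: tensor_words_iff)
      have "frag_of u' \<diamondop> (letter i (x \<oplus>\<^bsub>C i\<^esub> y) - letter i x - letter i y) \<diamondop> frag_of v \<in> rel"
        using z * by (intro rel_add_core)
      from rel_lact[OF \<mu>_simps(1)[OF z(1)] this] Cons p show ?thesis
        by (cases "k = 1") (simp_all add: cong_def cat_diff_left cat_diff_right cat_add diff_diff_eq lact_diff lact_add rel.zero)
    qed
  next
    fix u v i x j y a assume *: "word_of_C u" "word_of_C v" "x \<in> carrier (C i)" "y \<in> carrier (C j)" "a \<in> carrier A"
    show "?F (u @ (i, x \<star>\<^bsub>C i\<^esub> a) # (j, y) # v) \<simeq> ?F (u @ (i, x) # (j, a \<odot>\<^bsub>C j\<^esub> y) # v)"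
    proof (cases u)
      case Nil
      then show ?thesis using * by (auto simp: \<mu>_simps C.l_assoc)
    next
      case (Cons p u')
      obtain k z where p: "p = (k, z)" by (cases p)
      have z: "z \<in> carrier (C k)" "word_of_C u'" using *(1) Cons p by (auto simp: tensor_words_iff)
      have "frag_of u' \<diamondop> (frag_of [(i, x \<star>\<^bsub>C i\<^esub> a), (j, y)] - frag_of [(i, x), (j, a \<odot>\<^bsub>C j\<^esub> y)]) \<diamondop> frag_of v \<in> rel"
        using z * by (intro rel_balance_core)
      from rel_lact[OF \<mu>_simps(1)[OF z(1)] this] Cons p show ?thesis
        by (cases "k = 1") (simp_all add: cong_def cat_diff_left cat_diff_right lact_diff rel.zero)
    qed
  }
qed

text \<open>The coefficient \<open>\<mu> x\<close> is moved from the first to the second factor.\<close>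

lemma E_red:
  assumes "y \<in> vec n m" "n \<ge> 2"
  shows "E y \<simeq> letter 1 pt \<diamondop> red y"
  using assms(1)
proof (induction y rule: vec_induct)
  case (one w)
  then obtain i x w' where w: "w = (i, x) # w'" and x: "x \<in> carrier (C i)" and w': "w' \<in> W (n - 1) (m - i)"
    using assms(2) by (cases w) (auto simp: W_Cons W_Nil)
  have ne: "w' \<noteq> []" using w' assms(2) by (auto simp: W_Nil)
  show ?case
  proof (cases "i = 1")
    case True
    have "ract (\<mu> 1 x) (letter 1 pt) \<diamondop> frag_of w' \<simeq> letter 1 pt \<diamondop> lact (\<mu> 1 x) (frag_of w')"
      by (rule balanced[OF letter_vec[OF pt(1)] _ _ _ \<mu>_simps(1), of _ "n - 1" "m - i"]) (use w' x True assms(2) in auto)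
    then show ?thesis using True ne by (simp add: E_def red_def w)
  next
    case False
    then show ?thesis by (simp add: E_def red_def w)
  qed
next
  case (diff a b)
  from cong_diff[OF diff.IH] show ?case by (simp add: E_def red_diff frag_extend_diff cat_diff_right)
qed (simp add: E_def red_zero)

text \<open>Since \<open>\<mu> d = 0\<close>, the differential of the first factor does not contribute; the sign is that of passing a first factor of degree 1.\<close>

lemma D_red:
  assumes "y \<in> vec n m" "n \<ge> 2"
  shows "D (red y) \<simeq> - red (D y)"
  using assms(1)
proof (induction y rule: vec_induct)
  case (one w)
  then obtain i x w' where w: "w = (i, x) # w'" and x: "x \<in> carrier (C i)" and w': "w' \<in> W (n - 1) (m - i)"
    using assms(2) by (cases w) (auto simp: W_Cons W_Nil)
  let ?v = "frag_of w'"
  have v: "?v \<in> vec (n - 1) (m - i)" "n - 1 \<ge> 1" using w' assms(2) by auto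
  have wl: "frag_of w = letter i x \<diamondop> ?v" by (simp add: w)
  have 1: "red (dl i x \<diamondop> ?v) \<simeq> 0"
    unfolding dl_def red_letter[OF v] using \<mu>d_zero[OF x] lact_zero_scalar[OF v] by auto
  have 2: "D (red (letter i x \<diamondop> ?v)) \<simeq> - red (sgn_pow i (letter i x \<diamondop> D ?v))"
    unfolding red_sgn_pow red_letter[OF v] red_letter[OF D_vec[OF v(1)] v(2)]
    using D_lact[OF v(1) \<mu>_simps(1)[of x 1]] x by (auto simp: sgn_pow_def der_simps)
  have e: "- (X + Y) = - Y - X" for X Y :: "'p fr" by simp
  show ?case unfolding wl der_letter_cat red_add e using cong_diff[OF 2 cong_sym[OF 1]] by simp
next
  case (diff a b)
  from cong_diff[OF diff.IH] show ?case by (simp add: red_diff der_simps)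
qed (simp add: red_zero der_simps)

lemma counit_red:
  assumes n: "n \<ge> 2" and y: "y \<in> vec n (int n)"
  shows "counit (n - 1) (int n - 1) (red y) = koszul A (int n - 1) (counit n (int n) y)"
proof (rule additive_eq[OF A_abelian y])
  fix w assume w: "w \<in> W n (int n)"
  then obtain i x w' where w_eq: "w = (i, x) # w'" and x: "x \<in> carrier (C i)" and w': "w' \<in> W (n - 1) (int n - i)"
    using n by (cases w) (auto simp: W_Cons W_Nil)
  have ne: "w' \<noteq> []" and l: "int (length w') = int n - 1" using w' n by (auto simp: tensor_words_iff)
  have c: "cw w' \<in> carrier A" by (rule cw_closed[OF word_of_C[OF w']])
  show "counit (n - 1) (int n - 1) (red (frag_of w)) = koszul A (int n - 1) (counit n (int n) (frag_of w))"
  proof (cases "i = 1")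
    case True
    have "counit (n - 1) (int n - 1) (red (frag_of w)) = \<mu> 1 x \<otimes>\<^bsub>A\<^esub> cw w'"
      using True ne w' x n lact_words[OF bimodules \<mu>_simps(1) w', of x 1] cw_lact[OF w' _ \<mu>_simps(1), of x 1]
      by (simp add: w_eq red_def counit_of)
    moreover have "koszul A (int n - 1) (counit n (int n) (frag_of w)) = \<mu> 1 x \<otimes>\<^bsub>A\<^esub> cw w'"
      using counit_of[OF w] l x True c by (simp add: w_eq koszul_A \<mu>_simps) (simp add: koszul_def)
    ultimately show ?thesis by simp
  next
    case False
    have "cw w = \<zero>\<^bsub>A\<^esub>" using False x c by (simp add: w_eq \<mu>_zero koszul_A)
    then show ?thesis using False counit_of[OF w] by (simp add: w_eq red_def counit_zero koszul_A)
  qed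
next
  show "counit (n - 1) (int n - 1) (red x) \<in> carrier A" if "x \<in> vec n (int n)" for x
    by (rule counit_closed[OF red_vec[OF that n]])
  show "counit (n - 1) (int n - 1) (red (x + y)) = counit (n - 1) (int n - 1) (red x) \<oplus>\<^bsub>A\<^esub> counit (n - 1) (int n - 1) (red y)"
    if "x \<in> vec n (int n)" "y \<in> vec n (int n)" for x y
    unfolding red_add by (rule counit_add[OF red_vec[OF that(1) n] red_vec[OF that(2) n]])
qed (auto simp: koszul_A counit_closed counit_add)

text \<open>The only case in which no second factor can absorb the coefficient.\<close>

lemma E_single:
  assumes "y \<in> vec 1 1"
  shows "E y \<simeq> letter 1 (pt \<star>\<^bsub>C 1\<^esub> counit 1 1 y)"
  using assms
proof (induction y rule: vec_induct)
  case zero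
  show ?case using pt letter_zero[of 1] by (simp add: E_def counit_zero C.ract_zero_scalar cong_sym)
next
  case (one w)
  then obtain x where w: "w = [(1, x)]" and x: "x \<in> carrier (C 1)"
    by (cases w) (auto simp: tensor_words_iff)
  show ?case using counit_of[OF one] x by (simp add: w E_def koszul_def \<mu>_simps)
next
  case (diff a b)
  have c: "counit 1 1 a \<in> carrier A" "counit 1 1 b \<in> carrier A" using diff counit_closed by auto
  have "E (a - b) = E a - E b" by (simp add: E_def frag_extend_diff)
  also have "\<dots> \<simeq> letter 1 (pt \<star>\<^bsub>C 1\<^esub> counit 1 1 a) - letter 1 (pt \<star>\<^bsub>C 1\<^esub> counit 1 1 b)" by (rule cong_diff[OF diff.IH])
  also have "\<dots> \<simeq> letter 1 (pt \<star>\<^bsub>C 1\<^esub> counit 1 1 a \<ominus>\<^bsub>C 1\<^esub> pt \<star>\<^bsub>C 1\<^esub> counit 1 1 b)"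
    using c pt by (intro cong_sym[OF letter_diff]) (auto simp: C.r_closed)
  also have "pt \<star>\<^bsub>C 1\<^esub> counit 1 1 a \<ominus>\<^bsub>C 1\<^esub> pt \<star>\<^bsub>C 1\<^esub> counit 1 1 b = pt \<star>\<^bsub>C 1\<^esub> counit 1 1 (a - b)"
    using c pt diff by (simp add: counit_diff A.minus_eq C.M.minus_eq C.add_r C.ract_minus_scalar)
  finally show ?case .
qed

text \<open>Some letter has degree greater than 1.\<close>

lemma above_top: "y \<in> vec n m \<Longrightarrow> m > int n \<Longrightarrow> y \<in> rel"
proof (induction y rule: vec_induct)
  case (one w)
  have "frag_of w \<in> rel" if "w \<in> W n m" "m > int n" for w n m
    using that
  proof (induction w arbitrary: n m)
    case (Cons p w)
    obtain i x where p: "p = (i, x)" by (cases p)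
    have x: "x \<in> carrier (C i)" and w: "w \<in> W (n - 1) (m - i)" and n: "n \<ge> 1" using Cons.prems by (auto simp: p W_Cons)
    have wl: "frag_of (p # w) = letter i x \<diamondop> frag_of w" by (simp add: p)
    show ?case
    proof (cases "i > 1")
      case True
      then have "letter i x \<in> rel" using in_top[OF True x] letter_zero by (simp add: cong_zero_iff)
      then show ?thesis unfolding wl using w by (intro rel_cat_right[of _ "n - 1" "m - i"]) auto
    next
      case False
      then have "frag_of w \<in> rel" using Cons.IH[OF w] Cons.prems(2) n by (simp add: of_nat_diff)
      then show ?thesis unfolding wl by (rule rel_cat_left[OF letter_vec[OF x]])
    qed
  qed (simp add: W_Nil)
  then show ?case using one by blast
qed (auto intro: rel.zero rel.diff)

text \<open>For a cycle \<open>y\<close> the homotopy gives \<open>y \<simeq> D (H y) + E y\<close>, and \<open>E y\<close> is the product of \<open>pt\<close> with the cycle \<open>red y\<close>, which has one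
  factor less. If \<open>red y = D u\<close>, then \<open>E y\<close> is the boundary of \<open>- (pt \<otimes> u)\<close>, because \<open>d pt = 0\<close> and \<open>pt\<close> has odd degree.\<close>

lemma boundary_criterion:
  assumes "n \<ge> 1" "y \<in> vec n m" "D y \<in> rel" "m = int n \<Longrightarrow> counit n m y = \<zero>\<^bsub>A\<^esub>"
  shows "\<exists>z\<in>vec n (m - 1). D z \<simeq> y"
  using assms
proof (induction n arbitrary: y m)
  case (Suc n)
  have y: "y \<in> vec (Suc n) m" by (rule Suc.prems(2))
  have cr: "\<And>i. right_linear i (i + - 1) (contraction i)" using contraction(1) by simp
  have Hy: "H y \<in> vec (Suc n) (m - 1)" using on_first_vec[OF cr y] by (simp add: H_def)
  have "H (D y) \<in> rel" unfolding H_def by (rule on_first_rel[OF cr Suc.prems(3)])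
  then have HD: "H (D y) \<simeq> 0" by (simp add: cong_zero_iff)
  have DH: "D (H y) \<simeq> y - E y"
    using cong_diff[OF homotopy[OF y] HD] by simp
  show ?case
  proof (cases "n = 0")
    case True
    have "E y \<simeq> 0"
    proof (cases "m = 1")
      case True
      then have "counit 1 1 y = \<zero>\<^bsub>A\<^esub>" using Suc.prems(4) \<open>n = 0\<close> by simp
      then show ?thesis using E_single[of y] y True \<open>n = 0\<close> pt letter_zero[of 1]
        by (auto simp: C.ract_zero_scalar intro: cong_trans)
    next
      case False
      have "E z = 0" if "z \<in> vec (Suc n) m" for z
        using that
      proof (induction z rule: vec_induct)
        case (one w)
        then show ?case using False \<open>n = 0\<close> by (cases w) (auto simp: E_def tensor_words_iff)
      qed (simp_all add: E_def frag_extend_diff)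
      then show ?thesis using y by simp
    qed
    from cong_trans[OF DH cong_diff[OF cong_refl this]] Hy show ?thesis by auto
  next
    case False
    then have n: "Suc n \<ge> 2" "n \<ge> 1" by auto
    have r: "red y \<in> vec n (m - 1)" using red_vec[OF y n(1)] by simp
    have "D (red y) \<in> rel"
      using cong_trans[OF D_red[OF y n(1)] cong_minus[of "red (D y)" 0]] red_rel[OF Suc.prems(3)] by (simp add: cong_zero_iff)
    moreover have "counit n (m - 1) (red y) = \<zero>\<^bsub>A\<^esub>" if "m - 1 = int n"
    proof -
      have m: "m = int (Suc n)" using that by simp
      show ?thesis using counit_red[OF n(1), of y] y Suc.prems(4)[OF m] unfolding m by (simp add: koszul_A)
    qed
    ultimately obtain u where u: "u \<in> vec n (m - 1 - 1)" "D u \<simeq> red y" using Suc.IH[OF n(2) r] by blast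
    let ?z = "H y - letter 1 pt \<diamondop> u"
    have z: "?z \<in> vec (Suc n) (m - 1)"
      using Hy vec_cat'[OF letter_vec[OF pt(1)] u(1), of "Suc n" "m - 1"] by auto
    have "d 1 pt = \<zero>\<^bsub>C (1 + 1)\<^esub>" using in_top[of "1 + 1" "d 1 pt"] d_simps(1)[OF pt(1)] by simp
    then have "dl 1 pt \<simeq> 0" using letter_zero[of "1 + 1"] by (simp add: dl_def)
    then have "dl 1 pt \<diamondop> u \<simeq> 0" using cong_cat_right[OF u(1), of "dl 1 pt" 0] by simp
    moreover have "letter 1 pt \<diamondop> D u \<simeq> E y"
      by (rule cong_trans[OF cong_cat_left[OF letter_vec[OF pt(1)] u(2)] cong_sym[OF E_red[OF y n(1)]]])
    ultimately have "D (letter 1 pt \<diamondop> u) \<simeq> 0 - E y"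
      unfolding der_letter_cat using cong_diff by (fastforce simp: sgn_pow_def)
    from cong_diff[OF DH this] have "D ?z \<simeq> y" by (simp add: der_simps)
    with z show ?thesis by blast
  qed
qed simp

end

section \<open>The structure maps as classes\<close>

context bimodule_family
begin

text \<open>The operations on classes that enter the definition of an \<open>A\<^sub>\<infinity>\<close>-coalgebra are computed on representatives by concatenation
  and by \<^const>\<open>ins\<close>.\<close>

lemma splice_tensor_cls:
  assumes u: "u \<in> W r k" and v: "v \<in> W t l" and y: "y \<in> vec s e" and "n = r + s + t" "m = k + e + l"
  shows "splice_tensor A C n m u (cls s e y) v = cls n m (frag_of u \<diamondop> y \<diamondop> frag_of v)"
proof -
  let ?h = "\<lambda>y. cls n m (frag_of u \<diamondop> y \<diamondop> frag_of v)"
  have hv: "frag_of u \<diamondop> y \<diamondop> frag_of v \<in> vec n m" if "y \<in> vec s e" for y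
    by (rule vec_cat'[OF vec_cat[OF _ that]]) (use u v assms in auto)
  have "presented_lift (T n m) (\<lambda>z. tensor A C n m (u @ z @ v)) (cls s e y) = ?h y"
    unfolding cls_def[of s e]
  proof (rule presented_lift_coset[OF tensor_relators_carrier[OF bimodules] T_abelian])
    show "?h \<in> hom (free_Abelian_group (W s e)) (add_monoid (T n m))"
      unfolding hom_def using hv cls_closed
      by (auto simp: vec_carrier[symmetric] cat_add cls_add simp del: carrier_free_Abelian_group_iff)
    show "?h (frag_of w) = tensor A C n m (u @ w @ v)" for w by (simp add: cls_of)
    fix r assume r: "r \<in> tensor_relators A C s e"
    then have "r \<in> vec s e" using tensor_relators_carrier[OF bimodules] unfolding vec_carrier by (rule subsetD[rotated])
    moreover have "frag_of u \<diamondop> r \<diamondop> frag_of v \<in> rel"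
      by (rule rel_cat_right[of _ t l], use v in simp, rule rel_cat_left[of _ _ k], use u in simp, rule rel.relator[OF r])
    ultimately show "?h r = \<zero>\<^bsub>T n m\<^esub>"
      unfolding cls_zero[symmetric] by (subst cls_eq_iff) (auto simp: hv cong_zero_iff)
  qed (use y in \<open>simp add: vec_def\<close>)
  then show ?thesis by (simp add: splice_tensor_def)
qed

lemma id_tensor_id_cls:
  assumes g: "gmap s g" and f: "\<And>i x. x \<in> carrier (C i) \<Longrightarrow> f i x = cls s (i + 1) (g i x)"
    and y: "y \<in> vec (r + 1 + t) m"
  shows "id_tensor_id A C r s t f m (cls (r + 1 + t) m y) = cls (r + s + t) (m + 1) (ins g r y)"
  unfolding id_tensor_id_def cls_def[of "r + 1 + t" m]
proof (rule presented_lift_coset[OF tensor_relators_carrier[OF bimodules] T_abelian])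
  let ?n = "r + s + t"
  have hv: "ins g r y \<in> vec ?n (m + 1)" if "y \<in> vec (r + 1 + t) m" for y
    by (rule ins_vec[OF g that]) auto
  have ia: "ins g r (x + y) = ins g r x + ins g r y" for x y by (simp add: ins_def frag_extend_add)
  show "(\<lambda>y. cls ?n (m + 1) (ins g r y)) \<in> hom (free_Abelian_group (W (r + 1 + t) m)) (add_monoid (T ?n (m + 1)))"
    unfolding hom_def using hv cls_closed
    by (auto simp: vec_carrier[symmetric] ia cls_add simp del: carrier_free_Abelian_group_iff)
  show "cls ?n (m + 1) (ins g r z) = \<zero>\<^bsub>T ?n (m + 1)\<^esub>" if z: "z \<in> tensor_relators A C (r + 1 + t) m" for z
  proof -
    have "z \<in> vec (r + 1 + t) m" using z tensor_relators_carrier[OF bimodules] unfolding vec_carrier by (rule subsetD[rotated])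
    then show ?thesis unfolding cls_zero[symmetric]
      using ins_rel[OF g rel.relator[OF z]] hv by (subst cls_eq_iff) (auto simp: cong_zero_iff)
  qed
  show "Poly_Mapping.keys y \<subseteq> W (r + 1 + t) m" using y by (simp add: vec_def)
  fix w assume w: "w \<in> W (r + 1 + t) m"
  then have len: "r < length w" "length w = r + 1 + t" by (auto simp: tensor_words_iff)
  obtain i x where ix: "w ! r = (i, x)" by (cases "w ! r")
  have wsplit: "w = take r w @ (i, x) # drop (Suc r) w" using id_take_nth_drop[OF len(1)] ix by simp
  have "take r w @ (i, x) # drop (Suc r) w \<in> W (r + 1 + t) m" using w wsplit by simp
  then have u: "take r w \<in> W r (word_deg (take r w))" and v: "drop (Suc r) w \<in> W t (word_deg (drop (Suc r) w))"
    and x: "x \<in> carrier (C i)" and m: "m = word_deg (take r w) + i + word_deg (drop (Suc r) w)"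
    using len by (auto simp: tensor_words_iff)
  have z: "frag_of (take r w) \<diamondop> g i x \<diamondop> frag_of (drop (Suc r) w) \<in> vec ?n (m + 1)"
    by (rule vec_cat'[OF vec_cat[OF _ gmap_vec[OF g x]]]) (use u v m in auto)
  have "splice_tensor A C ?n (m + 1) (take r w) (cls s (i + 1) (g i x)) (drop (Suc r) w) =
      cls ?n (m + 1) (frag_of (take r w) \<diamondop> g i x \<diamondop> frag_of (drop (Suc r) w))"
    by (rule splice_tensor_cls[OF u v gmap_vec[OF g x]]) (use m in auto)
  then show "cls ?n (m + 1) (ins g r (frag_of w)) =
      koszul (T ?n (m + 1)) (word_deg (take r w))
        (splice_tensor A C ?n (m + 1) (take r w) (case w ! r of (i, x) \<Rightarrow> f i x) (drop (Suc r) w))"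
    using insw_split[OF len(1), of g] ix x z by (simp add: f ins_simps cls_sgn_pow)
qed

subsection \<open>Bimodule maps modulo the relations\<close>

lemma ghom_null: "n \<ge> 1 \<Longrightarrow> ghom n m i (\<lambda>x. 0)"
  by (simp add: ghom_iff)

lemma ghom_plus: "n \<ge> 1 \<Longrightarrow> ghom n m i f \<Longrightarrow> ghom n m i g \<Longrightarrow> ghom n m i (\<lambda>x. f x + g x)"
  unfolding ghom_iff
proof (intro conjI ballI; elim conjE)
  fix x y assume *: "x \<in> carrier (C i)" "y \<in> carrier (C i)"
    "\<forall>x\<in>carrier (C i). \<forall>y\<in>carrier (C i). f (x \<oplus>\<^bsub>C i\<^esub> y) \<simeq> f x + f y"
    "\<forall>x\<in>carrier (C i). \<forall>y\<in>carrier (C i). g (x \<oplus>\<^bsub>C i\<^esub> y) \<simeq> g x + g y"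
  then have "f (x \<oplus>\<^bsub>C i\<^esub> y) + g (x \<oplus>\<^bsub>C i\<^esub> y) \<simeq> (f x + f y) + (g x + g y)" by (blast intro: cong_add)
  then show "f (x \<oplus>\<^bsub>C i\<^esub> y) + g (x \<oplus>\<^bsub>C i\<^esub> y) \<simeq> (f x + g x) + (f y + g y)" by (simp add: algebra_simps)
qed (auto simp: lact_add ract_add intro: cong_add)

lemma ghom_uminus: "n \<ge> 1 \<Longrightarrow> ghom n m i f \<Longrightarrow> ghom n m i (\<lambda>x. - f x)"
proof -
  assume n: "n \<ge> 1" and f: "ghom n m i f"
  have l: "lact a (- x) = - lact a x" "ract a (- x) = - ract a x" for a x
    using lact_diff[of a 0 x] ract_diff[of a 0 x] by simp_all
  have s: "- (x + y) = - x + - y" for x y :: "'p fr" by simp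
  show ?thesis using f unfolding ghom_iff[OF n] l s[symmetric] by (blast intro: cong_minus)
qed

lemma ghom_sum: "n \<ge> 1 \<Longrightarrow> (\<And>s. s \<in> S \<Longrightarrow> ghom n m i (f s)) \<Longrightarrow> ghom n m i (\<lambda>x. \<Sum>s\<in>S. f s x)"
  by (induction S rule: infinite_finite_induct) (simp_all add: ghom_null ghom_plus)

lemma ghom_der:
  assumes g: "gmap s g" and n: "n \<ge> 1" and f: "ghom n m i f"
  shows "ghom (n + s - 1) (m + 1) i (\<lambda>x. der g (f x))"
proof -
  have n': "n + s - 1 \<ge> 1" using n gmap_pos[OF g] by simp
  note F = f[unfolded ghom_iff[OF n]]
  have fv: "f x \<in> vec n m" if "x \<in> carrier (C i)" for x using F that by blast
  show ?thesis unfolding ghom_iff[OF n']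
  proof (intro conjI ballI)
    fix x assume x: "x \<in> carrier (C i)"
    show "der g (f x) \<in> vec (n + s - 1) (m + 1)" by (rule der_vec[OF g fv[OF x]]) simp_all
    show "der g (f (x \<oplus>\<^bsub>C i\<^esub> y)) \<simeq> der g (f x) + der g (f y)" if "y \<in> carrier (C i)" for y
      using cong_der[OF g, of "f (x \<oplus>\<^bsub>C i\<^esub> y)" "f x + f y"] F x that by (simp add: der_simps)
  next
    fix x a assume x: "x \<in> carrier (C i)" and a: "a \<in> carrier A"
    have 1: "f (a \<odot>\<^bsub>C i\<^esub> x) \<simeq> lact a (f x)" "f (x \<star>\<^bsub>C i\<^esub> a) \<simeq> ract a (f x)" using F x a by blast+
    show "der g (f (a \<odot>\<^bsub>C i\<^esub> x)) \<simeq> lact a (der g (f x))"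
      by (rule cong_trans[OF cong_der[OF g 1(1)] der_lact[OF g fv[OF x] a]])
    show "der g (f (x \<star>\<^bsub>C i\<^esub> a)) \<simeq> ract a (der g (f x))"
      by (rule cong_trans[OF cong_der[OF g 1(2)] der_ract[OF g fv[OF x] a]])
  qed
qed

definition rep :: "nat \<Rightarrow> int \<Rightarrow> 'p fr set \<Rightarrow> 'p fr"
  where "rep n m Y = (SOME y. y \<in> vec n m \<and> cls n m y = Y)"

lemma rep: 
  assumes "Y \<in> carrier (T n m)"
  shows "rep n m Y \<in> vec n m" "cls n m (rep n m Y) = Y"
proof -
  have "\<exists>y. y \<in> vec n m \<and> cls n m y = Y" using cls_cases[OF assms] by metis
  from someI_ex[OF this] show "rep n m Y \<in> vec n m" "cls n m (rep n m Y) = Y" by (simp_all add: rep_def)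
qed

lemma ghom_rep:
  assumes "h \<in> bimodule_hom A (C i) (T n m)"
  shows "ghom n m i (\<lambda>x. rep n m (h x))"
proof -
  have h: "h x \<in> carrier (T n m)" if "x \<in> carrier (C i)" for x using assms that by (auto simp: bimodule_hom_def)
  have e: "cls n m (rep n m (h x)) = h x" if "x \<in> carrier (C i)" for x using rep(2)[OF h[OF that]] .
  have "(\<lambda>x. cls n m (rep n m (h x))) \<in> bimodule_hom A (C i) (T n m) \<longleftrightarrow> h \<in> bimodule_hom A (C i) (T n m)"
    by (simp add: bimodule_hom_def Pi_def e C.l_closed C.r_closed)
  with assms have "(\<lambda>x. cls n m (rep n m (h x))) \<in> bimodule_hom A (C i) (T n m)" by simp
  then show ?thesis using h by (auto simp: ghom_def rep)
qed

end

section \<open>Construction of the structure maps\<close>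

context shifted_resolution
begin

lemma ghom_d: "n \<ge> 1 \<Longrightarrow> ghom n m (i + 1) f \<Longrightarrow> ghom n m i (\<lambda>x. f (d i x))"
  by (auto simp: ghom_iff d_simps)

text \<open>The differential is a bimodule map on classes, and \<open>C i\<close> is projective.\<close>

lemma lift_boundary:
  assumes n: "n \<ge> 1" and f: "ghom n (m + 1) i f" and b: "\<And>x. x \<in> carrier (C i) \<Longrightarrow> \<exists>y\<in>vec n m. D y \<simeq> f x"
  shows "\<exists>g. ghom n m i g \<and> (\<forall>x\<in>carrier (C i). D (g x) \<simeq> f x)"
proof -
  define Dc where "Dc Y = cls n (m + 1) (D (rep n m Y))" for Y
  have Dc: "Dc (cls n m y) = cls n (m + 1) (D y)" if y: "y \<in> vec n m" for y
  proof -
    have r: "rep n m (cls n m y) \<in> vec n m" "cls n m (rep n m (cls n m y)) = cls n m y"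
      using rep[OF cls_closed[OF y]] by auto
    then have "rep n m (cls n m y) \<simeq> y" using y cls_eq_iff by blast
    then show ?thesis unfolding Dc_def using r y D_vec by (subst cls_eq_iff) (auto intro: cong_D)
  qed
  have hom: "Dc \<in> bimodule_hom A (T n m) (T n (m + 1))"
    unfolding bimodule_hom_def
  proof (intro CollectI conjI ballI Pi_I)
    fix Y assume "Y \<in> carrier (T n m)"
    then obtain y where y: "y \<in> vec n m" and Y: "Y = cls n m y" by (rule cls_cases)
    show "Dc Y \<in> carrier (T n (m + 1))" unfolding Y Dc[OF y] by (rule cls_closed[OF D_vec[OF y]])
    fix Z assume "Z \<in> carrier (T n m)"
    then obtain z where z: "z \<in> vec n m" and Z: "Z = cls n m z" by (rule cls_cases)
    show "Dc (Y \<oplus>\<^bsub>T n m\<^esub> Z) = Dc Y \<oplus>\<^bsub>T n (m + 1)\<^esub> Dc Z"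
      unfolding Y Z cls_add[OF y z, symmetric] Dc[OF y] Dc[OF z] Dc[OF vec_add[OF y z]] der_simps
      by (rule cls_add[OF D_vec[OF y] D_vec[OF z]])
  next
    fix a Y assume a: "a \<in> carrier A" and "Y \<in> carrier (T n m)"
    then obtain y where y: "y \<in> vec n m" and Y: "Y = cls n m y" by (blast elim: cls_cases)
    have "cls n (m + 1) (D (lact a y)) = cls n (m + 1) (lact a (D y))"
      using D_lact[OF y a] y a by (subst cls_eq_iff) (auto intro: D_vec lact_vec)
    then show "Dc (a \<odot>\<^bsub>T n m\<^esub> Y) = a \<odot>\<^bsub>T n (m + 1)\<^esub> Dc Y"
      unfolding Y Dc[OF y] cls_lact[OF n a y, symmetric] Dc[OF lact_vec[OF a y]] by (simp add: cls_lact[OF n a D_vec[OF y]])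
    have "cls n (m + 1) (D (ract a y)) = cls n (m + 1) (ract a (D y))"
      using D_ract[OF y a] y a by (subst cls_eq_iff) (auto intro: D_vec ract_vec)
    then show "Dc (Y \<star>\<^bsub>T n m\<^esub> a) = Dc Y \<star>\<^bsub>T n (m + 1)\<^esub> a"
      unfolding Y Dc[OF y] cls_ract[OF n a y, symmetric] Dc[OF ract_vec[OF a y]] by (simp add: cls_ract[OF n a D_vec[OF y]])
  qed
  have fh: "(\<lambda>x. cls n (m + 1) (f x)) \<in> bimodule_hom A (C i) (T n (m + 1))" using f by (simp add: ghom_def)
  have "cls n (m + 1) (f x) \<in> Dc ` carrier (T n m)" if x: "x \<in> carrier (C i)" for x
  proof -
    obtain y where y: "y \<in> vec n m" "D y \<simeq> f x" using b[OF x] by blast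
    have "cls n (m + 1) (f x) = Dc (cls n m y)"
      unfolding Dc[OF y(1)] using y D_vec[OF y(1)] ghom_vec[OF f x] by (subst cls_eq_iff) (auto intro: cong_sym)
    then show ?thesis using cls_closed[OF y(1)] by (rule image_eqI)
  qed
  from projective_lift_through[OF proj T_bimodule[OF n] T_bimodule[OF n] hom fh this]
  obtain h where h: "h \<in> bimodule_hom A (C i) (T n m)" and Dh: "\<And>x. x \<in> carrier (C i) \<Longrightarrow> Dc (h x) = cls n (m + 1) (f x)"
    by blast
  have "D (rep n m (h x)) \<simeq> f x" if x: "x \<in> carrier (C i)" for x
  proof -
    have hx: "h x \<in> carrier (T n m)" using h x by (auto simp: bimodule_hom_def)
    show ?thesis using Dh[OF x] D_vec[OF rep(1)[OF hx]] ghom_vec[OF f x] unfolding Dc_def by (simp add: cls_eq_iff)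
  qed
  with ghom_rep[OF h] show ?thesis by blast
qed

lemma regular_bimodule: "bimodule K A (regular_bimodule A)"
proof -
  have "abelian_group (regular_bimodule A)"
    by (rule abelian_groupI) (auto simp: regular_bimodule_def A.a_ac intro: A.l_neg A.a_inv_closed)
  then show ?thesis
    by (intro bimodule.intro bimodule_axioms.intro unital_algebra_axioms)
      (simp_all add: regular_bimodule_def A.l_distr A.r_distr A.m_assoc smult_mult_left smult_mult_right)
qed

text \<open>The double counit of \<open>pt \<otimes> pt\<close> is \<open>-1\<close>, since the second counit passes a factor of degree 1. Hence the double counit is
  surjective, and \<open>\<mu>\<close> lifts through it.\<close>

lemma diagonal_exists:
  "\<exists>g. ghom 2 2 1 g \<and> (\<forall>x\<in>carrier (C 1). counit 2 2 (g x) = \<mu> 1 x)"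
proof -
  have hom: "cu \<in> bimodule_hom A (T 2 2) (regular_bimodule A)"
    unfolding bimodule_hom_def
  proof (intro CollectI conjI ballI Pi_I)
    show "cu Y \<in> carrier (regular_bimodule A)" if "Y \<in> carrier (T 2 2)" for Y
      using cu_closed[OF that] by (simp add: regular_bimodule_def)
    show "cu (Y \<oplus>\<^bsub>T 2 2\<^esub> Z) = cu Y \<oplus>\<^bsub>regular_bimodule A\<^esub> cu Z" if "Y \<in> carrier (T 2 2)" "Z \<in> carrier (T 2 2)" for Y Z
      using cu_add[OF that] by (simp add: regular_bimodule_def)
    fix a Y assume a: "a \<in> carrier A" and "Y \<in> carrier (T 2 2)"
    then obtain y where y: "y \<in> vec 2 2" and Y: "Y = cls 2 2 y" by (blast elim: cls_cases)
    show "cu (a \<odot>\<^bsub>T 2 2\<^esub> Y) = a \<odot>\<^bsub>regular_bimodule A\<^esub> cu Y"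
      using counit_lact[OF _ y a] a y by (simp add: Y cls_lact[symmetric] counit_def regular_bimodule_def)
    show "cu (Y \<star>\<^bsub>T 2 2\<^esub> a) = cu Y \<star>\<^bsub>regular_bimodule A\<^esub> a"
      using counit_ract[OF _ y a] a y by (simp add: Y cls_ract[symmetric] counit_def regular_bimodule_def)
  qed
  have surj: "cu ` carrier (T 2 2) = carrier (regular_bimodule A)"
  proof
    show "cu ` carrier (T 2 2) \<subseteq> carrier (regular_bimodule A)" using hom by (auto simp: bimodule_hom_def)
    show "carrier (regular_bimodule A) \<subseteq> cu ` carrier (T 2 2)"
    proof
      fix a assume "a \<in> carrier (regular_bimodule A)"
      then have a: "a \<in> carrier A" by (simp add: regular_bimodule_def)
      let ?w = "[(1, pt), (1, pt)]"
      have w: "?w \<in> W 2 2" using pt by (simp add: tensor_words_iff)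
      have "counit 2 2 (- lact a (frag_of ?w)) = \<ominus>\<^bsub>A\<^esub> (a \<otimes>\<^bsub>A\<^esub> cw ?w)"
        using w a counit_lact[of 2 "frag_of ?w" 2 a] counit_of[OF w] by (subst counit_minus) (auto simp del: lact_of intro: lact_vec)
      also have "cw ?w = \<ominus>\<^bsub>A\<^esub> \<one>\<^bsub>A\<^esub>" by (simp add: pt koszul_def)
      finally have "a = cu (cls 2 2 (- lact a (frag_of ?w)))" using a by (simp add: counit_def A.r_minus)
      moreover have "cls 2 2 (- lact a (frag_of ?w)) \<in> carrier (T 2 2)"
        using w a by (intro cls_closed vec_minus lact_vec) simp_all
      ultimately show "a \<in> cu ` carrier (T 2 2)" by (rule image_eqI)
    qed
  qed
  have "bimodule K A (T 2 2)" by (rule T_bimodule) simp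
  from projective_bimodule_lift[OF proj this regular_bimodule hom surj \<mu>_hom]
  obtain h where h: "h \<in> bimodule_hom A (C 1) (T 2 2)" and ch: "\<And>x. x \<in> carrier (C 1) \<Longrightarrow> cu (h x) = \<mu> 1 x" by blast
  have "counit 2 2 (rep 2 2 (h x)) = \<mu> 1 x" if x: "x \<in> carrier (C 1)" for x
  proof -
    have "h x \<in> carrier (T 2 2)" using h x by (auto simp: bimodule_hom_def)
    from rep(2)[OF this] show ?thesis using ch[OF x] by (simp add: counit_def)
  qed
  with ghom_rep[OF h] show ?thesis by blast
qed

text \<open>On \<open>x \<otimes> z\<close> with both factors of degree 1, replacing \<open>x\<close> or \<open>z\<close> by its diagonal gives the counit \<open>\<mu> x \<mu> z\<close>, but the odd map
  \<open>g\<close> has to pass \<open>x\<close> in the second case. In other degrees both counits are zero.\<close>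

lemma counit_coassociator:
  assumes g: "gmap 2 g" and c: "\<And>x. x \<in> carrier (C 1) \<Longrightarrow> counit 2 2 (g 1 x) = \<mu> 1 x" and y: "y \<in> vec 2 2"
  shows "counit 3 3 (der g y) = \<zero>\<^bsub>A\<^esub>"
proof -
  have dv: "der g y \<in> vec 3 3" if "y \<in> vec 2 2" for y using that by (rule der_vec[OF g]) simp_all
  show ?thesis
  proof (rule additive_eq[OF A_abelian y])
    fix w assume "w \<in> W 2 2"
    then obtain i x j z where w: "w = [(i, x), (j, z)]" and x: "x \<in> carrier (C i)" and z: "z \<in> carrier (C j)" and ij: "i + j = 2"
      by (cases w; cases "tl w") (auto simp: tensor_words_iff)
    have gv: "g i x \<in> vec 2 (i + 1)" "g j z \<in> vec 2 (j + 1)" using gmap_vec[OF g] x z by auto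
    have dw: "der g (frag_of w) = g i x \<diamondop> letter j z + sgn_pow i (letter i x \<diamondop> g j z)"
      using der_letter_cat[of g i x "letter j z"] by (simp add: w der_letter)
    have v: "g i x \<diamondop> letter j z \<in> vec 3 3" "letter i x \<diamondop> g j z \<in> vec 3 3"
      using vec_cat'[OF gv(1) letter_vec[OF z], of 3 3] vec_cat'[OF letter_vec[OF x] gv(2), of 3 3] ij by auto
    have cl: "counit 1 i (letter i x) = \<mu> i x" "counit 1 j (letter j z) = \<mu> j z"
      using x z by (simp_all add: counit_of W_Cons W_Nil koszul_def \<mu>_simps)
    have e: "(2::nat) + 1 = 3" "(1::nat) + 2 = 3" "i + 1 + j = 3" "i + (j + 1) = 3" using ij by simp_all
    have c1: "counit 3 3 (g i x \<diamondop> letter j z) = koszul A (i + 1) (counit 2 (i + 1) (g i x) \<otimes>\<^bsub>A\<^esub> \<mu> j z)"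
      using counit_cat[OF gv(1) letter_vec[OF z]] unfolding e cl by simp
    have c2: "counit 3 3 (letter i x \<diamondop> g j z) = koszul A (2 * i) (\<mu> i x \<otimes>\<^bsub>A\<^esub> counit 2 (j + 1) (g j z))"
      using counit_cat[OF letter_vec[OF x] gv(2)] unfolding e cl by simp
    show "counit 3 3 (der g (frag_of w)) = \<zero>\<^bsub>A\<^esub>"
    proof (cases "i = 1")
      case True
      then have "j = 1" using ij by simp
      then show ?thesis unfolding dw using True x z v c c1 c2 \<mu>_simps(1)[OF x] \<mu>_simps(1)[OF z]
        by (simp add: counit_add vec_sgn_pow counit_sgn_pow) (simp add: koszul_def A.r_neg)
    next
      case False
      have "counit 2 (i + 1) (g i x) = \<zero>\<^bsub>A\<^esub>" "\<mu> i x = \<zero>\<^bsub>A\<^esub>"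
        using False counit_off_diagonal[OF gv(1)] \<mu>_zero[OF False x] by auto
      then show ?thesis unfolding dw using v c1 c2 \<mu>_simps(1)[OF z] counit_closed[OF gv(2)]
        by (simp add: counit_add vec_sgn_pow counit_sgn_pow koszul_A)
    qed
  qed (auto simp: der_simps counit_add counit_closed dv)
qed

text \<open>The terms of the relation of index \<open>N\<close> that involve only earlier maps.\<close>

definition obstr :: "(nat \<Rightarrow> int \<Rightarrow> 'p \<Rightarrow> 'p fr) \<Rightarrow> nat \<Rightarrow> int \<Rightarrow> 'p \<Rightarrow> 'p fr"
  where "obstr G N i x = (\<Sum>s=2..N-1. der (G s) (G (N + 1 - s) i x))"

text \<open>The conditions on \<open>r\<close> as the map of index \<open>N\<close>, given the earlier maps \<open>G\<close>: the prescribed map of index 1, the relation of index \<open>N\<close>, and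
  the counit condition on the diagonal. The other counit conditions follow from degrees.\<close>

definition structure_map :: "(nat \<Rightarrow> int \<Rightarrow> 'p \<Rightarrow> 'p fr) \<Rightarrow> nat \<Rightarrow> (int \<Rightarrow> 'p \<Rightarrow> 'p fr) \<Rightarrow> bool"
  where "structure_map G N r \<longleftrightarrow>
    (N = 1 \<longrightarrow> r = dl) \<and>
    (N \<ge> 2 \<longrightarrow> gmap N r \<and>
      (\<forall>i. \<forall>x\<in>carrier (C i). D (r i x) + r (i + 1) (d i x) + obstr G N i x \<simeq> 0)) \<and>
    (N = 2 \<longrightarrow> (\<forall>x\<in>carrier (C 1). counit 2 2 (r 1 x) = \<mu> 1 x))"

lemma structure_map_gmap: "structure_map G M (G M) \<Longrightarrow> M \<ge> 1 \<Longrightarrow> gmap M (G M)"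
  using gmap_dl by (cases "M = 1") (auto simp: structure_map_def)

lemma structure_map_relation:
  assumes G: "structure_map G M (G M)" "structure_map G 1 (G 1)" and M: "M \<ge> 1" and x: "x \<in> carrier (C i)"
  shows "(\<Sum>a=1..M. der (G a) (G (M + 1 - a) i x)) \<simeq> 0"
proof -
  have G1: "G 1 = dl" using G(2) by (simp add: structure_map_def)
  have e: "der g (dl i x) = g (i + 1) (d i x)" for g by (simp add: dl_def der_letter)
  show ?thesis
  proof (cases "M = 1")
    case True
    have "D (dl i x) = letter (i + 2) \<zero>\<^bsub>C (i + 2)\<^esub>"
      unfolding e dl_def[of "i + 1"] using dd_zero[OF x] by (simp add: add.assoc)
    then show ?thesis using True letter_zero[of "i + 2"] G1 by simp
  next
    case False
    then have "{1..M} = insert 1 (insert M {2..M-1})" using M by auto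
    then have "(\<Sum>a=1..M. der (G a) (G (M + 1 - a) i x)) =
        der (G 1) (G M i x) + (der (G M) (G 1 i x) + (\<Sum>a=2..M-1. der (G a) (G (M + 1 - a) i x)))"
      using M False by (simp add: sum.insert_if)
    also have "\<dots> = D (G M i x) + G M (i + 1) (d i x) + obstr G M i x"
      unfolding G1 e by (simp add: obstr_def add.assoc)
    also have "\<dots> \<simeq> 0" using G(1) M False x by (simp add: structure_map_def)
    finally show ?thesis .
  qed
qed

text \<open>The map is built downwards from degree 1. At each stage the prescribed differential is a cycle, by the relation at the previous stage
  and because the obstruction is closed; \<open>boundary_criterion\<close> then makes it a boundary.\<close>

lemma structure_map_step:
  assumes N: "N \<ge> 2" and G: "\<And>M. M < N \<Longrightarrow> structure_map G M (G M)"
  shows "\<exists>r. structure_map G N r"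
proof -
  have G1: "G 1 = dl" using G[of 1] N by (simp add: structure_map_def)
  have gm: "gmap a (G a)" if "1 \<le> a" "a < N" for a using structure_map_gmap[OF G] that by simp
  let ?o = "obstr G N"
  have oh: "ghom N (i + 2) i (?o i)" for i
    unfolding obstr_def[abs_def]
  proof (rule ghom_sum)
    fix s assume s: "s \<in> {2..N-1}"
    have "ghom (N + 1 - s) (i + 1) i (G (N + 1 - s) i)" using gm[of "N + 1 - s"] s by (auto simp: gmap_def)
    moreover have e: "N + 1 - s + s - 1 = N" "i + 1 + 1 = i + 2" "1 \<le> N + 1 - s" "1 \<le> s" "s < N" using s by auto
    ultimately show "ghom N (i + 2) i (\<lambda>x. der (G s) (G (N + 1 - s) i x))"
      using ghom_der[OF gm[OF e(4,5)] e(3), of "i + 1" i "G (N + 1 - s) i"] unfolding e(1,2) by blast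
  qed (use N in simp)
  have Do: "D (?o i x) \<simeq> ?o (i + 1) (d i x)" if x: "x \<in> carrier (C i)" for i x
  proof -
    have "der (G 1) (\<Sum>s=2..N-1. der (G s) (der (G (N + 1 - s)) (letter i x))) \<simeq>
        (\<Sum>s=2..N-1. der (G s) (der (G (N + 1 - s)) (der (G 1) (letter i x))))"
      by (rule obstruction_closed[OF N gm _ letter_vec[OF x]]) (use structure_map_relation[OF G G] N in simp_all)
    then show ?thesis by (simp only: G1 der_letter dl_def obstr_def)
  qed
  \<comment> \<open>As for the contraction, stage \<open>k\<close> concerns \<open>C (1 - k)\<close>. The differential of \<open>C 1\<close> is zero, so nothing precedes stage 0.\<close>
  define prev where "prev S k x = (if k = 0 then 0 else S (k - 1) (d (1 - int k) x))"
    for S :: "nat \<Rightarrow> 'p \<Rightarrow> 'p fr" and k x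
  define good where "good S k r \<longleftrightarrow> ghom N (2 - int k) (1 - int k) r \<and>
      (\<forall>x\<in>carrier (C (1 - int k)). D (r x) + prev S k x + ?o (1 - int k) x \<simeq> 0) \<and>
      (N = 2 \<and> k = 0 \<longrightarrow> (\<forall>x\<in>carrier (C 1). counit 2 2 (r x) = \<mu> 1 x))"
    for S :: "nat \<Rightarrow> 'p \<Rightarrow> 'p fr" and k r
  have "\<exists>S. \<forall>k. good S k (S k)"
  proof (rule dependent_wellorder_choice)
    show "good S k r = good S' k r" if "\<And>y. y < k \<Longrightarrow> S y = S' y" for r S S' k
    proof -
      have "prev S k x = prev S' k x" for x using that[of "k - 1"] by (simp add: prev_def)
      then show ?thesis by (simp add: good_def)
    qed
    fix k and S :: "nat \<Rightarrow> 'p \<Rightarrow> 'p fr" assume IH: "\<And>y. y < k \<Longrightarrow> good S y (S y)"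
    define j where "j = 1 - int k"
    have j2: "2 - int k = j + 1" and N1: "N \<ge> 1" and j1: "j \<le> 1" using N by (simp_all add: j_def)
    have kprev: "k \<noteq> 0 \<Longrightarrow> 1 - int (k - 1) = j + 1" "k \<noteq> 0 \<Longrightarrow> 2 - int (k - 1) = j + 2" by (auto simp: j_def)
    show "\<exists>r. good S k r"
    proof (cases "N = 2 \<and> k = 0")
      case True
      obtain g where g: "ghom 2 2 1 g" and c: "\<And>x. x \<in> carrier (C 1) \<Longrightarrow> counit 2 2 (g x) = \<mu> 1 x"
        using diagonal_exists by blast
      have "D (g x) \<simeq> 0" if "x \<in> carrier (C 1)" for x
        using above_top[OF D_vec[OF ghom_vec[OF g that]]] by (simp add: cong_zero_iff)
      then have "good S k g" using True g c by (simp add: good_def prev_def obstr_def)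
      then show ?thesis by blast
    next
      case False
      have ph: "ghom N (j + 2) j (prev S k)"
      proof (cases "k = 0")
        case True
        then show ?thesis using ghom_null[OF N1] by (simp add: prev_def[abs_def])
      next
        case k0: False
        have "good S (k - 1) (S (k - 1))" using IH[of "k - 1"] k0 by simp
        then have "ghom N (j + 2) (j + 1) (S (k - 1))" unfolding good_def kprev[OF k0] by blast
        then show ?thesis using ghom_d[OF N1, of "j + 2" j "S (k - 1)"] k0 by (simp add: prev_def[abs_def] j_def)
      qed
      let ?f = "\<lambda>x. - (prev S k x + ?o j x)"
      have e2: "j + 1 + 1 = j + 2" and e3: "j + 2 - 1 = j + 1" by simp_all
      have fh: "ghom N (j + 1 + 1) j ?f" unfolding e2 by (intro ghom_uminus[OF N1] ghom_plus[OF N1] ph oh)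
      have bd: "\<exists>y\<in>vec N (j + 1). D y \<simeq> ?f x" if x: "x \<in> carrier (C j)" for x
      proof -
        have pv: "prev S k x \<in> vec N (j + 2)" and ov: "?o j x \<in> vec N (j + 2)"
          using ghom_vec[OF ph x] ghom_vec[OF oh x] .
        have Dp: "D (prev S k x) \<simeq> - ?o (j + 1) (d j x)"
        proof (cases "k = 0")
          case True
          then have j: "j = 1" by (simp add: j_def)
          have "d j x = \<zero>\<^bsub>C (j + 1)\<^esub>" using in_top[OF _ d_simps(1)[OF x]] j by simp
          then have "?o (j + 1) (d j x) \<simeq> 0" using ghom_zero[OF oh N1] by simp
          then show ?thesis using cong_sym[OF cong_minus[of "?o (j + 1) (d j x)" 0]] True by (simp add: prev_def der_simps)
        next
          case k0: False
          have dx: "d j x \<in> carrier (C (j + 1))" by (rule d_simps(1)[OF x])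
          have "good S (k - 1) (S (k - 1))" using IH[of "k - 1"] k0 by simp
          then have "D (S (k - 1) (d j x)) + prev S (k - 1) (d j x) + ?o (j + 1) (d j x) \<simeq> 0"
            using dx unfolding good_def kprev[OF k0] by blast
          moreover have "prev S (k - 1) (d j x) \<simeq> 0"
          proof (cases "k = 1")
            case False
            then have k2: "1 - int (k - 2) = j + 2" "1 - int (k - 1) = j + 1" "k - 1 - 1 = k - 2" "k - 1 \<noteq> 0"
              using k0 by (auto simp: j_def)
            have "good S (k - 2) (S (k - 2))" using IH[of "k - 2"] k0 by simp
            then have "ghom N (2 - int (k - 2)) (j + 2) (S (k - 2))" unfolding good_def k2 by blast
            from ghom_zero[OF this N1] show ?thesis
              unfolding prev_def k2(2,3) dd_zero[OF x] using k2(4) by simp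
          qed (simp add: prev_def)
          ultimately have "D (S (k - 1) (d j x)) + prev S (k - 1) (d j x) + ?o (j + 1) (d j x)
              - prev S (k - 1) (d j x) - ?o (j + 1) (d j x) \<simeq> 0 - 0 - ?o (j + 1) (d j x)"
            by (intro cong_diff cong_refl)
          then show ?thesis using k0 by (simp add: prev_def j_def algebra_simps)
        qed
        have "D (?f x) \<in> rel"
          using cong_minus[OF cong_add[OF Dp Do[OF x]]] by (simp add: der_simps cong_zero_iff)
        moreover have "counit N (j + 2) (?f x) = \<zero>\<^bsub>A\<^esub>" if jN: "j + 2 = int N"
        proof -
          have fv: "prev S k x + ?o j x \<in> vec N (j + 2)" using pv ov by (rule vec_add)
          \<comment> \<open>Since \<open>j \<le> 1\<close> and \<open>N \<ge> 2\<close>, only the two cases below are left.\<close>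
          have "counit N (j + 2) (prev S k x) = \<zero>\<^bsub>A\<^esub> \<and> counit N (j + 2) (?o j x) = \<zero>\<^bsub>A\<^esub>"
          proof (cases "N = 2")
            case True
            then have j: "j = 0" and k: "k = 1" using jN by (simp_all add: j_def)
            have "good S 0 (S 0)" using IH[of 0] k by simp
            then have "counit 2 2 (S 0 (d 0 x)) = \<mu> 1 (d 0 x)"
              using True d_simps(1)[OF x] unfolding good_def j by simp
            then show ?thesis using \<mu>d_zero[OF x] True j k by (simp add: prev_def obstr_def counit_zero)
          next
            case False
            then have N3: "N = 3" and j: "j = 1" and k: "k = 0" using jN j1 N by (auto simp: j_def)
            have g2: "structure_map G 2 (G 2)" using G N3 by simp
            have "counit 3 3 (der (G 2) (G 2 1 x)) = \<zero>\<^bsub>A\<^esub>"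
              by (rule counit_coassociator[OF structure_map_gmap[OF g2]])
                (use g2 gmap_vec[OF structure_map_gmap[OF g2], of x 1] x j in \<open>simp_all add: structure_map_def\<close>)
            moreover have "?o 1 x = der (G 2) (G 2 1 x)" by (simp add: obstr_def N3)
            ultimately show ?thesis using N3 j k by (simp add: prev_def counit_zero)
          qed
          then show ?thesis using fv pv ov by (simp only: counit_minus counit_add) simp
        qed
        ultimately show ?thesis
          using boundary_criterion[OF N1, of "?f x" "j + 2"] vec_minus[OF vec_add[OF pv ov]]
          unfolding e3 by blast
      qed
      obtain g where g: "ghom N (j + 1) j g" and Dg: "\<And>x. x \<in> carrier (C j) \<Longrightarrow> D (g x) \<simeq> ?f x"
        using lift_boundary[OF N1 fh bd] by blast
      have "D (g x) + prev S k x + ?o j x \<simeq> 0" if "x \<in> carrier (C j)" for x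
        using Dg[OF that] by (simp add: cong_def algebra_simps)
      then have "good S k g" using g False unfolding good_def j_def[symmetric] j2 by blast
      then show ?thesis by blast
    qed
  qed
  then obtain S where S: "\<And>k. good S k (S k)" by blast
  \<comment> \<open>Above degree 1 the complex is zero.\<close>
  define r where "r i = (if i \<le> 1 then S (nat (1 - i)) else (\<lambda>x. 0))" for i
  have rh: "ghom N (i + 1) i (r i)" for i
  proof (cases "i \<le> 1")
    case True
    have e: "2 - int (nat (1 - i)) = i + 1" "1 - int (nat (1 - i)) = i" using True by auto
    have "good S (nat (1 - i)) (S (nat (1 - i)))" by (rule S)
    then have "ghom N (i + 1) i (S (nat (1 - i)))" unfolding good_def e by blast
    then show ?thesis using True by (simp add: r_def)
  next
    case False
    then show ?thesis using ghom_null[of N] N by (simp add: r_def)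
  qed
  have "D (r i x) + r (i + 1) (d i x) + ?o i x \<simeq> 0" if x: "x \<in> carrier (C i)" for i x
  proof (cases "i \<le> 1")
    case True
    let ?k = "nat (1 - i)"
    have k: "1 - int ?k = i" using True by auto
    have "good S ?k (S ?k)" by (rule S)
    then have "D (S ?k x) + prev S ?k x + ?o i x \<simeq> 0" using x unfolding good_def k by blast
    moreover have "prev S ?k x = r (i + 1) (d i x)"
    proof (cases "i = 1")
      case False
      then have "nat (1 - (i + 1)) = ?k - 1" "?k \<noteq> 0" using True by auto
      then show ?thesis using False True k by (simp add: prev_def r_def)
    qed (simp add: prev_def r_def)
    ultimately show ?thesis using True by (simp add: r_def)
  next
    case False
    then have "x = \<zero>\<^bsub>C i\<^esub>" using in_top x by simp
    then have "?o i x \<simeq> 0" using ghom_zero[OF oh] N by simp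
    then show ?thesis using False by (simp add: r_def der_simps)
  qed
  moreover have "counit 2 2 (r 1 x) = \<mu> 1 x" if "N = 2" "x \<in> carrier (C 1)" for x
    using S[of 0] that by (simp add: good_def r_def)
  ultimately have "structure_map G N r" using N rh by (auto simp: structure_map_def gmap_def)
  then show ?thesis by blast
qed

lemma structure_maps_exist: "\<exists>G. \<forall>N. structure_map G N (G N)"
proof (rule dependent_wellorder_choice)
  show "structure_map f N r = structure_map g N r" if "\<And>M. M < N \<Longrightarrow> f M = g M" for r f g N
  proof -
    have "obstr f N i x = obstr g N i x" for i x
      unfolding obstr_def using that by (intro sum.cong) auto
    then show ?thesis by (simp add: structure_map_def)
  qed
  fix N and G :: "nat \<Rightarrow> int \<Rightarrow> 'p \<Rightarrow> 'p fr"
  assume G: "\<And>M. M < N \<Longrightarrow> structure_map G M (G M)"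
  show "\<exists>r. structure_map G N r"
  proof (cases "N \<ge> 2")
    case True
    then show ?thesis by (rule structure_map_step[OF _ G])
  next
    case False
    then show ?thesis by (auto simp: structure_map_def)
  qed
qed

text \<open>For fixed \<open>s\<close>, the terms of the relation add up to the derivation that extends the map of index \<open>s\<close>.\<close>

lemma relation_sum:
  assumes G: "\<And>s. s \<ge> 1 \<Longrightarrow> gmap s (G s)" and N: "N \<ge> 1" and x: "x \<in> carrier (C i)"
  shows "(\<Oplus>\<^bsub>T N (i + 2)\<^esub> p \<in> {(r, s, t). r + s + t = N \<and> s \<ge> 1}.
      case p of (r, s, t) \<Rightarrow>
        id_tensor_id A C r s t (\<lambda>i x. cls s (i + 1) (G s i x)) (i + 1) (cls (N - s + 1) (i + 1) (G (N - s + 1) i x)))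
    = cls N (i + 2) (\<Sum>s=1..N. der (G s) (G (N + 1 - s) i x))"
proof -
  interpret T: abelian_group "T N (i + 2)" by (rule T_abelian)
  let ?I = "{(r, s, t). r + s + t = N \<and> s \<ge> 1}"
  let ?F = "\<lambda>(r, s, t). ins (G s) r (G (N + 1 - s) i x)"
  have fin: "finite ?I" by (rule finite_subset[of _ "{..N} \<times> {..N} \<times> {..N}"]) auto
  have Gv: "G (N + 1 - s) i x \<in> vec (N + 1 - s) (i + 1)" if "s \<le> N" for s
    using gmap_vec[OF G x] that by simp
  have Fv: "?F p \<in> vec N (i + 2)" if "p \<in> ?I" for p
  proof -
    obtain r s t where p: "p = (r, s, t)" by (cases p)
    show ?thesis unfolding p split_conv
      by (rule ins_vec[OF G Gv]) (use that p in auto)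
  qed
  have "(\<Oplus>\<^bsub>T N (i + 2)\<^esub> p \<in> ?I.
      case p of (r, s, t) \<Rightarrow>
        id_tensor_id A C r s t (\<lambda>i x. cls s (i + 1) (G s i x)) (i + 1) (cls (N - s + 1) (i + 1) (G (N - s + 1) i x)))
    = (\<Oplus>\<^bsub>T N (i + 2)\<^esub> p \<in> ?I. cls N (i + 2) (?F p))"
  proof (rule T.finsum_cong')
    fix p assume pI: "p \<in> ?I"
    obtain r s t where p: "p = (r, s, t)" by (cases p)
    have rst: "r + s + t = N" "s \<ge> 1" "N - s + 1 = r + 1 + t" "N + 1 - s = r + 1 + t" "i + 1 + 1 = i + 2" using pI p by auto
    have "G (r + 1 + t) i x \<in> vec (r + 1 + t) (i + 1)" by (rule gmap_vec[OF G x]) simp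
    from id_tensor_id_cls[OF G[OF rst(2)] _ this, of "\<lambda>i x. cls s (i + 1) (G s i x)"]
    show "(case p of (r, s, t) \<Rightarrow>
        id_tensor_id A C r s t (\<lambda>i x. cls s (i + 1) (G s i x)) (i + 1) (cls (N - s + 1) (i + 1) (G (N - s + 1) i x)))
       = cls N (i + 2) (?F p)"
      unfolding p split_conv rst(3,4) rst(5) rst(1) by simp
  qed (use Fv cls_closed in \<open>auto simp del: split_paired_All\<close>)
  also have "\<dots> = cls N (i + 2) (\<Sum>p\<in>?I. ?F p)"
    by (rule cls_sum[OF fin Fv, symmetric])
  also have "(\<Sum>p\<in>?I. ?F p) = (\<Sum>s=1..N. \<Sum>r<N + 1 - s. ins (G s) r (G (N + 1 - s) i x))"
    unfolding sum.Sigma[OF finite_atLeastAtMost ballI[OF finite_lessThan]]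
    by (rule sum.reindex_bij_witness[of _ "\<lambda>(s, r). (r, s, N - s - r)" "\<lambda>(r, s, t). (s, r)"]) auto
  also have "\<dots> = (\<Sum>s=1..N. der (G s) (G (N + 1 - s) i x))"
    by (rule sum.cong[OF refl], rule der_sum_ins[symmetric, OF G Gv]) auto
  finally show ?thesis .
qed

lemma counit_hom: "graded_hom A (-1) C (in_degree_zero A) \<mu>"
  unfolding graded_hom_def
proof
  fix i
  show "\<mu> i \<in> bimodule_hom A (C i) (in_degree_zero A (i + - 1))"
  proof (cases "i = 1")
    case True
    then show ?thesis using \<mu>_hom by (simp add: in_degree_zero_def)
  next
    case False
    then show ?thesis
      by (auto simp: bimodule_hom_def in_degree_zero_def regular_bimodule_def \<mu>_zero C.l_closed C.r_closed)
  qed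
qed

lemma coalgebra_structure:
  "\<exists>\<delta>. weakly_counital_A_infinity_coalgebra K A C \<delta> \<mu> \<and>
    (\<forall>i. \<forall>x\<in>carrier (C i). \<delta> 1 i x = tensor A C 1 (i + 1) [(i + 1, d i x)])"
proof -
  obtain G where G: "\<And>N. structure_map G N (G N)" using structure_maps_exist by blast
  define \<delta> where "\<delta> n i x = cls n (i + 1) (G n i x)" for n i x
  have gm: "gmap s (G s)" if "s \<ge> 1" for s using structure_map_gmap[OF G that] .
  have hom: "graded_hom A 1 C (T n) (\<delta> n)" if "n \<ge> 1" for n
    using gm[OF that] by (simp add: graded_hom_def gmap_def ghom_def \<delta>_def[abs_def])
  have rels: "(\<Oplus>\<^bsub>T N (i + 2)\<^esub> p \<in> {(r, s, t). r + s + t = N \<and> s \<ge> 1}.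
        case p of (r, s, t) \<Rightarrow> id_tensor_id A C r s t (\<delta> s) (i + 1) (\<delta> (N - s + 1) i x)) = \<zero>\<^bsub>T N (i + 2)\<^esub>"
    if N: "N \<ge> 1" and x: "x \<in> carrier (C i)" for N i x
  proof -
    have v: "(\<Sum>s=1..N. der (G s) (G (N + 1 - s) i x)) \<in> vec N (i + 2)"
    proof (rule vec_sum)
      fix s assume s: "s \<in> {1..N}"
      have v: "G (N + 1 - s) i x \<in> vec (N + 1 - s) (i + 1)" by (rule gmap_vec[OF gm x]) (use s in auto)
      show "der (G s) (G (N + 1 - s) i x) \<in> vec N (i + 2)" by (rule der_vec[OF gm v]) (use s in auto)
    qed
    have "cls N (i + 2) (\<Sum>s=1..N. der (G s) (G (N + 1 - s) i x)) = cls N (i + 2) 0"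
      using structure_map_relation[OF G G N x] v by (subst cls_eq_iff) auto
    then show ?thesis
      using relation_sum[where G = G and N = N and i = i and x = x, OF gm N x]
      by (simp only: \<delta>_def[abs_def] cls_zero)
  qed
  have Gz: "G n i x \<simeq> 0" if "i > 1" "x \<in> carrier (C i)" "n \<ge> 1" for n i x
  proof -
    have "ghom n (i + 1) i (G n i)" using gm[OF that(3)] by (simp add: gmap_def)
    from ghom_zero[OF this that(3)] show ?thesis using in_top[OF that(1,2)] by simp
  qed
  have \<delta>c: "cu (\<delta> n i x) = counit n (i + 1) (G n i x)" for n i x by (simp add: \<delta>_def counit_def)
  have off: "counit n (i + 1) (G n i x) = \<zero>\<^bsub>A\<^esub>" if x: "x \<in> carrier (C i)" and n: "n \<ge> 2" and ni: "n > 2 \<or> i \<noteq> 1" for n i x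
  proof -
    have v: "G n i x \<in> vec n (i + 1)" using gmap_vec[OF gm x] n by simp
    show ?thesis
    proof (cases "i > 1")
      case True
      then show ?thesis using counit_cong[OF v vec_zero Gz[OF True x]] n counit_zero by simp
    next
      case False
      then show ?thesis using n ni by (intro counit_off_diagonal[OF v]) auto
    qed
  qed
  have "cu (\<delta> 2 i x) = \<mu> i x" if x: "x \<in> carrier (C i)" for i x
  proof (cases "i = 1")
    case True
    then show ?thesis using G[of 2] x unfolding \<delta>c by (simp add: structure_map_def)
  next
    case False
    then show ?thesis unfolding \<delta>c using off[OF x] \<mu>_zero[OF False x] by simp
  qed
  moreover have "cu (\<delta> n i x) = \<zero>\<^bsub>A\<^esub>" if "n > 2" "x \<in> carrier (C i)" for n i x
    unfolding \<delta>c using off[OF that(2)] that(1) by simp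
  ultimately have "weakly_counital_A_infinity_coalgebra K A C \<delta> \<mu>"
    unfolding weakly_counital_A_infinity_coalgebra_def A_infinity_coalgebra_def
    using bimodules hom rels counit_hom by blast
  moreover have "\<delta> 1 i x = tensor A C 1 (i + 1) [(i + 1, d i x)]" for i x
    using G[of 1] by (simp add: structure_map_def \<delta>_def dl_def cls_of)
  ultimately show ?thesis by blast
qed

end

lemma bimodule_hom_cong:
  assumes "bimodule K A X" and f: "\<And>x. x \<in> carrier X \<Longrightarrow> f x = f' x"
  shows "f \<in> bimodule_hom A X Y \<longleftrightarrow> f' \<in> bimodule_hom A X Y"
proof -
  interpret X: bimodule K A X by fact
  show ?thesis by (simp add: bimodule_hom_def Pi_def f X.l_closed X.r_closed)
qed

theorem theorem3p1p1:
  fixes K :: "('k, 'y) ring_scheme"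
    and A :: "('k, 'a, 'z) module_scheme"
    and P :: "int \<Rightarrow> ('a, 'p) bimodule"
    and d\<^sub>P :: "int \<Rightarrow> 'p \<Rightarrow> 'p"
    and \<mu>\<^sub>P :: "int \<Rightarrow> 'p \<Rightarrow> 'a"
  assumes "unital_algebra K A"
    and "shifted_projective_resolution K A P d\<^sub>P \<mu>\<^sub>P"
  shows "\<exists>\<delta>. weakly_counital_A_infinity_coalgebra K A P \<delta> \<mu>\<^sub>P \<and>
    (\<forall>i. \<forall>x\<in>carrier (P i). \<delta> 1 i x = tensor A P 1 (i + 1) [(i + 1, d\<^sub>P i x)])"
proof -
  obtain P' d' \<epsilon> where res: "projective_resolution K A P' d' \<epsilon>"
    and P: "\<And>i. P i = P' (i - 1)" and d: "\<And>i x. x \<in> carrier (P i) \<Longrightarrow> d\<^sub>P i x = d' (i - 1) x"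
    and \<mu>: "\<And>i x. x \<in> carrier (P i) \<Longrightarrow> \<mu>\<^sub>P i x = (if i = 1 then \<epsilon> x else \<zero>\<^bsub>A\<^esub>)"
    using assms(2) unfolding shifted_projective_resolution_def by blast
  note R = res[unfolded projective_resolution_def]
  have proj: "projective_bimodule K A (P i)" for i using R P by simp
  have bim: "bimodule K A (P i)" for i using proj[of i] by (simp add: projective_bimodule_def)
  interpret S: shifted_resolution K A P d\<^sub>P \<mu>\<^sub>P
  proof (intro shifted_resolution.intro bimodule_family.intro bimodule_family_axioms.intro
      shifted_resolution_axioms.intro assms(1) bim proj)
    show "carrier (P i) = {\<zero>\<^bsub>P i\<^esub>}" if "i > 1" for i using R that by (simp add: P)
    show "d\<^sub>P i \<in> bimodule_hom A (P i) (P (i + 1))" for i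
    proof -
      have "d' (i - 1) \<in> bimodule_hom A (P' (i - 1)) (P' (i - 1 + 1))" using R unfolding graded_hom_def by blast
      then have "d' (i - 1) \<in> bimodule_hom A (P i) (P (i + 1))" by (simp add: P)
      then show ?thesis using bimodule_hom_cong[OF bim, of i "d\<^sub>P i" "d' (i - 1)"] d by blast
    qed
    have \<epsilon>: "\<epsilon> \<in> bimodule_hom A (P 1) (regular_bimodule A)" using R by (simp add: P)
    have \<mu>1: "\<mu>\<^sub>P 1 x = \<epsilon> x" if "x \<in> carrier (P 1)" for x using \<mu>[OF that] by simp
    show "\<mu>\<^sub>P 1 \<in> bimodule_hom A (P 1) (regular_bimodule A)" using \<epsilon> bimodule_hom_cong[OF bim, of 1 "\<mu>\<^sub>P 1" \<epsilon>] \<mu>1 by blast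
    have "\<mu>\<^sub>P 1 ` carrier (P 1) = \<epsilon> ` carrier (P 1)" using \<mu>1 by (rule image_cong[OF refl])
    then show "\<mu>\<^sub>P 1 ` carrier (P 1) = carrier A" using R by (simp add: P)
    show "\<mu>\<^sub>P i x = \<zero>\<^bsub>A\<^esub>" if "i \<noteq> 1" "x \<in> carrier (P i)" for i x using \<mu> that by simp
    have d0: "d\<^sub>P i ` carrier (P i) = d' (i - 1) ` carrier (P i)" for i using d by (rule image_cong[OF refl])
    have "{x \<in> carrier (P 1). \<mu>\<^sub>P 1 x = \<zero>\<^bsub>A\<^esub>} = a_kernel (P' 0) A \<epsilon>"
      using \<mu>1 by (auto simp: a_kernel_def' P)
    also have "\<dots> = d' (-1) ` carrier (P' (-1))" using R by blast
    also have "\<dots> = d\<^sub>P 0 ` carrier (P 0)" unfolding d0 by (simp add: P)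
    finally show "{x \<in> carrier (P 1). \<mu>\<^sub>P 1 x = \<zero>\<^bsub>A\<^esub>} = d\<^sub>P 0 ` carrier (P 0)" .
    show "{x \<in> carrier (P i). d\<^sub>P i x = \<zero>\<^bsub>P (i + 1)\<^esub>} = d\<^sub>P (i - 1) ` carrier (P (i - 1))" if "i < 1" for i
    proof -
      have "{x \<in> carrier (P i). d\<^sub>P i x = \<zero>\<^bsub>P (i + 1)\<^esub>} = {x \<in> carrier (P i). d' (i - 1) x = \<zero>\<^bsub>P (i + 1)\<^esub>}"
        using d by auto
      also have "\<dots> = a_kernel (P' (i - 1)) (P' (i - 1 + 1)) (d' (i - 1))"
        by (simp add: a_kernel_def' P)
      also have "\<dots> = d' (i - 1 - 1) ` carrier (P' (i - 1 - 1))"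
      proof -
        have "i - 1 < 0" using that by simp
        then show ?thesis using R by blast
      qed
      also have "\<dots> = d\<^sub>P (i - 1) ` carrier (P (i - 1))" unfolding d0 by (simp add: P)
      finally show ?thesis .
    qed
  qed
  show ?thesis by (rule S.coalgebra_structure)
qed

end
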